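(* Let $X\in\{A,B,C,D\}$. For $w\in W(X)$ put $\psi^w:=\Phi^X(\mathcal G^X_w)\in \mathrm{Fun}(W(X),R^{b,\bar b})$ (for $X=A$, $\mathcal G^A_w=\mathcal G^A_w(a,b)$; for $X=B,C,D$, $\mathcal G^X_w=\mathcal G^X_w(a,b;x)$). Then the family $(\psi^w)_{w\in W(X)}$ satisfies: (i) $\psi^w(e)=\delta_{w,e}$ for all $w$; (ii) for all $w,v\in W(X)$ and every simple reflection $s_i\in I^X$ with $s_iv<v$, $$\psi^w(v)=\begin{cases} s_i^{(b)}\big(\psi^w(s_iv)\big) & \text{if } s_iw>w,\\ (1+\beta\alpha_i(b))\,s_i^{(b)}\big(\psi^w(s_iv)\big)+\alpha_i(b)\,s_i^{(b)}\big(\psi^{s_iw}(s_iv)\big) & \text{if } s_iw<w.\end{cases}$$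
   Context: Let $\beta$ be an indeterminate. For elements $x,y$ of a commutative $\mathbb Z[\beta]$-algebra (where the needed denominators are invertible) put $x\oplus y=x+y+\beta xy$, $x\ominus y=(x-y)/(1+\beta y)$, $\bar x=\ominus x=-x/(1+\beta x)$. Weyl groups: $W(A_{n-1})=S_n$ generated by $s_1,\dots,s_{n-1}$ ($s_i=(i,i+1)$); $W(B_n)=W(C_n)$ is the group of signed permutations $w=[w(1),\dots,w(n)]$ of $\{\pm1,\dots,\pm n\}$ (write $\bar i=-i$), generated by $s_0$ (sign change of the first entry) and $s_1,\dots,s_{n-1}$, with $(s_0s_1)^4=1$, $(s_0s_i)^2=1$ ($i\ge2$); $W(D_n)$ is the subgroup generated by $s_{\hat1}:=s_0s_1s_0,s_1,\dots,s_{n-1}$. $W(X)=\bigcup_nW(X_n)$ via natural inclusions (signed permutations fixing all $i>n$), $I^X$ its simple reflections, $\ell$ length, $\le$ Bruhat order. IdCoxeter algebra $\mathrm{Id}_\beta(W)$: the $\mathbb Z[\beta]$-algebra with generators $u_i$ ($s_i\in I^X$), relations $u_i^2=\beta u_i$ and the braid relations $u_iu_ju_i\cdots=u_ju_iu_j\cdots$ ($m_{ij}$ factors each side, $m_{ij}$ the order of $s_is_j$); $u_w=u_{i_1}\cdots u_{i_\ell}$ for a reduced word $w=s_{i_1}\cdots s_{i_\ell}$; $\{u_w\}$ is a basis. All variables commute with the $u_i$. Put $h_i(x)=1+xu_i$, $A^{(n)}_i(x)=h_{n-1}(x)h_{n-2}(x)\cdots h_i(x)$, $G_{A_{n-1}}(a_1,\dots,a_{n-1})=A^{(n)}_1(a_1)A^{(n)}_2(a_2)\cdots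 A^{(n)}_{n-1}(a_{n-1})$, $F^B_n(x)=h_{n-1}(x)\cdots h_1(x)h_0(x)h_1(x)\cdots h_{n-1}(x)$, $F^C_n(x)$ the same with $h_0(x)$ replaced by $h_0(x)^2$, $F^D_n(x)=h_{n-1}(x)\cdots h_2(x)h_1(x)h_{\hat1}(x)h_2(x)\cdots h_{n-1}(x)$, and $F^X_n(x_1,\dots,x_n)=\prod_{i=1}^nF^X_n(x_i)$. For $w\in S_n$, $\mathcal G^A_w(a,b)$ is the coefficient of $u_w$ in $G_{A_{n-1}}(\bar b_1,\dots,\bar b_{n-1})^{-1}G_{A_{n-1}}(a_1,\dots,a_{n-1})$ (independent of $n$). For $X\in\{B,C,D\}$ and $w\in W(X)$, $\mathcal G^X_w(a,b;x)$ is the coefficient of $u_w$ in $G_A(\bar b)^{-1}F^X_\infty(x)G_A(a)$, where $G_A(a)=\lim_nG_{A_{n-1}}(a_1,\dots,a_{n-1})$ and $F^X_\infty(x)=\lim_nF^X_n(x_1,\dots,x_n)$, $x=(x_1,x_2,\dots)$; its coefficients in the $x$ are $\beta$-supersymmetric functions (symmetric functions $f$ with $f(t,\bar t,x_3,\dots)=f(0,0,x_3,\dots)$). Let $R^{b,\bar b}=\mathbb Z[\beta][b_1,\bar b_1,b_2,\bar b_2,\dots]$ with $\bar b_i=-b_i/(1+\beta b_i)$, and $b_{-j}:=\bar b_j$. Action: $s^{(b)}_i$ ($i\ge1$) swaps $b_i\leftrightarrow b_{i+1}$; $s^{(b)}_0$ swaps $b_1\leftrightarrow\bar b_1$; $s^{(b)}_{\hat1}$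 maps $b_1\mapsto\bar b_2$, $b_2\mapsto\bar b_1$; other $b_k$ fixed. Roots: $\alpha_i(b)=b_i\oplus\bar b_{i+1}$ ($i\ge1$), $\alpha_0(b)=\bar b_1$ (type $B$), $\alpha_0(b)=\bar b_1\oplus\bar b_1$ (type $C$), $\alpha_{\hat1}(b)=\bar b_1\oplus\bar b_2$. Localization map: for $f$ a polynomial in $a_1,a_2,\dots$ (and, for $X=B,C,D$, with coefficients in $R^{b,\bar b}\otimes$ $\beta$-supersymmetric functions of $x$) and $v\in W(X)$, $\Phi^X(f)(v)\in R^{b,\bar b}$ is obtained by substituting $a_i\mapsto\overline{b_{v(i)}}$ for all $i$ and, for $X=B,C,D$, $x_i\mapsto b_{v(i)}$ if $v(i)<0$ and $x_i\mapsto0$ if $v(i)>0$. *)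

theory Defs
  imports "HOL-Library.Poly_Mapping" "HOL-Computational_Algebra.Fraction_Field"
    "HOL-Computational_Algebra.Polynomial"
begin

section \<open>Weyl groups\<close>

datatype cox_type = TypeA | TypeB | TypeC | TypeD

text \<open>
  \<open>Gen i\<close> is the index \<open>i\<close>, and \<open>GenHat1\<close> is the index \<open>1\<close> with a hat.
\<close>

datatype gen = Gen nat | GenHat1

fun gens :: "cox_type \<Rightarrow> gen set" where
  "gens TypeA = {Gen i | i. 1 \<le> i}"
| "gens TypeB = {Gen i | i. True}"
| "gens TypeC = {Gen i | i. True}"
| "gens TypeD = {GenHat1} \<union> {Gen i | i. 1 \<le> i}"

text \<open>
  A signed permutation is an odd bijection of the integers with finite support; it is determined
  by its values on the positive integers.  A permutation of the positive integers is identified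
  with the signed permutation that extends it.
\<close>

definition signed_perm :: "(int \<Rightarrow> int) \<Rightarrow> bool" where
  "signed_perm w \<longleftrightarrow> bij w \<and> (\<forall>k. w (- k) = - w k) \<and> finite {k. w k \<noteq> k}"

definition sgn_change1 :: "int \<Rightarrow> int" where
  "sgn_change1 k = (if \<bar>k\<bar> = 1 then - k else k)"

definition adj_swap :: "nat \<Rightarrow> int \<Rightarrow> int" where
  "adj_swap i k =
     (if \<bar>k\<bar> = int i then sgn k * (int i + 1)
      else if \<bar>k\<bar> = int i + 1 then sgn k * int i else k)"

fun simple_refl :: "gen \<Rightarrow> int \<Rightarrow> int" where
  "simple_refl (Gen i) = (if i = 0 then sgn_change1 else adj_swap i)"
| "simple_refl GenHat1 = sgn_change1 \<circ> adj_swap 1 \<circ> sgn_change1"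

definition word_prod :: "gen list \<Rightarrow> int \<Rightarrow> int" where
  "word_prod ws = foldr (\<circ>) (map simple_refl ws) id"

fun Weyl :: "cox_type \<Rightarrow> (int \<Rightarrow> int) set" where
  "Weyl TypeA = {w. signed_perm w \<and> (\<forall>k>0. w k > 0)}"
| "Weyl TypeB = {w. signed_perm w}"
| "Weyl TypeC = {w. signed_perm w}"
| "Weyl TypeD = {word_prod ws | ws. set ws \<subseteq> gens TypeD}"

definition cox_len :: "cox_type \<Rightarrow> (int \<Rightarrow> int) \<Rightarrow> nat" where
  "cox_len X w = (LEAST l. \<exists>ws. set ws \<subseteq> gens X \<and> word_prod ws = w \<and> length ws = l)"

definition reduced_word :: "cox_type \<Rightarrow> (int \<Rightarrow> int) \<Rightarrow> gen list \<Rightarrow> bool" where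
  "reduced_word X w ws \<longleftrightarrow> set ws \<subseteq> gens X \<and> word_prod ws = w \<and> length ws = cox_len X w"

definition reflections :: "cox_type \<Rightarrow> (int \<Rightarrow> int) set" where
  "reflections X = {u \<circ> simple_refl g \<circ> inv u | u g. u \<in> Weyl X \<and> g \<in> gens X}"

definition bruhat_step :: "cox_type \<Rightarrow> (int \<Rightarrow> int) \<Rightarrow> (int \<Rightarrow> int) \<Rightarrow> bool" where
  "bruhat_step X u w \<longleftrightarrow>
     u \<in> Weyl X \<and> (\<exists>t\<in>reflections X. w = u \<circ> t) \<and> cox_len X u < cox_len X w"

definition bruhat_le :: "cox_type \<Rightarrow> (int \<Rightarrow> int) \<Rightarrow> (int \<Rightarrow> int) \<Rightarrow> bool" where
  "bruhat_le X = (bruhat_step X)\<^sup>*\<^sup>*"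

definition bruhat_less :: "cox_type \<Rightarrow> (int \<Rightarrow> int) \<Rightarrow> (int \<Rightarrow> int) \<Rightarrow> bool" where
  "bruhat_less X u w \<longleftrightarrow> bruhat_le X u w \<and> u \<noteq> w"

definition cox_m :: "gen \<Rightarrow> gen \<Rightarrow> nat" where
  "cox_m g g' = (LEAST m. 0 < m \<and> (simple_refl g \<circ> simple_refl g') ^^ m = id)"


section \<open>The base ring\<close>

text \<open>
  \<open>base\<close> is the fraction field of \<open>\<int>[\<beta>][b\<^sub>1, b\<^sub>2, \<dots>]\<close>, with \<open>\<int>[\<beta>]\<close> represented by
  \<^typ>\<open>int poly\<close>.  The ring \<open>Rb\<close> below, a subring of it, is the one called \<open>R\<close> with exponents
  \<open>b\<close> and \<open>b bar\<close>.  The polynomial variable number \<open>j\<close> stands for \<open>b\<^sub>j\<^sub>+\<^sub>1\<close>, so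
  that there is no superfluous variable.
\<close>

type_synonym base = "((nat \<Rightarrow>\<^sub>0 nat) \<Rightarrow>\<^sub>0 int poly) fract"

definition zbeta :: "int poly \<Rightarrow> base" where
  "zbeta c = Fraction_Field.Fract (Poly_Mapping.single 0 c) 1"

definition beta :: base where
  "beta = zbeta [:0, 1:]"

definition oplus :: "base \<Rightarrow> base \<Rightarrow> base" where
  "oplus x y = x + y + beta * x * y"

definition bar :: "base \<Rightarrow> base" where
  "bar x = - x / (1 + beta * x)"

definition b_pos :: "nat \<Rightarrow> base" where
  "b_pos i = Fraction_Field.Fract (Poly_Mapping.single (Poly_Mapping.single (i - 1) 1) 1) 1"

text \<open>
  The convention \<open>b\<^sub>-\<^sub>j\<close> = \<open>b\<^sub>j bar\<close>; the index \<open>0\<close> is never used.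
\<close>

definition b_var :: "int \<Rightarrow> base" where
  "b_var k = (if k > 0 then b_pos (nat k) else bar (b_pos (nat (- k))))"

inductive_set Rb :: "base set" where
  zbeta: "zbeta c \<in> Rb"
| b_var: "k \<noteq> 0 \<Longrightarrow> b_var k \<in> Rb"
| add: "x \<in> Rb \<Longrightarrow> y \<in> Rb \<Longrightarrow> x + y \<in> Rb"
| mult: "x \<in> Rb \<Longrightarrow> y \<in> Rb \<Longrightarrow> x * y \<in> Rb"

definition ring_endo :: "(base \<Rightarrow> base) \<Rightarrow> bool" where
  "ring_endo f \<longleftrightarrow>
     f 1 = 1 \<and> (\<forall>x y. f (x + y) = f x + f y) \<and> (\<forall>x y. f (x * y) = f x * f y)"

text \<open>
  The action of a simple reflection on the \<open>b\<close> variables.  By \<open>b\<^sub>-\<^sub>j\<close> = \<open>b\<^sub>j bar\<close> all the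
  prescriptions (swap \<open>b\<^sub>i\<close> and \<open>b\<^sub>i\<^sub>+\<^sub>1\<close>; swap \<open>b\<^sub>1\<close> and \<open>b\<^sub>-\<^sub>1\<close>;
  send \<open>b\<^sub>1\<close> to \<open>b\<^sub>-\<^sub>2\<close> and \<open>b\<^sub>2\<close> to \<open>b\<^sub>-\<^sub>1\<close>) read \<open>b\<^sub>k \<mapsto> b\<^bsub>s(k)\<^esub>\<close>.
  The endomorphism is described on the whole fraction field and restricts to \<open>Rb\<close>.
\<close>

definition b_act :: "gen \<Rightarrow> base \<Rightarrow> base" where
  "b_act g = (THE f. ring_endo f \<and> f beta = beta \<and> (\<forall>k>0. f (b_var k) = b_var (simple_refl g k)))"

definition simple_root :: "cox_type \<Rightarrow> gen \<Rightarrow> base" where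
  "simple_root X g =
     (case g of
        Gen i \<Rightarrow>
          if i = 0 then (if X = TypeC then oplus (bar (b_var 1)) (bar (b_var 1)) else bar (b_var 1))
          else oplus (b_var (int i)) (bar (b_var (int i + 1)))
      | GenHat1 \<Rightarrow> oplus (bar (b_var 1)) (bar (b_var 2)))"


section \<open>The IdCoxeter algebra\<close>

datatype axvar = VarA nat | VarX nat

type_synonym coef = "(axvar \<Rightarrow>\<^sub>0 nat) \<Rightarrow>\<^sub>0 base"

definition const_coef :: "base \<Rightarrow> coef" where
  "const_coef c = Poly_Mapping.single 0 c"

definition var_coef :: "axvar \<Rightarrow> coef" where
  "var_coef y = Poly_Mapping.single (Poly_Mapping.single y 1) 1"

text \<open>
  Words under concatenation, written additively so that \<open>word \<Rightarrow>\<^sub>0 coef\<close> carries the library's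
  monoid algebra structure: it is the free \<open>coef\<close>-algebra on the generators.
\<close>

datatype word = Word (letters: "gen list")

instantiation word :: monoid_add
begin

definition zero_word :: word where
  "0 = Word []"

definition plus_word :: "word \<Rightarrow> word \<Rightarrow> word" where
  "p + q = Word (letters p @ letters q)"

instance
  by standard (simp_all add: zero_word_def plus_word_def)

end

type_synonym free_alg = "word \<Rightarrow>\<^sub>0 coef"

definition scalar :: "coef \<Rightarrow> free_alg" where
  "scalar c = Poly_Mapping.single 0 c"

definition u_word :: "gen list \<Rightarrow> free_alg" where
  "u_word ws = Poly_Mapping.single (Word ws) 1"

fun alternating :: "gen \<Rightarrow> gen \<Rightarrow> nat \<Rightarrow> gen list" where
  "alternating g g' 0 = []"
| "alternating g g' (Suc m) = g # alternating g' g m"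

text \<open>
  Elements of the IdCoxeter algebra are represented by elements of the free algebra modulo the
  two-sided ideal \<open>id_ideal\<close>.  All symbols of type \<^typ>\<open>gen\<close> are present in the free algebra;
  those that are not generators for the given type are killed.
\<close>

inductive_set id_relators :: "cox_type \<Rightarrow> free_alg set" for X :: cox_type where
  square: "g \<in> gens X \<Longrightarrow>
    u_word [g, g] - scalar (const_coef beta) * u_word [g] \<in> id_relators X"
| braid: "g \<in> gens X \<Longrightarrow> g' \<in> gens X \<Longrightarrow> g \<noteq> g' \<Longrightarrow>
    u_word (alternating g g' (cox_m g g')) - u_word (alternating g' g (cox_m g g'))
      \<in> id_relators X"
| unused: "g \<notin> gens X \<Longrightarrow> u_word [g] \<in> id_relators X"

inductive_set id_ideal :: "cox_type \<Rightarrow> free_alg set" for X :: cox_type where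
  zero: "0 \<in> id_ideal X"
| step: "z \<in> id_ideal X \<Longrightarrow> r \<in> id_relators X \<Longrightarrow> z + p * r * q \<in> id_ideal X"

definition u_elem :: "cox_type \<Rightarrow> (int \<Rightarrow> int) \<Rightarrow> free_alg" where
  "u_elem X w = u_word (SOME ws. reduced_word X w ws)"

definition id_coeff :: "cox_type \<Rightarrow> free_alg \<Rightarrow> (int \<Rightarrow> int) \<Rightarrow> coef" where
  "id_coeff X z =
     (THE c. finite {w. c w \<noteq> 0} \<and> {w. c w \<noteq> 0} \<subseteq> Weyl X \<and>
        z - (\<Sum>w\<in>{w. c w \<noteq> 0}. scalar (c w) * u_elem X w) \<in> id_ideal X)"

text \<open>
  A representative of the inverse in the quotient; its class is unique.
\<close>

definition id_inverse :: "cox_type \<Rightarrow> free_alg \<Rightarrow> free_alg" where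
  "id_inverse X z = (SOME y. y * z - 1 \<in> id_ideal X \<and> z * y - 1 \<in> id_ideal X)"


section \<open>Double Grothendieck polynomials\<close>

definition h_op :: "gen \<Rightarrow> coef \<Rightarrow> free_alg" where
  "h_op g x = 1 + scalar x * u_word [g]"

definition A_op :: "nat \<Rightarrow> nat \<Rightarrow> coef \<Rightarrow> free_alg" where
  "A_op n i x = prod_list (map (\<lambda>j. h_op (Gen j) x) (rev [i..<n]))"

text \<open>
  \<open>G_op n\<close> is \<open>G\<close> of type \<open>A\<^bsub>n-1\<^esub>\<close>.
\<close>

definition G_op :: "nat \<Rightarrow> (nat \<Rightarrow> coef) \<Rightarrow> free_alg" where
  "G_op n a = prod_list (map (\<lambda>i. A_op n i (a i)) [1..<n])"

text \<open>
  For type \<open>A\<close> there is no factor \<open>F\<close>.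
\<close>

fun F_op :: "cox_type \<Rightarrow> nat \<Rightarrow> coef \<Rightarrow> free_alg" where
  "F_op TypeA n x = 1"
| "F_op TypeB n x =
     prod_list (map (\<lambda>j. h_op (Gen j) x) (rev [1..<n])) * h_op (Gen 0) x
       * prod_list (map (\<lambda>j. h_op (Gen j) x) [1..<n])"
| "F_op TypeC n x =
     prod_list (map (\<lambda>j. h_op (Gen j) x) (rev [1..<n])) * (h_op (Gen 0) x)\<^sup>2
       * prod_list (map (\<lambda>j. h_op (Gen j) x) [1..<n])"
| "F_op TypeD n x =
     prod_list (map (\<lambda>j. h_op (Gen j) x) (rev [1..<n])) * h_op GenHat1 x
       * prod_list (map (\<lambda>j. h_op (Gen j) x) [2..<n])"

definition F_prod :: "cox_type \<Rightarrow> nat \<Rightarrow> (nat \<Rightarrow> coef) \<Rightarrow> free_alg" where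
  "F_prod X n x = prod_list (map (\<lambda>i. F_op X n (x i)) [1..<n+1])"

definition Groth_fin :: "cox_type \<Rightarrow> nat \<Rightarrow> (int \<Rightarrow> int) \<Rightarrow> coef" where
  "Groth_fin X n =
     id_coeff X
       (id_inverse X (G_op n (\<lambda>i. const_coef (bar (b_var (int i)))))
         * F_prod X n (\<lambda>i. var_coef (VarX i))
         * G_op n (\<lambda>i. var_coef (VarA i)))"

text \<open>
  A formal series in the \<open>a\<close> and \<open>x\<close> variables is the function giving its coefficients.
  Limits are taken in the completed algebra of formal sums of the \<open>u\<^sub>w\<close> with formal series as
  coefficients, where convergence means that each coefficient of each \<open>u\<^sub>w\<close> is eventually
  constant.  Multiplication is continuous there, because only finitely many pairs
  \<open>(u\<^sub>v, u\<^sub>v\<^sub>')\<close> have a product that is a multiple of a given \<open>u\<^sub>w\<close>; so the product of the limits is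
  the limit of the products.  For type \<open>A\<close> the sequence of \<open>u\<^sub>w\<close>-coefficients itself is eventually
  constant, with the double Grothendieck polynomial as its value.
\<close>

type_synonym series = "(axvar \<Rightarrow>\<^sub>0 nat) \<Rightarrow> base"

definition eventual_value :: "(nat \<Rightarrow> base) \<Rightarrow> base" where
  "eventual_value f = (THE c. \<forall>\<^sub>F n in sequentially. f n = c)"

definition Groth :: "cox_type \<Rightarrow> (int \<Rightarrow> int) \<Rightarrow> series" where
  "Groth X w m = eventual_value (\<lambda>n. Poly_Mapping.lookup (Groth_fin X n w) m)"


section \<open>Localization\<close>

fun loc_subst :: "(int \<Rightarrow> int) \<Rightarrow> axvar \<Rightarrow> base" where
  "loc_subst v (VarA i) = bar (b_var (v (int i)))"
| "loc_subst v (VarX i) = (if v (int i) < 0 then b_var (v (int i)) else 0)"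

definition mono_value :: "(axvar \<Rightarrow> base) \<Rightarrow> (axvar \<Rightarrow>\<^sub>0 nat) \<Rightarrow> base" where
  "mono_value s m = (\<Prod>y\<in>Poly_Mapping.keys m. s y ^ Poly_Mapping.lookup m y)"

text \<open>
  Only finitely many \<open>x\<^sub>i\<close> are substituted by something nonzero, so for the series in question
  only finitely many summands are nonzero.
\<close>

definition Phi :: "series \<Rightarrow> (int \<Rightarrow> int) \<Rightarrow> base" where
  "Phi f v = (\<Sum>m. f m * mono_value (loc_subst v) m)"

definition psi :: "cox_type \<Rightarrow> (int \<Rightarrow> int) \<Rightarrow> (int \<Rightarrow> int) \<Rightarrow> base" where
  "psi X w = Phi (Groth X w)"

end

theory Submission
  imports Defs
begin

text \<open>
  Evaluating at \<open>v\<close>, \<open>\<psi>\<^sup>w(v)\<close> is the coefficient of \<open>u\<^sub>w\<close> in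
  \<open>\<Psi>\<^sub>v = G(b bar)\<^sup>-\<^sup>1 \<cdot> \<Prod>\<^bsub>v(i)<0\<^esub> F(b\<^bsub>v(i)\<^esub>) \<cdot> G(b\<^bsub>v(1)\<^esub> bar, b\<^bsub>v(2)\<^esub> bar, \<dots>)\<close>.
  The action of \<open>s\<^sub>i\<close> on the \<open>b\<close> variables carries the last factor for \<open>s\<^sub>iv\<close> to the one for \<open>v\<close>
  and changes the middle one by \<open>F(b\<^sub>1 bar)\<close> (for \<open>s\<^sub>0\<close>) or \<open>F(b\<^sub>1 bar) F(b\<^sub>2 bar)\<close> (for \<open>s\<^sub>1 hat\<close>), because
  the \<open>F(x)\<close> commute and \<open>F(x) F(x bar) = 1\<close>.  The Yang-Baxter equations give
  \<open>C \<cdot> G(s\<^sub>i b bar) = G(b bar) \<cdot> h\<^sub>i(\<alpha>\<^sub>i(b))\<close> for this correction factor \<open>C\<close>, hence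
  \<open>\<Psi>\<^sub>v = h\<^sub>i(\<alpha>\<^sub>i(b)) \<cdot> s\<^sub>i(\<Psi>\<^bsub>s\<^sub>iv\<^esub>)\<close>, and the recursion is the coefficient of \<open>u\<^sub>w\<close> in this identity.

  Coefficients are computed in the left regular representation, by operators on functions on the
  Weyl group; that it is well defined and faithful on the \<open>u\<^sub>w\<close> rests on the exchange property.
\<close>

section \<open>Words and lengths\<close>

text \<open>Several objects are given by description operators and must first be made computable.
  \<open>id_coeff\<close> needs the \<open>u_elem X w\<close> to be a basis of the quotient:
  independence of the reduced word and spanning come from braid moves, linear independence from the
  operators, which send \<open>delta_id\<close> to \<open>delta w\<close>. \<open>b_act\<close>
  needs the substitution b_k -> b_{s(k)} to extend to fractions, hence to be injective on
  polynomials. \<open>Groth\<close> is a coefficientwise limit. If w and v fix everything above N,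
  localization kills each monomial containing some x_i with i > N, and letters of index at least N
  do not affect the coefficient of u_w, so rank N already gives the exact value.

  One N has to serve w, v, s_g w and s_g v, to leave room for the letter after g, and to be at least
  3 because in type D the commutation of the F passes through \<open>Gen 2\<close>. From then on all
  identities are finite rearrangements in a monoid of operators over \<open>base\<close>. The Bruhat
  hypotheses become statements about \<open>desc\<close> by comparing lengths.\<close>

lemma simple_refl_GenHat1:
  "simple_refl GenHat1 k = (if k = 1 then -2 else if k = 2 then -1 else if k = -1 then 2 else if k = -2 then 1 else k)"
  by (auto simp: sgn_change1_def adj_swap_def abs_if)

lemma simple_refl_Gen:
  "simple_refl (Gen i) k = (if i = 0 then (if k = 1 then -1 else if k = -1 then 1 else k)
     else if k = int i then int i + 1 else if k = int i + 1 then int i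
     else if k = - int i then - (int i + 1) else if k = - (int i + 1) then - int i else k)"
  by (auto simp: sgn_change1_def adj_swap_def abs_if)

lemmas simple_refl_eq = simple_refl_Gen simple_refl_GenHat1

declare simple_refl.simps [simp del]

lemma simple_refl_invol [simp]: "simple_refl g (simple_refl g k) = k"
  by (cases g) (auto simp: simple_refl_eq)

lemma simple_refl_comp_invol [simp]: "simple_refl g \<circ> simple_refl g = id"
  by (auto simp: fun_eq_iff)

lemma simple_refl_cancel_left [simp]: "simple_refl g \<circ> (simple_refl g \<circ> w) = w"
  by (auto simp: fun_eq_iff)

lemma simple_refl_eq_iff: "simple_refl g k = l \<longleftrightarrow> k = simple_refl g l"
  by auto

lemma simple_refl_odd: "simple_refl g (- k) = - simple_refl g k"
  by (cases g) (auto simp: simple_refl_eq)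

lemma bij_simple_refl [simp]: "bij (simple_refl g)"
  by (rule o_bij[of "simple_refl g"]) simp_all

lemma simple_refl_fixes: "\<exists>N. \<forall>k. \<bar>k\<bar> > int N \<longrightarrow> simple_refl g k = k"
proof (cases g)
  case (Gen i)
  then show ?thesis by (intro exI[of _ "Suc i"]) (auto simp: simple_refl_eq)
next
  case GenHat1
  then show ?thesis by (intro exI[of _ 2]) (auto simp: simple_refl_eq)
qed

text \<open>Finite support with an explicit bound: a signed permutation with this property lies in
  the group of rank \<open>N\<close>. Such a bound later takes the place of the limit over
  n.\<close>

definition fixes_above :: "nat \<Rightarrow> (int \<Rightarrow> int) \<Rightarrow> bool" where
  "fixes_above N w \<longleftrightarrow> (\<forall>k. \<bar>k\<bar> > int N \<longrightarrow> w k = k)"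

lemma fixes_above_mono: "fixes_above N w \<Longrightarrow> N \<le> M \<Longrightarrow> fixes_above M w"
  by (auto simp: fixes_above_def)

lemma finite_moved_iff: "finite {k. w k \<noteq> k} \<longleftrightarrow> (\<exists>N. fixes_above N w)"
proof
  assume fin: "finite {k. w k \<noteq> k}"
  define N where "N = Max (insert 0 ((\<lambda>k. nat \<bar>k\<bar>) ` {k. w k \<noteq> k}))"
  have "fixes_above N w"
    unfolding fixes_above_def
  proof (intro allI impI)
    fix k :: int assume k: "int N < \<bar>k\<bar>"
    show "w k = k"
    proof (rule ccontr)
      assume "w k \<noteq> k"
      then have "nat \<bar>k\<bar> \<le> N"
        unfolding N_def using fin by (intro Max_ge) auto
      with k show False by simp
    qed
  qed
  then show "\<exists>N. fixes_above N w" ..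
next
  assume "\<exists>N. fixes_above N w"
  then obtain N where "fixes_above N w" ..
  then have "{k. w k \<noteq> k} \<subseteq> {- int N..int N}"
    by (force simp: fixes_above_def)
  then show "finite {k. w k \<noteq> k}" by (rule finite_subset) simp
qed

lemma signed_perm_iff:
  "signed_perm w \<longleftrightarrow> bij w \<and> (\<forall>k. w (- k) = - w k) \<and> (\<exists>N. fixes_above N w)"
  unfolding signed_perm_def finite_moved_iff ..

lemma signed_perm_bij: "signed_perm w \<Longrightarrow> bij w"
  and signed_perm_odd: "signed_perm w \<Longrightarrow> w (- k) = - w k"
  by (auto simp: signed_perm_def)

lemma signed_perm_0: "signed_perm w \<Longrightarrow> w 0 = 0"
  using signed_perm_odd[of w 0] by simp

lemma signed_perm_eq_0_iff: "signed_perm w \<Longrightarrow> w k = 0 \<longleftrightarrow> k = 0"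
  by (metis signed_perm_0 signed_perm_bij bij_is_inj injD)

lemma signed_perm_id [simp]: "signed_perm id"
  by (simp add: signed_perm_def)

lemma signed_perm_simple_refl [simp]: "signed_perm (simple_refl g)"
  using simple_refl_fixes[of g] by (auto simp: signed_perm_iff simple_refl_odd fixes_above_def)

lemma signed_perm_comp: "signed_perm v \<Longrightarrow> signed_perm w \<Longrightarrow> signed_perm (v \<circ> w)"
proof -
  assume v: "signed_perm v" and w: "signed_perm w"
  obtain M N where "fixes_above M v" "fixes_above N w"
    using v w by (auto simp: signed_perm_iff)
  then have "fixes_above (max M N) (v \<circ> w)" by (auto simp: fixes_above_def)
  then show ?thesis using v w by (auto simp: signed_perm_iff intro: bij_comp)
qed

lemma signed_perm_inv:
  assumes "signed_perm w" shows "signed_perm (inv w)"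
proof -
  note b = signed_perm_bij[OF assms]
  have 1: "inv w (- k) = - inv w k" for k
    by (metis b bij_inv_eq_iff signed_perm_odd[OF assms])
  obtain N where "fixes_above N w" using assms by (auto simp: signed_perm_iff)
  then have "fixes_above N (inv w)"
    unfolding fixes_above_def by (metis b bij_inv_eq_iff)
  then show ?thesis using 1 b by (auto simp: signed_perm_iff bij_imp_bij_inv)
qed

lemma fixes_above_inv: "bij w \<Longrightarrow> fixes_above N w \<Longrightarrow> fixes_above N (inv w)"
  unfolding fixes_above_def by (metis bij_inv_eq_iff)

lemma fixes_above_bound:
  assumes "bij w" "fixes_above N w" "\<bar>k\<bar> \<le> int N" shows "\<bar>w k\<bar> \<le> int N"
proof (rule ccontr)
  assume a: "\<not> ?thesis"
  then have "w (w k) = w k" using assms(2) by (auto simp: fixes_above_def)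
  then have "w k = k" using assms(1) by (metis bij_is_inj injD)
  with a assms(3) show False by simp
qed

lemma inv_simple_refl_comp: "bij w \<Longrightarrow> inv (simple_refl g \<circ> w) = inv w \<circ> simple_refl g"
  by (simp add: o_inv_distrib inv_unique_comp[of "simple_refl g" "simple_refl g"])

lemma word_prod_Nil [simp]: "word_prod [] = id"
  and word_prod_Cons [simp]: "word_prod (g # ws) = simple_refl g \<circ> word_prod ws"
  by (simp_all add: word_prod_def)

lemma word_prod_append [simp]: "word_prod (us @ vs) = word_prod us \<circ> word_prod vs"
  by (induction us) (simp_all add: o_assoc)

lemma signed_perm_word_prod [simp]: "signed_perm (word_prod ws)"
proof (induction ws)
  case Nil
  show "signed_perm (word_prod [])" by simp
next
  case (Cons g ws)
  then show "signed_perm (word_prod (g # ws))" by (simp only: word_prod_Cons signed_perm_comp signed_perm_simple_refl)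
qed

lemma Weyl_signed_perm: "w \<in> Weyl X \<Longrightarrow> signed_perm w"
  by (cases X) auto

lemma Weyl_bij: "w \<in> Weyl X \<Longrightarrow> bij w"
  by (rule signed_perm_bij[OF Weyl_signed_perm])

lemma id_Weyl [simp]: "id \<in> Weyl X"
  by (cases X) (auto intro!: exI[of _ "[]"])

lemma simple_refl_Weyl:
  assumes "g \<in> gens X" "w \<in> Weyl X" shows "simple_refl g \<circ> w \<in> Weyl X"
proof (cases X)
  case TypeA
  with assms obtain i where "g = Gen i" "i \<ge> 1" by auto
  with TypeA assms show ?thesis
    by (auto intro!: signed_perm_comp simp: simple_refl_Gen)
next
  case TypeD
  with assms obtain ws where "w = word_prod ws" "set ws \<subseteq> gens TypeD" by auto
  with TypeD assms show ?thesis by (auto intro!: exI[of _ "g # ws"])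
qed (use assms in \<open>auto intro!: signed_perm_comp\<close>)

lemma word_prod_Weyl: "set ws \<subseteq> gens X \<Longrightarrow> word_prod ws \<in> Weyl X"
  by (induction ws) (auto intro!: simple_refl_Weyl simp del: gens.simps)

section \<open>Roots, reflections and the exchange condition\<close>

text \<open>The roots are the pairs \<open>(p, q)\<close> of nonzero integers, standing for \<open>e\<^sub>q - e\<^sub>p\<close> with
  \<open>e\<^sub>-\<^sub>p = - e\<^sub>p\<close>, so that \<open>(p, q)\<close> and \<open>(-q, -p)\<close> are the same root.  A root is positive if
  \<open>p < q\<close>.\<close>

fun root_pair :: "gen \<Rightarrow> int \<times> int" where
  "root_pair (Gen i) = (if i = 0 then (-1, 1) else (int i, int i + 1))"
| "root_pair GenHat1 = (-2, 1)"

text \<open>A left descent in terms of roots: the inverse of \<open>w\<close> makes the simple root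
  of \<open>g\<close> negative. \<open>desc_iff_cox_len\<close> identifies this with a drop in
  length.\<close>

definition desc :: "gen \<Rightarrow> (int \<Rightarrow> int) \<Rightarrow> bool" where
  "desc g w \<longleftrightarrow> inv w (fst (root_pair g)) > inv w (snd (root_pair g))"

text \<open>In type A the product has to be positive, not both entries, so that
  \<open>(p, q)\<close> and \<open>(-q, -p)\<close> are roots together. Types B and C also have
  \<open>(-p, p)\<close>, which type D excludes.\<close>

fun is_root :: "cox_type \<Rightarrow> int \<Rightarrow> int \<Rightarrow> bool" where
  "is_root TypeA p q \<longleftrightarrow> p \<noteq> q \<and> p * q > 0"
| "is_root TypeB p q \<longleftrightarrow> p \<noteq> q \<and> p \<noteq> 0 \<and> q \<noteq> 0"
| "is_root TypeC p q \<longleftrightarrow> p \<noteq> q \<and> p \<noteq> 0 \<and> q \<noteq> 0"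
| "is_root TypeD p q \<longleftrightarrow> p \<noteq> q \<and> p \<noteq> 0 \<and> q \<noteq> 0 \<and> p \<noteq> - q"

text \<open>The reflection in the root \<open>(p, q)\<close>, acting through both of its
  names.\<close>

definition pair_swap :: "int \<Rightarrow> int \<Rightarrow> int \<Rightarrow> int" where
  "pair_swap p q k = (if k = p then q else if k = q then p else if k = - p then - q
     else if k = - q then - p else k)"

lemma pair_swap_root_pair: "pair_swap (fst (root_pair g)) (snd (root_pair g)) = simple_refl g"
  by (cases g) (auto simp: fun_eq_iff pair_swap_def simple_refl_eq)

text \<open>Conjugating a reflection by a simple reflection moves its root; oddness takes care of
  the entries -p and -q.\<close>

lemma pair_swap_conj:
  "simple_refl g \<circ> pair_swap (simple_refl g p) (simple_refl g q) = pair_swap p q \<circ> simple_refl g"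
proof
  fix k
  have "simple_refl g k = - p \<longleftrightarrow> k = - simple_refl g p" for p
    by (metis simple_refl_invol simple_refl_odd)
  then show "(simple_refl g \<circ> pair_swap (simple_refl g p) (simple_refl g q)) k
      = (pair_swap p q \<circ> simple_refl g) k"
    by (auto simp: pair_swap_def simple_refl_odd simple_refl_eq_iff)
qed

lemma is_root_pair: "g \<in> gens X \<Longrightarrow> is_root X (fst (root_pair g)) (snd (root_pair g))"
  by (cases X; cases g) auto

lemma root_pair_less: "fst (root_pair g) < snd (root_pair g)"
  by (cases g) auto

lemma is_root_simple_refl:
  assumes "g \<in> gens X" "is_root X p q" shows "is_root X (simple_refl g p) (simple_refl g q)"
proof -
  have *: "simple_refl g p = 0 \<longleftrightarrow> p = 0" for p
    using signed_perm_eq_0_iff[OF signed_perm_simple_refl] .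
  have neg: "simple_refl g p = - simple_refl g q \<longleftrightarrow> p = - q" for p q
    by (metis simple_refl_invol simple_refl_odd)
  have inj: "simple_refl g p = simple_refl g q \<longleftrightarrow> p = q" for p q
    by (metis simple_refl_invol)
  show ?thesis
  proof (cases X)
    case TypeA
    with assms obtain i where "g = Gen i" "i \<ge> 1" by auto
    then have "simple_refl g p > 0 \<longleftrightarrow> p > 0" "simple_refl g p < 0 \<longleftrightarrow> p < 0" for p
      by (auto simp: simple_refl_Gen)
    with TypeA assms(2) inj show ?thesis by (auto simp: zero_less_mult_iff)
  qed (use assms in \<open>simp_all add: * neg inj\<close>)
qed

text \<open>A simple reflection makes only its own simple root negative. Since a root has two names,
  the pair is \<open>root_pair g\<close> or its negated reversal, and both define the same
  reflection.\<close>

lemma inverted_root: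
  assumes "g \<in> gens X" "is_root X p q" "p < q" "simple_refl g p > simple_refl g q"
  shows "pair_swap p q = simple_refl g"
proof -
  have "(p, q) = root_pair g \<or> (- q, - p) = root_pair g"
  proof (cases g)
    case (Gen i)
    have "p \<noteq> 0" "q \<noteq> 0" using assms(2) by (cases X; auto)+
    then show ?thesis using assms(3,4) unfolding Gen
      by (cases "i = 0") (simp_all add: simple_refl_Gen split: if_splits)
  next
    case GenHat1
    \<comment> \<open>The type matters: in types B and C the pairs (-1, 1) and (-2, 2) are roots
      that this reflection also makes negative.\<close>
    then have "X = TypeD" using assms(1) by (cases X) auto
    then show ?thesis using assms(2-4) unfolding GenHat1
      by (simp add: simple_refl_GenHat1 split: if_splits)
  qed
  moreover have "p \<noteq> 0" "q \<noteq> 0" using assms(2) by (cases X; auto)+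
  then have "pair_swap (- q) (- p) = pair_swap p q"
    by (auto simp: pair_swap_def fun_eq_iff)
  ultimately show ?thesis
    using pair_swap_root_pair[of g] by (metis fst_conv snd_conv)
qed

text \<open>The root is followed letter by letter. It starts positive and ends negative, so some
  letter \<open>h\<close> makes it negative; just before, it is the simple root of \<open>h\<close>
  by \<open>inverted_root\<close>, and conjugating back by the prefix \<open>us\<close> gives the
  equation.\<close>

lemma exchange_roots:
  assumes "set ws \<subseteq> gens X" "is_root X p q" "p < q"
    "inv (word_prod ws) p > inv (word_prod ws) q"
  shows "\<exists>us h vs. ws = us @ h # vs \<and> pair_swap p q \<circ> word_prod us = word_prod us \<circ> simple_refl h"
  using assms
proof (induction ws arbitrary: p q)
  case Nil
  then show ?case by simp
next
  case (Cons h ws)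
  let ?s = "simple_refl h"
  have bij: "bij (word_prod ws)" by (rule signed_perm_bij) simp
  show ?case
  proof (cases "?s p < ?s q")
    case True
    have "h \<in> gens X" "set ws \<subseteq> gens X" using Cons.prems(1) by auto
    moreover have "inv (word_prod ws) (?s p) > inv (word_prod ws) (?s q)"
    proof -
      have "inv (word_prod (h # ws)) p > inv (word_prod (h # ws)) q" by (rule Cons.prems(4))
      then show ?thesis by (simp only: word_prod_Cons inv_simple_refl_comp[OF bij] o_apply)
    qed
    ultimately obtain us h' vs where *: "ws = us @ h' # vs"
      "pair_swap (?s p) (?s q) \<circ> word_prod us = word_prod us \<circ> simple_refl h'"
      using Cons.IH is_root_simple_refl Cons.prems(2) True by blast
    have "pair_swap p q \<circ> word_prod (h # us) = pair_swap p q \<circ> ?s \<circ> word_prod us"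
      by (simp add: o_assoc)
    also have "\<dots> = ?s \<circ> (pair_swap (?s p) (?s q) \<circ> word_prod us)"
      by (simp add: pair_swap_conj[symmetric] o_assoc)
    also have "\<dots> = word_prod (h # us) \<circ> simple_refl h'"
      unfolding *(2) by (simp add: o_assoc)
    finally have "pair_swap p q \<circ> word_prod (h # us) = word_prod (h # us) \<circ> simple_refl h'" .
    moreover have "h # ws = (h # us) @ h' # vs" using *(1) by simp
    ultimately show ?thesis by blast
  next
    case False
    moreover have "?s p \<noteq> ?s q" using Cons.prems by (metis simple_refl_invol less_irrefl)
    ultimately have "pair_swap p q = ?s"
      using Cons.prems by (intro inverted_root[of h X]) auto
    then show ?thesis by (intro exI[of _ "[]"]) auto
  qed
qed

text \<open>The letter \<open>h\<close> found by \<open>exchange_roots\<close> cancels: s_g us h vs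
  = us h h vs = us vs.\<close>

lemma exchange:
  assumes "set ws \<subseteq> gens X" "g \<in> gens X" "desc g (word_prod ws)"
  shows "\<exists>us. set us \<subseteq> gens X \<and> word_prod us = simple_refl g \<circ> word_prod ws
     \<and> Suc (length us) = length ws"
proof -
  obtain us h vs where *: "ws = us @ h # vs"
    "simple_refl g \<circ> word_prod us = word_prod us \<circ> simple_refl h"
    using exchange_roots[OF assms(1) is_root_pair[OF assms(2)] root_pair_less] assms(3)
    by (auto simp: desc_def pair_swap_root_pair)
  have "simple_refl g \<circ> word_prod ws
      = (simple_refl g \<circ> word_prod us) \<circ> (simple_refl h \<circ> word_prod vs)"
    by (simp add: * o_assoc)
  also have "\<dots> = word_prod (us @ vs)"
    unfolding *(2) by (simp add: fun_eq_iff)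
  finally show ?thesis using * assms(1) by (intro exI[of _ "us @ vs"]) auto
qed

section \<open>Existence of reduced words\<close>

text \<open>Integer values that increase strictly from y 1 > 0 satisfy y k >= k; equality far out,
  where \<open>y\<close> fixes everything, forces y k <= k.\<close>

lemma strict_mono_signed_perm_id:
  assumes y: "signed_perm y" and pos: "y 1 > 0" and inc: "\<And>k. k \<ge> 1 \<Longrightarrow> y k < y (k + 1)"
  shows "y = id"
proof -
  obtain N where N: "fixes_above N y" using y by (auto simp: signed_perm_iff)
  have diff: "y (1 + int n + int d) \<ge> y (1 + int n) + int d" for n d
  proof (induction d)
    case (Suc d)
    have "y (1 + int n + int d) < y (1 + int n + int d + 1)" by (rule inc) simp
    with Suc show ?case by (simp add: algebra_simps)
  qed simp
  have id: "y k = k" if "k \<ge> 1" for k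
  proof -
    define n where "n = nat (k - 1)"
    have k: "k = 1 + int n" using that by (simp add: n_def)
    have "y k \<ge> k" using diff[of 0 n] pos k by simp
    moreover have "y (1 + int n + int N) = 1 + int n + int N"
      using N by (auto simp: fixes_above_def)
    then have "y k \<le> k" using diff[of n N] k by simp
    ultimately show ?thesis by simp
  qed
  have "y k = k" for k
    using id[of k] id[of "- k"] signed_perm_0[OF y] signed_perm_odd[OF y, of k]
    by (cases "k > 0"; cases "k = 0") auto
  then show ?thesis by auto
qed

text \<open>Without a descent, \<open>inv w\<close> increases on the positive integers. It is
  positive at 1, because \<open>w\<close> preserves signs in type A and because \<open>Gen 0\<close>
  is no descent in types B and C, so it is the identity.\<close>

lemma exists_desc:
  assumes "w \<in> Weyl X" "X \<noteq> TypeD" "w \<noteq> id"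
  shows "\<exists>i. Gen i \<in> gens X \<and> desc (Gen i) w"
proof (rule ccontr)
  assume no: "\<not> ?thesis"
  note sp = Weyl_signed_perm[OF assms(1)]
  let ?y = "inv w"
  have yinj: "?y a = ?y b \<longleftrightarrow> a = b" for a b
    using bij_imp_bij_inv[OF signed_perm_bij[OF sp]] by (metis bij_is_inj injD)
  have "?y k < ?y (k + 1)" if "k \<ge> 1" for k
  proof -
    have "Gen (nat k) \<in> gens X" using assms that by (cases X) auto
    with no have "\<not> desc (Gen (nat k)) w" by auto
    with that have "?y k \<le> ?y (k + 1)" by (auto simp: desc_def)
    then show ?thesis using yinj[of k "k + 1"] by simp
  qed
  moreover have "?y 1 > 0"
  proof (cases "X = TypeA")
    case True
    then have "w (?y 1) = 1" "\<And>k. k > 0 \<Longrightarrow> w k > 0"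
      using sp assms by (auto simp: bij_is_surj signed_perm_bij surj_f_inv_f)
    then show ?thesis
      by (metis signed_perm_odd[OF sp] signed_perm_0[OF sp] less_numeral_extra(1) neg_0_less_iff_less
          not_less_iff_gr_or_eq less_numeral_extra(3))
  next
    case False
    then have "Gen 0 \<in> gens X" using assms by (cases X) auto
    with no have "\<not> desc (Gen 0) w" by auto
    then have "?y (-1) \<le> ?y 1" by (auto simp: desc_def)
    moreover have "?y (-1) = - ?y 1" using signed_perm_odd[OF signed_perm_inv[OF sp]] .
    moreover have "?y 1 \<noteq> 0" using signed_perm_eq_0_iff[OF signed_perm_inv[OF sp]] by simp
    ultimately show ?thesis by simp
  qed
  ultimately have "?y = id"
    by (intro strict_mono_signed_perm_id signed_perm_inv sp) auto
  then have "w = id"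
    by (metis inv_id inv_inv_eq signed_perm_bij[OF sp])
  with assms show False by simp
qed

text \<open>The weight measures how well \<open>inv w\<close> is sorted: removing a descent puts two
  values in order, or for i = 0 makes a negative first value positive, and both raise the
  sum.\<close>

lemma desc_weight_less:
  assumes w: "signed_perm w" "fixes_above N w" and d: "desc (Gen i) w"
  shows "(\<Sum>k=1..N. int k * inv (simple_refl (Gen i) \<circ> w) (int k)) > (\<Sum>k=1..N. int k * inv w (int k))"
    and "fixes_above N (simple_refl (Gen i) \<circ> w)"
proof -
  let ?y = "inv w"
  let ?D = "\<lambda>k. int k * ?y (simple_refl (Gen i) (int k)) - int k * ?y (int k)"
  note bij = signed_perm_bij[OF w(1)]
  have y: "fixes_above N ?y" by (rule fixes_above_inv[OF bij w(2)])
  have yb: "\<bar>k\<bar> \<le> int N \<Longrightarrow> \<bar>?y k\<bar> \<le> int N" for k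
    by (rule fixes_above_bound[OF bij_imp_bij_inv[OF bij] y])
  have odd: "?y (- 1) = - ?y 1" by (rule signed_perm_odd[OF signed_perm_inv[OF w(1)]])
  \<comment> \<open>Beyond the bound there is no descent: \<open>inv w\<close> fixes i + 1 and sends
    i to at most i.\<close>
  have iN: "i < N"
  proof (rule ccontr)
    assume "\<not> i < N"
    then have *: "?y (int i + 1) = int i + 1" using y by (auto simp: fixes_above_def)
    have "?y (int i) \<le> int i"
      using y yb[of "int i"] \<open>\<not> i < N\<close> by (cases "i = N") (auto simp: fixes_above_def)
    then show False using d * odd by (auto simp: desc_def split: if_splits)
  qed
  then have "\<bar>k\<bar> > int N \<Longrightarrow> simple_refl (Gen i) k = k" for k
    by (auto simp: simple_refl_Gen)
  then show "fixes_above N (simple_refl (Gen i) \<circ> w)"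
    using w(2) by (auto simp: fixes_above_def)
  have "(\<Sum>k=1..N. ?D k) = (\<Sum>k\<in>{i, Suc i} \<inter> {1..N}. ?D k)"
    by (rule sum.mono_neutral_right) (auto simp: simple_refl_Gen)
  also have "\<dots> > 0"
  proof (cases "i = 0")
    case True
    then have "{i, Suc i} \<inter> {1..N} = {1}" using iN by auto
    then show ?thesis using d True odd by (auto simp: desc_def simple_refl_Gen)
  next
    case False
    then have *: "{i, Suc i} \<inter> {1..N} = {i, Suc i}" using iN by auto
    show ?thesis using False d unfolding *
      by (auto simp: desc_def simple_refl_Gen algebra_simps)
  qed
  finally show "(\<Sum>k=1..N. int k * inv (simple_refl (Gen i) \<circ> w) (int k))
      > (\<Sum>k=1..N. int k * inv w (int k))"
    by (simp add: inv_simple_refl_comp bij sum_subtractf)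
qed

text \<open>Type D consists of words by definition. Otherwise descents are removed one after
  another; the weight of \<open>desc_weight_less\<close> grows but never exceeds \<open>B\<close>,
  because all values are at most \<open>N\<close>.\<close>

lemma Weyl_word:
  assumes "w \<in> Weyl X"
  shows "\<exists>ws. set ws \<subseteq> gens X \<and> word_prod ws = w"
proof (cases "X = TypeD")
  case True
  then show ?thesis using assms by auto
next
  case nD: False
  obtain N where "fixes_above N w"
    using Weyl_signed_perm[OF assms] by (auto simp: signed_perm_iff)
  define B where "B = (\<Sum>k=1..N. int k * int N)"
  show ?thesis
    using assms \<open>fixes_above N w\<close>
  proof (induction "nat (B - (\<Sum>k=1..N. int k * inv w (int k)))" arbitrary: w rule: less_induct)
    case less
    note bij = Weyl_bij[OF less.prems(1)]
    show ?case
    proof (cases "w = id")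
      case True
      then show ?thesis by (intro exI[of _ "[]"]) auto
    next
      case False
      then obtain i where i: "Gen i \<in> gens X" "desc (Gen i) w"
        using exists_desc less.prems nD by blast
      let ?w = "simple_refl (Gen i) \<circ> w"
      note sp = Weyl_signed_perm[OF less.prems(1)]
      have w': "?w \<in> Weyl X" by (rule simple_refl_Weyl) fact+
      have f: "fixes_above N ?w" by (rule desc_weight_less(2)[OF sp less.prems(2) i(2)])
      have "inv ?w (int k) \<le> int N" if "k \<le> N" for k
        using fixes_above_bound[OF bij_imp_bij_inv[OF Weyl_bij[OF w']]
            fixes_above_inv[OF Weyl_bij[OF w'] f], of "int k"] that by simp
      then have "(\<Sum>k=1..N. int k * inv ?w (int k)) \<le> B"
        unfolding B_def by (intro sum_mono mult_left_mono) auto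
      then obtain ws where "set ws \<subseteq> gens X" "word_prod ws = ?w"
        using less.hyps[OF _ w' f] desc_weight_less(1)[OF sp less.prems(2) i(2)] by auto
      then show ?thesis using i(1)
        by (intro exI[of _ "Gen i # ws"]) simp
    qed
  qed
qed

lemma exists_reduced_word:
  assumes "w \<in> Weyl X" shows "\<exists>ws. reduced_word X w ws"
proof -
  have "\<exists>l ws. set ws \<subseteq> gens X \<and> word_prod ws = w \<and> length ws = l"
    using Weyl_word[OF assms] by auto
  from LeastI_ex[OF this] show ?thesis
    unfolding reduced_word_def cox_len_def by blast
qed

lemma cox_len_le: "set ws \<subseteq> gens X \<Longrightarrow> cox_len X (word_prod ws) \<le> length ws"
  unfolding cox_len_def by (rule Least_le) auto

lemma reduced_word_Weyl: "reduced_word X w ws \<Longrightarrow> w \<in> Weyl X"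
  using word_prod_Weyl by (auto simp: reduced_word_def)

text \<open>The exchange condition bounds the length of the shorter element; prefixing
  \<open>g\<close> to one of its reduced words gives the reverse inequality.\<close>

lemma cox_len_desc:
  assumes "w \<in> Weyl X" "g \<in> gens X" "desc g w"
  shows "cox_len X w = Suc (cox_len X (simple_refl g \<circ> w))"
proof (rule antisym)
  obtain ws where ws: "reduced_word X w ws" using exists_reduced_word[OF assms(1)] ..
  with exchange[of ws X g] assms obtain us where "set us \<subseteq> gens X"
    "word_prod us = simple_refl g \<circ> w" "Suc (length us) = cox_len X w"
    by (auto simp: reduced_word_def)
  then show "Suc (cox_len X (simple_refl g \<circ> w)) \<le> cox_len X w"
    using cox_len_le[of us X] by simp
next
  obtain us where us: "reduced_word X (simple_refl g \<circ> w) us"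
    using exists_reduced_word simple_refl_Weyl assms by blast
  then have "set (g # us) \<subseteq> gens X" "word_prod (g # us) = w"
    using assms by (auto simp: reduced_word_def)
  then show "cox_len X w \<le> Suc (cox_len X (simple_refl g \<circ> w))"
    using cox_len_le us unfolding reduced_word_def by (metis length_Cons)
qed

text \<open>The reflection swaps the two entries of its root pair, and \<open>inv w\<close> is
  injective, so exactly one of the two comparisons holds.\<close>

lemma desc_simple_refl:
  assumes "w \<in> Weyl X" "g \<in> gens X"
  shows "desc g (simple_refl g \<circ> w) \<longleftrightarrow> \<not> desc g w"
proof -
  note sp = signed_perm_inv[OF Weyl_signed_perm[OF assms(1)]]
  have "inv w a = inv w b \<longleftrightarrow> a = b" for a b
    using signed_perm_bij[OF sp] by (metis bij_is_inj injD)
  moreover have "simple_refl g (snd (root_pair g)) = fst (root_pair g)"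
    "simple_refl g (fst (root_pair g)) = snd (root_pair g)" if "g \<noteq> GenHat1"
    using that by (cases g; auto simp: simple_refl_eq)+
  ultimately show ?thesis
    using signed_perm_odd[OF sp] root_pair_less[of g] Weyl_bij[OF assms(1)]
    by (auto simp: desc_def inv_simple_refl_comp not_less order.order_iff_strict)
       (cases "g = GenHat1"; force simp: simple_refl_GenHat1)+
qed

lemma desc_iff_cox_len:
  assumes "w \<in> Weyl X" "g \<in> gens X"
  shows "desc g w \<longleftrightarrow> cox_len X (simple_refl g \<circ> w) < cox_len X w"
  using cox_len_desc[OF assms] cox_len_desc[OF simple_refl_Weyl[OF assms(2,1)] assms(2)]
    desc_simple_refl[OF assms] by auto

text \<open>Each step of a Bruhat chain raises the length, and a chain between different elements
  has at least one step. This turns the hypotheses of the recursion into statements about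
  \<open>desc\<close>.\<close>

lemma bruhat_less_cox_len: "bruhat_less X v w \<Longrightarrow> cox_len X v < cox_len X w"
proof -
  assume a: "bruhat_less X v w"
  then have "(bruhat_step X)\<^sup>+\<^sup>+ v w"
    unfolding bruhat_less_def bruhat_le_def by (metis rtranclpD)
  then show ?thesis
    by (induction) (auto simp: bruhat_step_def)
qed

section \<open>Demazure operators and rank two subsystems\<close>

text \<open>The value at \<open>w\<close> of \<open>u\<^sub>g \<cdot> \<Sum>\<^sub>v f v u\<^sub>v\<close>.\<close>

definition hecke :: "cox_type \<Rightarrow> 'r::comm_ring_1 \<Rightarrow> gen \<Rightarrow> ((int \<Rightarrow> int) \<Rightarrow> 'r) \<Rightarrow> (int \<Rightarrow> int) \<Rightarrow> 'r"
  where
  "hecke X t g f w =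
     (if g \<in> gens X \<and> w \<in> Weyl X \<and> desc g w then t * f w + f (simple_refl g \<circ> w) else 0)"

lemma hecke_add: "hecke X t g (\<lambda>w. f w + f' w) = (\<lambda>w. hecke X t g f w + hecke X t g f' w)"
  by (auto simp: hecke_def fun_eq_iff algebra_simps)

lemma hecke_scale: "hecke X t g (\<lambda>w. c * f w) = (\<lambda>w. c * hecke X t g f w)"
  by (auto simp: hecke_def fun_eq_iff algebra_simps)

lemma hecke_zero: "hecke X t g (\<lambda>w. 0) = (\<lambda>w. 0)"
  by (auto simp: hecke_def fun_eq_iff)

lemma hecke_not_gen: "g \<notin> gens X \<Longrightarrow> hecke X t g f = (\<lambda>w. 0)"
  by (simp add: hecke_def fun_eq_iff)

lemma hecke_not_Weyl: "w \<notin> Weyl X \<Longrightarrow> hecke X t g f w = 0"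
  by (simp add: hecke_def)

text \<open>At \<open>simple_refl g \<circ> w\<close> the inner operator vanishes, since
  \<open>g\<close> is a descent of only one of the two elements.\<close>

lemma hecke_square: "hecke X t g (hecke X t g f) = (\<lambda>w. t * hecke X t g f w)"
  by (auto simp: hecke_def fun_eq_iff desc_simple_refl)

lemma desc_root_pair:
  assumes "signed_perm w" "root_pair g = (p, q) \<or> root_pair g = (- q, - p)"
  shows "desc g w \<longleftrightarrow> inv w p > inv w q"
  using assms(2) signed_perm_odd[OF signed_perm_inv[OF assms(1)]] by (auto simp: desc_def)

section \<open>Rank two subsystems of types A1 x A1, A2 and B2\<close>

definition pair2 :: "gen \<Rightarrow> gen \<Rightarrow> bool" where
  "pair2 g h \<longleftrightarrow> simple_refl g \<noteq> simple_refl h \<and> simple_refl g \<circ> simple_refl h = simple_refl h \<circ> simple_refl g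
     \<and> (\<forall>w. signed_perm w \<longrightarrow> desc g (simple_refl h \<circ> w) = desc g w \<and> desc h (simple_refl g \<circ> w) = desc h w)"

text \<open>Type A2, written as the transpositions (p q) and (q r) of three points whose order under
  \<open>inv w\<close> decides the descents. This covers two adjacent \<open>Gen\<close> and the
  pair \<open>GenHat1\<close>, \<open>Gen 2\<close> at once.\<close>

definition pair3 :: "gen \<Rightarrow> gen \<Rightarrow> int \<Rightarrow> int \<Rightarrow> int \<Rightarrow> bool" where
  "pair3 g h p q r \<longleftrightarrow> simple_refl g \<noteq> simple_refl h
     \<and> simple_refl g \<circ> simple_refl h \<circ> simple_refl g = simple_refl h \<circ> simple_refl g \<circ> simple_refl h
     \<and> simple_refl g p = q \<and> simple_refl g q = p \<and> simple_refl g r = r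
     \<and> simple_refl h q = r \<and> simple_refl h r = q \<and> simple_refl h p = p \<and> p \<noteq> q \<and> q \<noteq> r \<and> p \<noteq> r
     \<and> (\<forall>w. signed_perm w \<longrightarrow> desc g w = (inv w p > inv w q) \<and> desc h w = (inv w q > inv w r))"

lemma pair2_commute: "pair2 g h \<Longrightarrow> pair2 h g"
  by (auto simp: pair2_def)

lemma simple_refl_commute:
  assumes "\<And>k. simple_refl g k = k \<or> simple_refl h k = k"
  shows "simple_refl g \<circ> simple_refl h = simple_refl h \<circ> simple_refl g"
proof
  fix k show "(simple_refl g \<circ> simple_refl h) k = (simple_refl h \<circ> simple_refl g) k"
    using assms[of k] assms[of "simple_refl g k"] assms[of "simple_refl h k"]
    by (metis comp_apply simple_refl_invol)
qed

lemma pair2_disjoint: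
  assumes dis: "\<And>k. simple_refl g k = k \<or> simple_refl h k = k"
    and inv: "simple_refl h (fst (root_pair g)) = fst (root_pair g)"
      "simple_refl h (snd (root_pair g)) = snd (root_pair g)"
      "simple_refl g (fst (root_pair h)) = fst (root_pair h)"
      "simple_refl g (snd (root_pair h)) = snd (root_pair h)"
  shows "pair2 g h"
proof -
  have "simple_refl g (fst (root_pair g)) \<noteq> fst (root_pair g)"
    by (cases g) (auto simp: simple_refl_eq)
  then have "simple_refl g \<noteq> simple_refl h" using inv(1) by metis
  moreover have "desc g (simple_refl h \<circ> w) = desc g w \<and> desc h (simple_refl g \<circ> w) = desc h w"
    if "signed_perm w" for w
    by (simp add: desc_def inv_simple_refl_comp signed_perm_bij[OF that] inv)
  ultimately show ?thesis using simple_refl_commute[of g h, OF dis] by (simp add: pair2_def)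
qed

lemma pair2_far: "i + 2 \<le> j \<Longrightarrow> pair2 (Gen i) (Gen j)"
  by (rule pair2_disjoint) (auto simp: simple_refl_Gen)

text \<open>The roots e_1 + e_2 and e_2 - e_1 are orthogonal, but both reflections move 1 and 2, so
  \<open>pair2_disjoint\<close> does not apply.\<close>

lemma pair2_GenHat1_Gen1: "pair2 GenHat1 (Gen 1)"
proof -
  have "simple_refl GenHat1 1 \<noteq> simple_refl (Gen 1) 1"
    by (auto simp: simple_refl_eq)
  then have "simple_refl GenHat1 \<noteq> simple_refl (Gen 1)" by metis
  moreover have "simple_refl GenHat1 \<circ> simple_refl (Gen 1) = simple_refl (Gen 1) \<circ> simple_refl GenHat1"
    by (auto simp: fun_eq_iff simple_refl_eq)
  moreover have "desc GenHat1 (simple_refl (Gen 1) \<circ> w) = desc GenHat1 w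
      \<and> desc (Gen 1) (simple_refl GenHat1 \<circ> w) = desc (Gen 1) w" if "signed_perm w" for w
    using signed_perm_odd[OF signed_perm_inv[OF that], of 1] signed_perm_odd[OF signed_perm_inv[OF that], of 2]
    by (auto simp add: desc_def inv_simple_refl_comp signed_perm_bij[OF that] simple_refl_eq)
  ultimately show ?thesis by (auto simp: pair2_def)
qed

lemma pair2_GenHat1_Gen:
  assumes "j = 1 \<or> 3 \<le> j" shows "pair2 GenHat1 (Gen j)"
proof (cases "j = 1")
  case True
  then show ?thesis using pair2_GenHat1_Gen1 by simp
next
  case False
  with assms have "3 \<le> j" by simp
  then show ?thesis by (intro pair2_disjoint) (auto simp: simple_refl_eq)
qed

lemma braid3_points:
  assumes "simple_refl g p = q" "simple_refl g q = p" "simple_refl g r = r"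
    "simple_refl h q = r" "simple_refl h r = q" "simple_refl h p = p"
    and "\<And>k. k \<notin> {p, q, r} \<Longrightarrow> - k \<notin> {p, q, r} \<Longrightarrow> simple_refl g k = k \<and> simple_refl h k = k"
  shows "simple_refl g \<circ> simple_refl h \<circ> simple_refl g = simple_refl h \<circ> simple_refl g \<circ> simple_refl h"
proof
  fix k
  consider "k \<in> {p, q, r}" | "- k \<in> {p, q, r}" | "simple_refl g k = k" "simple_refl h k = k"
    using assms(7) by blast
  then show "(simple_refl g \<circ> simple_refl h \<circ> simple_refl g) k
      = (simple_refl h \<circ> simple_refl g \<circ> simple_refl h) k"
  proof cases
    case 2
    then obtain l where "k = - l" "l \<in> {p, q, r}" by (metis minus_minus)
    then show ?thesis by (auto simp only: o_apply simple_refl_odd assms(1-6) insert_iff empty_iff)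
  qed (auto simp only: o_apply assms(1-6) insert_iff empty_iff)
qed

lemma pair3_adjacent:
  assumes "i \<ge> 1" shows "pair3 (Gen i) (Gen (Suc i)) (int i) (int i + 1) (int i + 2)"
proof -
  have vals: "simple_refl (Gen i) (int i) = int i + 1" "simple_refl (Gen i) (int i + 1) = int i"
    "simple_refl (Gen i) (int i + 2) = int i + 2" "simple_refl (Gen (Suc i)) (int i) = int i"
    "simple_refl (Gen (Suc i)) (int i + 1) = int i + 2" "simple_refl (Gen (Suc i)) (int i + 2) = int i + 1"
    using assms by (auto simp: simple_refl_Gen)
  have "simple_refl (Gen i) \<circ> simple_refl (Gen (Suc i)) \<circ> simple_refl (Gen i)
      = simple_refl (Gen (Suc i)) \<circ> simple_refl (Gen i) \<circ> simple_refl (Gen (Suc i))"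
    by (rule braid3_points[OF vals(1-3,5,6,4)]) (auto simp: simple_refl_Gen)
  moreover have "simple_refl (Gen i) \<noteq> simple_refl (Gen (Suc i))"
    using vals by (metis add_cancel_right_right zero_neq_one)
  moreover have "desc (Gen i) w = (inv w (int i) > inv w (int i + 1))"
    "desc (Gen (Suc i)) w = (inv w (int i + 1) > inv w (int i + 2))" for w
    using assms by (simp_all add: desc_def algebra_simps)
  ultimately show ?thesis
    by (simp add: pair3_def vals)
qed

text \<open>The points start with -1 because (-1, 2) is the other name of the root (-2, 1) of
  \<open>GenHat1\<close>.\<close>

lemma pair3_GenHat1: "pair3 GenHat1 (Gen 2) (-1) 2 3"
proof -
  have vals: "simple_refl GenHat1 (-1) = 2" "simple_refl GenHat1 2 = -1" "simple_refl GenHat1 3 = 3"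
    "simple_refl (Gen 2) (-1) = -1" "simple_refl (Gen 2) 2 = 3" "simple_refl (Gen 2) 3 = 2"
    by (auto simp: simple_refl_eq)
  have "simple_refl GenHat1 \<circ> simple_refl (Gen 2) \<circ> simple_refl GenHat1
      = simple_refl (Gen 2) \<circ> simple_refl GenHat1 \<circ> simple_refl (Gen 2)"
    by (rule braid3_points[OF vals(1-3,5,6,4)]) (auto simp: simple_refl_eq)
  moreover have "simple_refl GenHat1 \<noteq> simple_refl (Gen 2)"
    using vals by auto
  ultimately show ?thesis
    by (simp add: pair3_def vals desc_root_pair[where p="-1" and q=2] desc_root_pair[where p=2 and q=3])
qed

text \<open>\<open>Gen 0\<close> and \<open>GenHat1\<close> never belong to the same type, so the
  Coxeter diagrams leave only these bonds; the one of type B2 joins \<open>Gen 0\<close> and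
  \<open>Gen 1\<close>.\<close>

lemma gens_pair_cases:
  assumes "g \<in> gens X" "h \<in> gens X" "g \<noteq> h"
  obtains "pair2 g h" | p q r where "pair3 g h p q r" | p q r where "pair3 h g p q r"
    | "g = Gen 0" "h = Gen 1" | "h = Gen 0" "g = Gen 1"
proof -
  note cs = that
  have hat: thesis if "j \<noteq> 0" "g = GenHat1 \<and> h = Gen j \<or> h = GenHat1 \<and> g = Gen j" for j
  proof (cases "j = 2")
    case True
    with that(2) show ?thesis using cs(2)[of "-1" 2 3] cs(3)[of "-1" 2 3] pair3_GenHat1 by blast
  next
    case False
    then have "j = 1 \<or> 3 \<le> j" using that by linarith
    then have "pair2 GenHat1 (Gen j)" by (rule pair2_GenHat1_Gen)
    with that(2) show ?thesis using cs(1) pair2_commute by blast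
  qed
  show thesis
  proof (cases g)
    case [simp]: (Gen i)
    show thesis
    proof (cases h)
      case [simp]: (Gen j)
      consider "i + 2 \<le> j" | "j + 2 \<le> i" | "j = Suc i" "i = 0" | "j = Suc i" "i \<ge> 1"
        | "i = Suc j" "j = 0" | "i = Suc j" "j \<ge> 1"
        using assms(3) by fastforce
      then show thesis
      proof cases
        case 1
        then show thesis using that(1) pair2_far by simp
      next
        case 2
        then show thesis using that(1) pair2_far pair2_commute by simp
      next
        case 3
        then show thesis using that(4) by simp
      next
        case 4
        then show thesis using 4 cs(2) pair3_adjacent[of i] by simp
      next
        case 5
        then show thesis using that(5) by simp
      next
        case 6
        then show thesis using 6 cs(3) pair3_adjacent[of j] by simp
      qed
    next
      case GenHat1
      with assms have "i \<noteq> 0" by (cases X) auto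
      then show thesis using GenHat1 by (intro hat[of i]) auto
    qed
  next
    case GenHat1
    then obtain j where "h = Gen j" using assms by (cases h) auto
    moreover have "j \<noteq> 0" using calculation GenHat1 assms by (cases X) auto
    ultimately show thesis using GenHat1 by (intro hat[of j]) auto
  qed
qed

lemma hecke_pair2:
  assumes "pair2 g h"
  shows "hecke X t g (hecke X t h f) = hecke X t h (hecke X t g f)"
proof
  fix w
  have d: "desc g (simple_refl h \<circ> w) = desc g w" "desc h (simple_refl g \<circ> w) = desc h w"
    if "w \<in> Weyl X"
    using assms Weyl_signed_perm[OF that] by (auto simp: pair2_def)
  have c: "simple_refl g \<circ> (simple_refl h \<circ> w) = simple_refl h \<circ> (simple_refl g \<circ> w)"
    using assms by (simp add: o_assoc pair2_def)
  show "hecke X t g (hecke X t h f) w = hecke X t h (hecke X t g f) w"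
    by (simp add: hecke_def simple_refl_Weyl d c algebra_simps)
qed

lemma desc_comp_pair3:
  assumes "pair3 g h p q r" "w \<in> Weyl X"
  shows "desc g w \<longleftrightarrow> inv w p > inv w q" "desc h w \<longleftrightarrow> inv w q > inv w r"
  using assms Weyl_signed_perm by (auto simp: pair3_def)

text \<open>Each of the six orders of \<open>inv w\<close> on p, q, r decides every descent met
  while the operators are unfolded.\<close>

lemma hecke_pair3:
  assumes "pair3 g h p q r"
  shows "hecke X t g (hecke X t h (hecke X t g f)) = hecke X t h (hecke X t g (hecke X t h f))"
proof
  fix w
  note D = desc_comp_pair3[OF assms, of _ X]
  have pq: "simple_refl g p = q" "simple_refl g q = p" "simple_refl g r = r"
    "simple_refl h q = r" "simple_refl h r = q" "simple_refl h p = p"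
    using assms by (auto simp: pair3_def)
  show "hecke X t g (hecke X t h (hecke X t g f)) w = hecke X t h (hecke X t g (hecke X t h f)) w"
  proof (cases "g \<in> gens X \<and> h \<in> gens X \<and> w \<in> Weyl X")
    case True
    then have ne: "inv w p \<noteq> inv w q" "inv w q \<noteq> inv w r" "inv w p \<noteq> inv w r"
      using assms bij_imp_bij_inv[OF Weyl_bij] by (metis pair3_def bij_is_inj injD)+
    have W: "simple_refl k \<circ> v \<in> Weyl X" if "k = g \<or> k = h" "v \<in> Weyl X" for k v
      using that True simple_refl_Weyl by blast
    have c: "simple_refl g \<circ> (simple_refl h \<circ> (simple_refl g \<circ> w))
        = simple_refl h \<circ> (simple_refl g \<circ> (simple_refl h \<circ> w))"
      using assms by (simp add: o_assoc pair3_def)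
    have I: "inv (simple_refl k \<circ> v) = inv v \<circ> simple_refl k" if "v \<in> Weyl X" for k v
      by (rule inv_simple_refl_comp[OF Weyl_bij[OF that]])
    show ?thesis using ne
      by (simp add: hecke_def True W D I pq c) (auto simp: algebra_simps)
  qed (auto simp: hecke_not_gen hecke_zero hecke_not_Weyl)
qed

lemma braid_01:
  "simple_refl (Gen 0) (simple_refl (Gen 1) (simple_refl (Gen 0) (simple_refl (Gen 1) k)))
   = simple_refl (Gen 1) (simple_refl (Gen 0) (simple_refl (Gen 1) (simple_refl (Gen 0) k)))"
proof -
  let ?g = "simple_refl (Gen 0)" and ?h = "simple_refl (Gen 1)"
  have m: "?g 1 = -1" "?g (-1) = 1" "?g 2 = 2" "?g (-2) = -2"
     "?h 1 = 2" "?h 2 = 1" "?h (-1) = -2" "?h (-2) = -1"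
    by (auto simp: simple_refl_Gen)
  have "?g k = k \<and> ?h k = k" if "k \<notin> {1, -1, 2, -2}"
    using that by (auto simp: simple_refl_Gen)
  then consider "k \<in> {1, -1, 2, -2}" | "?g k = k" "?h k = k" by blast
  then show ?thesis by cases (auto simp only: m insert_iff empty_iff)
qed

lemma word_prod_braid_01:
  "word_prod [Gen 0, Gen 1, Gen 0, Gen 1] = word_prod [Gen 1, Gen 0, Gen 1, Gen 0]"
  using braid_01 by (simp add: fun_eq_iff)

lemma hecke_pair4_aux:
  assumes gh: "g = Gen 0" "h = Gen 1"
  shows "hecke X t g (hecke X t h (hecke X t g (hecke X t h f)))
    = hecke X t h (hecke X t g (hecke X t h (hecke X t g f)))"
proof
  fix w
  show "hecke X t g (hecke X t h (hecke X t g (hecke X t h f))) w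
    = hecke X t h (hecke X t g (hecke X t h (hecke X t g f))) w"
  proof (cases "g \<in> gens X \<and> h \<in> gens X \<and> w \<in> Weyl X")
    case True
    then have sp: "signed_perm (inv w)" using signed_perm_inv Weyl_signed_perm by blast
    have odd: "inv w (-1) = - inv w 1" "inv w (-2) = - inv w 2"
      by (simp_all add: signed_perm_odd[OF sp])
    have inj: "inv w a = inv w b \<longleftrightarrow> a = b" for a b
      using signed_perm_bij[OF sp] by (metis bij_is_inj injD)
    have ne: "inv w 1 \<noteq> inv w 2" "inv w 1 \<noteq> - inv w 2" "inv w 1 \<noteq> 0" "inv w 2 \<noteq> 0"
      using inj[of 1 2] inj[of 1 "-2"] odd signed_perm_eq_0_iff[OF sp] by simp_all
    have W: "simple_refl k \<circ> v \<in> Weyl X" if "k = g \<or> k = h" "v \<in> Weyl X" for k v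
      using that True simple_refl_Weyl by blast
    have m: "simple_refl g 1 = -1" "simple_refl g (-1) = 1" "simple_refl g 2 = 2"
       "simple_refl g (-2) = -2" "simple_refl h 1 = 2" "simple_refl h 2 = 1"
       "simple_refl h (-1) = -2" "simple_refl h (-2) = -1"
      by (auto simp: simple_refl_Gen gh)
    have D: "desc g v \<longleftrightarrow> inv v (-1) > inv v 1" "desc h v \<longleftrightarrow> inv v 1 > inv v 2" for v
      by (auto simp: desc_def gh)
    have c: "simple_refl g \<circ> (simple_refl h \<circ> (simple_refl g \<circ> (simple_refl h \<circ> w)))
        = simple_refl h \<circ> (simple_refl g \<circ> (simple_refl h \<circ> (simple_refl g \<circ> w)))"
      using braid_01 unfolding gh by (simp add: fun_eq_iff)
    let ?a = "\<lambda>v. simple_refl g \<circ> v" and ?b = "\<lambda>v. simple_refl h \<circ> v"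
    have W1: "?a w \<in> Weyl X" "?b w \<in> Weyl X" using W True by blast+
    then have W2: "?a (?b w) \<in> Weyl X" "?b (?a w) \<in> Weyl X" using W by blast+
    then have W3: "?a (?b (?a w)) \<in> Weyl X" "?b (?a (?b w)) \<in> Weyl X" using W by blast+
    \<comment> \<open>The four reflecting lines of B2 in the plane of (\<open>inv w 1\<close>,
      \<open>inv w 2\<close>). Of the sixteen sign patterns only the eight chambers survive, and a
      chamber decides every descent listed in \<open>d\<close>.\<close>
    define A B C E where "A \<longleftrightarrow> inv w 1 < 0" and "B \<longleftrightarrow> inv w 2 < 0"
      and "C \<longleftrightarrow> inv w 2 < inv w 1" and "E \<longleftrightarrow> inv w 1 < - inv w 2"
    note ABCE = A_def B_def C_def E_def
    have I: "inv (?a v) 1 = inv v (-1)" "inv (?a v) (-1) = inv v 1" "inv (?a v) 2 = inv v 2" "inv (?a v) (-2) = inv v (-2)"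
      "inv (?b v) 1 = inv v 2" "inv (?b v) 2 = inv v 1" "inv (?b v) (-1) = inv v (-2)" "inv (?b v) (-2) = inv v (-1)"
      if "v \<in> Weyl X" for v
      by (simp_all only: inv_simple_refl_comp[OF Weyl_bij[OF that]] o_apply m)
    note w = conjunct2[OF conjunct2[OF True]]
    note va = I(1-4)[OF w] and vb = I(5-8)[OF w]
    note vab = I(1-4)[OF W1(2)] and vba = I(5-8)[OF W1(1)]
    note vaba = I(1-4)[OF W2(2)] and vbab = I(5-8)[OF W2(1)]
    have n: "0 < inv w 1 \<longleftrightarrow> \<not> inv w 1 < 0" "0 < inv w 2 \<longleftrightarrow> \<not> inv w 2 < 0"
      "inv w 1 < inv w 2 \<longleftrightarrow> \<not> inv w 2 < inv w 1" "- inv w 2 < inv w 1 \<longleftrightarrow> \<not> inv w 1 < - inv w 2"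
      "- inv w 1 < inv w 2 \<longleftrightarrow> \<not> inv w 1 < - inv w 2" "inv w 2 < - inv w 1 \<longleftrightarrow> inv w 1 < - inv w 2"
      using ne by linarith+
    have d: "desc g w \<longleftrightarrow> A" "desc h w \<longleftrightarrow> C"
      "desc g (?a w) \<longleftrightarrow> \<not> A" "desc h (?a w) \<longleftrightarrow> E"
      "desc g (?b w) \<longleftrightarrow> B" "desc h (?b w) \<longleftrightarrow> \<not> C"
      "desc g (?a (?b w)) \<longleftrightarrow> \<not> B" "desc h (?a (?b w)) \<longleftrightarrow> E"
      "desc g (?b (?a w)) \<longleftrightarrow> B" "desc h (?b (?a w)) \<longleftrightarrow> \<not> E"
      "desc g (?a (?b (?a w))) \<longleftrightarrow> \<not> B" "desc h (?a (?b (?a w))) \<longleftrightarrow> C"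
      "desc g (?b (?a (?b w))) \<longleftrightarrow> A" "desc h (?b (?a (?b w))) \<longleftrightarrow> \<not> E"
      by (simp_all add: D va vb vab vba vaba vbab odd n ABCE)
    have "A \<Longrightarrow> B \<Longrightarrow> E" "\<not> A \<Longrightarrow> \<not> B \<Longrightarrow> \<not> E" "A \<Longrightarrow> \<not> B \<Longrightarrow> \<not> C" "\<not> A \<Longrightarrow> B \<Longrightarrow> C"
      using ne unfolding ABCE by linarith+
    then consider "A" "B" "C" "E" | "A" "B" "\<not> C" "E" | "A" "\<not> B" "\<not> C" "E" | "A" "\<not> B" "\<not> C" "\<not> E"
      | "\<not> A" "\<not> B" "C" "\<not> E" | "\<not> A" "\<not> B" "\<not> C" "\<not> E" | "\<not> A" "B" "C" "E" | "\<not> A" "B" "C" "\<not> E"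
      by blast
    then show ?thesis
      by cases (simp_all add: hecke_def True W1 W2 W3 d c algebra_simps)
  next
    case False
    then show ?thesis by (auto simp: hecke_not_gen hecke_zero hecke_not_Weyl)
  qed
qed

lemmas hecke_pair4 = hecke_pair4_aux[OF refl refl]

section \<open>Orders of products of two simple reflections, and dihedral cosets\<close>

lemma cox_m_pair2:
  assumes "pair2 g h" shows "cox_m g h = 2"
  unfolding cox_m_def
proof (rule Least_equality)
  have "simple_refl g \<circ> (simple_refl h \<circ> (simple_refl g \<circ> simple_refl h)) = id"
    using assms by (simp add: pair2_def)
  then show "0 < (2::nat) \<and> (simple_refl g \<circ> simple_refl h) ^^ 2 = id"
    by (simp add: numeral_eq_Suc o_assoc)
next
  fix k assume k: "0 < k \<and> (simple_refl g \<circ> simple_refl h) ^^ k = id"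
  have "k \<noteq> 1"
  proof
    assume "k = 1"
    with k have "simple_refl g \<circ> simple_refl h = id" by simp
    with assms show False unfolding pair2_def by (metis comp_id simple_refl_cancel_left)
  qed
  with k show "2 \<le> k" by simp
qed

lemma cox_m_braid3:
  assumes "simple_refl g \<noteq> simple_refl h"
    "simple_refl g \<circ> simple_refl h \<circ> simple_refl g = simple_refl h \<circ> simple_refl g \<circ> simple_refl h"
  shows "cox_m g h = 3"
  unfolding cox_m_def
proof (rule Least_equality)
  let ?g = "simple_refl g" and ?h = "simple_refl h"
  have br: "?g (?h (?g k)) = ?h (?g (?h k))" for k
    using fun_cong[OF assms(2), of k] by simp
  then show "0 < (3::nat) \<and> (?g \<circ> ?h) ^^ 3 = id"
    by (simp add: numeral_eq_Suc fun_eq_iff)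
  fix k assume k: "0 < k \<and> (?g \<circ> ?h) ^^ k = id"
  have "k \<noteq> 1"
  proof
    assume "k = 1"
    with k have "?g \<circ> ?h = id" by simp
    with assms show False by (metis comp_id simple_refl_cancel_left)
  qed
  moreover have "k \<noteq> 2"
  proof
    assume "k = 2"
    then have "?g (?h (?g (?h x))) = x" for x
      using k by (simp add: numeral_eq_Suc fun_eq_iff)
    then have "?g x = ?h x" for x using br by (metis simple_refl_invol)
    with assms(1) show False by auto
  qed
  ultimately show "3 \<le> k" using k by linarith
qed

lemma cox_m_01: "cox_m (Gen 0) (Gen 1) = 4" "cox_m (Gen 1) (Gen 0) = 4"
proof -
  let ?g = "simple_refl (Gen 0)" and ?h = "simple_refl (Gen 1)"
  have m: "?g 1 = -1" "?g (-1) = 1" "?g 2 = 2" "?g (-2) = -2"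
     "?h 1 = 2" "?h 2 = 1" "?h (-1) = -2" "?h (-2) = -1"
    by (auto simp: simple_refl_Gen)
  \<comment> \<open>Under either product the point 1 has an orbit of four elements, which rules out
    smaller exponents.\<close>
  have n: "((?g \<circ> ?h) ^^ k) 1 \<noteq> 1" "((?h \<circ> ?g) ^^ k) 1 \<noteq> 1" if "0 < k" "k < 4" for k
  proof -
    have "k = 1 \<or> k = 2 \<or> k = 3" using that by linarith
    then show "((?g \<circ> ?h) ^^ k) 1 \<noteq> 1" "((?h \<circ> ?g) ^^ k) 1 \<noteq> 1"
      by (auto simp: numeral_eq_Suc m[simplified])
  qed
  have "?g (?h (?g (?h (?g (?h (?g (?h k))))))) = k" "?h (?g (?h (?g (?h (?g (?h (?g k))))))) = k" for k
    by (subst braid_01, simp)+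
  then have i: "(?g \<circ> ?h) ^^ 4 = id" "(?h \<circ> ?g) ^^ 4 = id"
    by (simp_all add: numeral_eq_Suc fun_eq_iff)
  show "cox_m (Gen 0) (Gen 1) = 4" "cox_m (Gen 1) (Gen 0) = 4"
    unfolding cox_m_def
    by (rule Least_equality; use n i in \<open>metis id_apply not_less zero_less_numeral\<close>)+
qed

lemma alternating_numeral:
  "alternating g h 2 = [g, h]" "alternating g h 3 = [g, h, g]" "alternating g h 4 = [g, h, g, h]"
  by (simp_all add: numeral_eq_Suc)

lemma foldr_hecke_braid:
  assumes "g \<in> gens X" "h \<in> gens X" "g \<noteq> h"
  shows "foldr (hecke X t) (alternating g h (cox_m g h)) f = foldr (hecke X t) (alternating h g (cox_m g h)) f"
  using assms
proof (rule gens_pair_cases)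
  assume a: "pair2 g h"
  show ?thesis using hecke_pair2[OF a, of X t f] by (simp add: cox_m_pair2[OF a] alternating_numeral)
next
  fix p q r assume a: "pair3 g h p q r"
  then have "cox_m g h = 3" by (intro cox_m_braid3) (auto simp: pair3_def)
  with hecke_pair3[OF a, of X t f] show ?thesis by (simp add: alternating_numeral)
next
  fix p q r assume a: "pair3 h g p q r"
  then have "cox_m g h = 3" by (intro cox_m_braid3) (auto simp: pair3_def)
  with hecke_pair3[OF a, of X t f] show ?thesis by (simp add: alternating_numeral)
qed (simp_all add: cox_m_01[simplified] alternating_numeral hecke_pair4[simplified])

lemma word_prod_braid:
  assumes "g \<in> gens X" "h \<in> gens X" "g \<noteq> h"
  shows "word_prod (alternating g h (cox_m g h)) = word_prod (alternating h g (cox_m g h))"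
  using assms
proof (rule gens_pair_cases)
  assume a: "pair2 g h"
  then have "simple_refl g \<circ> simple_refl h = simple_refl h \<circ> simple_refl g" by (simp add: pair2_def)
  then show ?thesis by (simp add: cox_m_pair2[OF a] alternating_numeral)
next
  fix p q r assume a: "pair3 g h p q r"
  then have "cox_m g h = 3" by (intro cox_m_braid3) (auto simp: pair3_def)
  moreover have "simple_refl g \<circ> simple_refl h \<circ> simple_refl g = simple_refl h \<circ> simple_refl g \<circ> simple_refl h"
    using a by (simp add: pair3_def)
  ultimately show ?thesis by (simp add: alternating_numeral o_assoc)
next
  fix p q r assume a: "pair3 h g p q r"
  then have "cox_m g h = 3" by (intro cox_m_braid3) (auto simp: pair3_def)
  moreover have "simple_refl g \<circ> simple_refl h \<circ> simple_refl g = simple_refl h \<circ> simple_refl g \<circ> simple_refl h"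
    using a by (simp add: pair3_def)
  ultimately show ?thesis by (simp add: alternating_numeral o_assoc)
qed (use word_prod_braid_01 in \<open>simp_all add: cox_m_01[simplified] alternating_numeral\<close>)

lemma cox_m_pos:
  assumes "g \<in> gens X" "h \<in> gens X" "g \<noteq> h" shows "cox_m g h > 0"
  using assms
proof (rule gens_pair_cases)
  fix p q r assume a: "pair3 g h p q r"
  then have "cox_m g h = 3" by (intro cox_m_braid3) (auto simp: pair3_def)
  then show ?thesis by simp
next
  fix p q r assume a: "pair3 h g p q r"
  then have "cox_m g h = 3" by (intro cox_m_braid3) (auto simp: pair3_def)
  then show ?thesis by simp
qed (simp_all add: cox_m_01[simplified] cox_m_pair2)

text \<open>An element with two left descents starts with the longest element of the dihedral group
  they generate: the letters of the alternating word can be stripped in turn, because the next one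
  is always still a descent. The rest \<open>x\<close> carries the remaining length.\<close>

lemma cox_len_braid:
  assumes gh: "g \<in> gens X" "h \<in> gens X" "g \<noteq> h"
    and w: "w \<in> Weyl X" and d: "desc g w" "desc h w"
  obtains x where "x \<in> Weyl X" "w = word_prod (alternating g h (cox_m g h)) \<circ> x"
    "cox_len X w = cox_m g h + cox_len X x"
proof -
  have W: "simple_refl k \<circ> v \<in> Weyl X" if "k = g \<or> k = h" "v \<in> Weyl X" for k v
    using that gh simple_refl_Weyl by blast
  have I: "inv (simple_refl k \<circ> v) = inv v \<circ> simple_refl k" if "v \<in> Weyl X" for k v
    by (rule inv_simple_refl_comp[OF Weyl_bij[OF that]])
  have L: "cox_len X v = Suc (cox_len X (simple_refl k \<circ> v))" if "k = g \<or> k = h" "v \<in> Weyl X" "desc k v" for k v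
    using that gh cox_len_desc by blast
  note fin = that
  have three: thesis if p: "pair3 k l p q r" "k = g \<and> l = h \<or> k = h \<and> l = g" for k l p q r
  proof -
    have kl: "k = g \<or> k = h" "l = g \<or> l = h" and dk: "desc k w" "desc l w" using p(2) d by auto
    have pq: "simple_refl k p = q" "simple_refl k q = p" "simple_refl k r = r"
      "simple_refl l q = r" "simple_refl l r = q" "simple_refl l p = p"
      using p by (auto simp: pair3_def)
    note D = desc_comp_pair3[OF p(1), of _ X]
    have w1: "simple_refl k \<circ> w \<in> Weyl X" by (rule W[OF kl(1) w])
    then have d1: "desc l (simple_refl k \<circ> w)" using dk by (simp add: D w I pq)
    have w2: "simple_refl l \<circ> (simple_refl k \<circ> w) \<in> Weyl X" by (rule W[OF kl(2) w1])
    then have d2: "desc k (simple_refl l \<circ> (simple_refl k \<circ> w))" using dk w1 by (simp add: D w I pq)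
    let ?x = "simple_refl k \<circ> (simple_refl l \<circ> (simple_refl k \<circ> w))"
    have m: "cox_m g h = 3" using p unfolding pair3_def
      by (metis cox_m_braid3)
    \<comment> \<open>The roles of \<open>k\<close> and \<open>l\<close> may be reversed against
      \<open>g\<close> and \<open>h\<close>; both alternating words have the same product.\<close>
    have "word_prod (alternating g h (cox_m g h)) = word_prod (alternating k l (cox_m g h))"
      using p(2) word_prod_braid[OF gh] by auto
    then have "w = word_prod (alternating g h (cox_m g h)) \<circ> ?x"
      unfolding m by (simp add: fun_eq_iff alternating_numeral)
    moreover have "cox_len X w = 3 + cox_len X ?x"
      using L[OF kl(1) w dk(1)] L[OF kl(2) w1 d1] L[OF kl(1) w2 d2] by simp
    ultimately show thesis by (intro fin[OF W[OF kl(1) w2]]) (simp_all only: m)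
  qed
  have four: thesis if kl: "{k, l} = {g, h}" "k = Gen 0" "l = Gen 1" for k l
  proof -
    have kl': "k = g \<and> l = h \<or> k = h \<and> l = g" using kl(1) by (auto simp: doubleton_eq_iff)
    then have kk: "k = g \<or> k = h" "l = g \<or> l = h" and dk: "desc k w" "desc l w" using d by auto
    have m: "simple_refl k 1 = -1" "simple_refl k (-1) = 1" "simple_refl k 2 = 2" "simple_refl k (-2) = -2"
      "simple_refl l 1 = 2" "simple_refl l 2 = 1" "simple_refl l (-1) = -2"
      by (auto simp: simple_refl_Gen kl)
    have D: "desc k v \<longleftrightarrow> inv v (-1) > inv v 1" "desc l v \<longleftrightarrow> inv v 1 > inv v 2" for v
      by (auto simp: desc_def kl)
    have odd: "inv w (-1) = - inv w 1" "inv w (-2) = - inv w 2"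
      by (simp_all add: signed_perm_odd[OF signed_perm_inv[OF Weyl_signed_perm[OF w]]])
    have w1: "simple_refl k \<circ> w \<in> Weyl X" by (rule W[OF kk(1) w])
    then have d1: "desc l (simple_refl k \<circ> w)" using dk by (simp add: D w I m odd)
    have w2: "simple_refl l \<circ> (simple_refl k \<circ> w) \<in> Weyl X" by (rule W[OF kk(2) w1])
    then have d2: "desc k (simple_refl l \<circ> (simple_refl k \<circ> w))" using dk w1 by (simp add: D w I m odd)
    have w3: "simple_refl k \<circ> (simple_refl l \<circ> (simple_refl k \<circ> w)) \<in> Weyl X" by (rule W[OF kk(1) w2])
    then have d3: "desc l (simple_refl k \<circ> (simple_refl l \<circ> (simple_refl k \<circ> w)))"
      using dk w1 w2 by (simp add: D w I m odd)
    let ?x = "simple_refl l \<circ> (simple_refl k \<circ> (simple_refl l \<circ> (simple_refl k \<circ> w)))"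
    have m: "cox_m g h = 4" using kl' kl cox_m_01 by auto
    have "word_prod (alternating g h (cox_m g h)) = word_prod (alternating k l (cox_m g h))"
      using kl' word_prod_braid[OF gh] by auto
    then have "w = word_prod (alternating g h (cox_m g h)) \<circ> ?x"
      unfolding m by (simp add: fun_eq_iff alternating_numeral)
    moreover have "cox_len X w = 4 + cox_len X ?x"
      using L[OF kk(1) w dk(1)] L[OF kk(2) w1 d1] L[OF kk(1) w2 d2] L[OF kk(2) w3 d3] by simp
    ultimately show thesis by (intro fin[OF W[OF kk(2) w3]]) (simp_all only: m)
  qed
  from gh show thesis
  proof (rule gens_pair_cases)
    assume p: "pair2 g h"
    have w1: "simple_refl g \<circ> w \<in> Weyl X" using W w by blast
    have d1: "desc h (simple_refl g \<circ> w)"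
      using p d Weyl_signed_perm[OF w] by (simp add: pair2_def)
    let ?x = "simple_refl h \<circ> (simple_refl g \<circ> w)"
    have "w = word_prod (alternating g h (cox_m g h)) \<circ> ?x"
      by (simp add: cox_m_pair2[OF p] fun_eq_iff alternating_numeral)
    moreover have "cox_len X w = cox_m g h + cox_len X ?x"
      using L[of g w] L[of h "simple_refl g \<circ> w"] w d w1 d1 by (simp add: cox_m_pair2[OF p])
    moreover have "?x \<in> Weyl X" using W w1 by blast
    ultimately show thesis using that by blast
  next
    fix p q r assume "pair3 g h p q r" then show thesis using three by blast
  next
    fix p q r assume "pair3 h g p q r" then show thesis using three by blast
  next
    assume "g = Gen 0" "h = Gen 1" then show thesis using four[of g h] by simp
  next
    assume "h = Gen 0" "g = Gen 1" then show thesis using four[of h g] by (simp add: insert_commute)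
  qed
qed

section \<open>The basis of the IdCoxeter algebra\<close>

lemma poly_mapping_sum_induct [case_names zero single add]:
  fixes p :: "'a \<Rightarrow>\<^sub>0 'b::comm_monoid_add"
  assumes "P 0" "\<And>k c. P (Poly_Mapping.single k c)" "\<And>p q. P p \<Longrightarrow> P q \<Longrightarrow> P (p + q)"
  shows "P p"
proof (induction p rule: update_induct)
  case const
  then show ?case using assms(1) .
next
  case (update p a b)
  then have "Poly_Mapping.update a b p = p + Poly_Mapping.single a b"
    by (intro poly_mapping_eqI)
       (auto simp: lookup_update lookup_add lookup_single not_in_keys_iff_lookup_eq_zero when_def)
  then show ?case using update assms by simp
qed

section \<open>The left regular representation\<close>

definition word_act :: "cox_type \<Rightarrow> gen list \<Rightarrow> ((int \<Rightarrow> int) \<Rightarrow> coef) \<Rightarrow> (int \<Rightarrow> int) \<Rightarrow> coef" where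
  "word_act X ws = foldr (hecke X (const_coef beta)) ws"

lemma word_act_simps [simp]:
  "word_act X [] f = f" "word_act X (g # ws) f = hecke X (const_coef beta) g (word_act X ws f)"
  by (simp_all add: word_act_def)

lemma word_act_append: "word_act X (us @ vs) f = word_act X us (word_act X vs f)"
  by (simp add: word_act_def)

lemma word_act_add: "word_act X ws (\<lambda>w. f w + f' w) = (\<lambda>w. word_act X ws f w + word_act X ws f' w)"
  by (induction ws) (simp_all add: hecke_add)

lemma word_act_scale: "word_act X ws (\<lambda>w. c * f w) = (\<lambda>w. c * word_act X ws f w)"
  by (induction ws) (simp_all add: hecke_scale)

text \<open>A function on the group stands for the formal sum of its values times the u_w, with
  arbitrary support; scalars act pointwise.\<close>

definition alg_act :: "cox_type \<Rightarrow> free_alg \<Rightarrow> ((int \<Rightarrow> int) \<Rightarrow> coef) \<Rightarrow> (int \<Rightarrow> int) \<Rightarrow> coef" where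
  "alg_act X z f w = (\<Sum>k\<in>Poly_Mapping.keys z. Poly_Mapping.lookup z k * word_act X (letters k) f w)"

lemma alg_act_superset:
  "finite S \<Longrightarrow> Poly_Mapping.keys z \<subseteq> S \<Longrightarrow>
   alg_act X z f w = (\<Sum>k\<in>S. Poly_Mapping.lookup z k * word_act X (letters k) f w)"
  unfolding alg_act_def by (intro sum.mono_neutral_left) (auto simp: in_keys_iff)

lemma alg_act_add: "alg_act X (a + b) f w = alg_act X a f w + alg_act X b f w"
proof -
  let ?S = "Poly_Mapping.keys a \<union> Poly_Mapping.keys b"
  have "Poly_Mapping.keys (a + b) \<subseteq> ?S" by (rule Poly_Mapping.keys_add)
  then show ?thesis
    by (simp add: alg_act_superset[of ?S] lookup_add sum.distrib algebra_simps)
qed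

lemma alg_act_0 [simp]: "alg_act X 0 f = (\<lambda>w. 0)"
  by (simp add: alg_act_def fun_eq_iff)

lemma alg_act_single: "alg_act X (Poly_Mapping.single k c) f w = c * word_act X (letters k) f w"
  by (cases "c = 0") (simp_all add: alg_act_def)

lemma alg_act_diff: "alg_act X (a - b) f w = alg_act X a f w - alg_act X b f w"
  using alg_act_add[of X "a - b" b f w] by simp

lemma alg_act_linear:
  "alg_act X z (\<lambda>w. f w + f' w) w = alg_act X z f w + alg_act X z f' w"
  "alg_act X z (\<lambda>w. c * f w) w = c * alg_act X z f w"
  by (simp_all add: alg_act_def word_act_add word_act_scale sum.distrib sum_distrib_left algebra_simps)

lemma alg_act_mult: "alg_act X (p * q) f = alg_act X p (alg_act X q f)"
proof (induction p rule: poly_mapping_sum_induct)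
  case (single k c)
  show ?case
  proof (induction q rule: poly_mapping_sum_induct)
    case zero
    then show ?case using word_act_scale[of X _ 0] by (simp add: fun_eq_iff alg_act_single)
  next
    case (single l d)
    have "alg_act X (Poly_Mapping.single l d) f = (\<lambda>w. d * word_act X (letters l) f w)"
      by (simp add: fun_eq_iff alg_act_single)
    then show ?case
      by (simp add: fun_eq_iff mult_single alg_act_single plus_word_def word_act_append word_act_scale algebra_simps)
  next
    case (add p q)
    have "alg_act X (p + q) f = (\<lambda>w. alg_act X p f w + alg_act X q f w)"
      by (simp add: fun_eq_iff alg_act_add)
    with add show ?case by (simp add: fun_eq_iff distrib_left alg_act_add alg_act_linear)
  qed
qed (simp_all add: fun_eq_iff distrib_right alg_act_add)

lemma u_word_append: "u_word (us @ vs) = u_word us * u_word vs"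
  by (simp add: u_word_def mult_single plus_word_def)

lemma u_word_Nil: "u_word [] = 1"
  by (simp add: u_word_def single_one[symmetric] zero_word_def del: single_one)

lemma alg_act_u_word: "alg_act X (u_word ws) f = word_act X ws f"
  by (simp add: u_word_def alg_act_single fun_eq_iff)

lemma alg_act_scalar: "alg_act X (scalar c) f w = c * f w"
  by (simp add: scalar_def alg_act_single zero_word_def)

lemma alg_act_scalar_mult: "alg_act X (scalar c * z) f w = c * alg_act X z f w"
  by (simp add: alg_act_mult alg_act_scalar)

lemma alg_act_1: "alg_act X 1 f = f"
  by (simp add: alg_act_u_word u_word_Nil[symmetric])

lemma alg_act_sum: "alg_act X (sum h S) f w = (\<Sum>i\<in>S. alg_act X (h i) f w)"
  by (induction S rule: infinite_finite_induct) (simp_all add: alg_act_add)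

text \<open>The operators satisfy the quadratic and braid relations, and \<open>hecke\<close> is
  zero for foreign generators; this makes the representation well defined on the quotient.\<close>

lemma alg_act_relator: "r \<in> id_relators X \<Longrightarrow> alg_act X r f = (\<lambda>w. 0)"
proof (induction rule: id_relators.induct)
  case (square g)
  then show ?case
    by (simp add: fun_eq_iff alg_act_diff alg_act_mult alg_act_u_word alg_act_scalar hecke_square)
next
  case (braid g h)
  then have "word_act X (alternating g h (cox_m g h)) f = word_act X (alternating h g (cox_m g h)) f"
    unfolding word_act_def by (rule foldr_hecke_braid)
  then show ?case by (simp add: fun_eq_iff alg_act_diff alg_act_u_word)
next
  case (unused g)
  then show ?case by (simp add: fun_eq_iff alg_act_u_word hecke_def)
qed

lemma alg_act_ideal: "z \<in> id_ideal X \<Longrightarrow> alg_act X z f = (\<lambda>w. 0)"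
proof (induction rule: id_ideal.induct)
  case (step z r p q)
  have "alg_act X p (\<lambda>w. 0) w = 0" for w
    using alg_act_linear(2)[of X p 0 "\<lambda>w. 0"] by simp
  with step show ?case
    by (simp add: fun_eq_iff alg_act_add alg_act_mult alg_act_relator)
qed simp

lemma id_ideal_relator: "r \<in> id_relators X \<Longrightarrow> r \<in> id_ideal X"
  using id_ideal.step[OF id_ideal.zero, of r X 1 1] by simp

lemma id_ideal_add: "b \<in> id_ideal X \<Longrightarrow> a \<in> id_ideal X \<Longrightarrow> a + b \<in> id_ideal X"
  by (induction rule: id_ideal.induct) (auto simp: add.assoc[symmetric] intro: id_ideal.step)

lemma id_ideal_mult_left: "a \<in> id_ideal X \<Longrightarrow> c * a \<in> id_ideal X"
proof (induction rule: id_ideal.induct)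
  case (step z r p q)
  then have "c * z + (c * p) * r * q \<in> id_ideal X" by (intro id_ideal.step)
  then show ?case by (simp add: algebra_simps)
qed (simp add: id_ideal.zero)

lemma id_ideal_mult_right: "a \<in> id_ideal X \<Longrightarrow> a * c \<in> id_ideal X"
proof (induction rule: id_ideal.induct)
  case (step z r p q)
  then have "z * c + p * r * (q * c) \<in> id_ideal X" by (intro id_ideal.step)
  then show ?case by (simp add: algebra_simps)
qed (simp add: id_ideal.zero)

section \<open>Congruence modulo the ideal\<close>

definition id_cong :: "cox_type \<Rightarrow> free_alg \<Rightarrow> free_alg \<Rightarrow> bool" where
  "id_cong X a b \<longleftrightarrow> a - b \<in> id_ideal X"

lemma id_cong_refl [simp]: "id_cong X a a"
  by (simp add: id_cong_def id_ideal.zero)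

lemma id_cong_sym: "id_cong X a b \<Longrightarrow> id_cong X b a"
  using id_ideal_mult_left[of "a - b" X "-1"] by (simp add: id_cong_def)

lemma id_cong_trans [trans]: "id_cong X a b \<Longrightarrow> id_cong X b c \<Longrightarrow> id_cong X a c"
  using id_ideal_add[of "b - c" X "a - b"] by (simp add: id_cong_def)

lemma id_cong_add: "id_cong X a b \<Longrightarrow> id_cong X c d \<Longrightarrow> id_cong X (a + c) (b + d)"
  using id_ideal_add[of "c - d" X "a - b"] by (simp add: id_cong_def algebra_simps)

lemma id_cong_mult_left: "id_cong X a b \<Longrightarrow> id_cong X (c * a) (c * b)"
  using id_ideal_mult_left[of "a - b" X c] by (simp add: id_cong_def algebra_simps)

lemma id_cong_mult_right: "id_cong X a b \<Longrightarrow> id_cong X (a * c) (b * c)"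
  using id_ideal_mult_right[of "a - b" X c] by (simp add: id_cong_def algebra_simps)

lemma id_cong_alg_act: "id_cong X a b \<Longrightarrow> alg_act X a f = alg_act X b f"
  using alg_act_ideal[of "a - b" X f] by (auto simp: id_cong_def fun_eq_iff alg_act_diff)

lemma scalar_central: "scalar c * z = z * scalar c"
  by (induction z rule: poly_mapping_sum_induct)
     (simp_all add: scalar_def mult_single distrib_left distrib_right mult.commute)

lemma scalar_mult: "scalar (c * d) = scalar c * scalar d"
  by (simp add: scalar_def mult_single)

lemma scalar_add: "scalar (c + d) = scalar c + scalar d"
  by (simp add: scalar_def single_add)

lemma scalar_0 [simp]: "scalar 0 = 0" and scalar_1 [simp]: "scalar 1 = 1"
  by (simp_all add: scalar_def)

lemma u_square_cong:
  "g \<in> gens X \<Longrightarrow> id_cong X (u_word [g] * u_word [g]) (scalar (const_coef beta) * u_word [g])"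
  using id_ideal_relator[OF id_relators.square, of g X] by (simp add: id_cong_def u_word_append[symmetric])

subsection \<open>Independence of the reduced word\<close>

lemma reduced_word_Cons:
  assumes "reduced_word X w (g # ws)"
  shows "g \<in> gens X" "desc g w" "reduced_word X (simple_refl g \<circ> w) ws"
proof -
  have ws: "set ws \<subseteq> gens X" "word_prod ws = simple_refl g \<circ> w" "Suc (length ws) = cox_len X w"
    using assms by (auto simp: reduced_word_def)
  show g: "g \<in> gens X" using assms by (auto simp: reduced_word_def)
  have le: "cox_len X (simple_refl g \<circ> w) \<le> length ws" using cox_len_le[OF ws(1)] ws(2) by simp
  have w: "w \<in> Weyl X" by (rule reduced_word_Weyl[OF assms])
  show d: "desc g w" unfolding desc_iff_cox_len[OF w g] using le ws by simp
  show "reduced_word X (simple_refl g \<circ> w) ws"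
    using ws cox_len_desc[OF w g d] by (simp add: reduced_word_def)
qed

lemma reduced_word_ConsI:
  assumes "g \<in> gens X" "w \<in> Weyl X" "desc g w" "reduced_word X (simple_refl g \<circ> w) ws"
  shows "reduced_word X w (g # ws)"
  using assms cox_len_desc[OF assms(2,1,3)] by (simp add: reduced_word_def)

lemma length_alternating [simp]: "length (alternating g h m) = m"
  by (induction m arbitrary: g h) auto

lemma set_alternating: "set (alternating g h m) \<subseteq> {g, h}"
proof (induction m arbitrary: g h)
  case (Suc m)
  then show ?case using Suc[of h g] by auto
qed simp

lemma alternating_Cons: "m > 0 \<Longrightarrow> alternating g h m = g # alternating h g (m - 1)"
  by (cases m) auto

text \<open>Matsumoto's argument, by induction on the length. Words with the same first letter
  reduce to their tails. If the first letters \<open>g\<close> and \<open>h\<close> differ, both are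
  descents, so by \<open>cox_len_braid\<close> there are reduced words starting with either
  alternating word in \<open>g\<close> and \<open>h\<close>; these two differ by one braid relator
  and link the given words.\<close>

lemma reduced_words_cong:
  "reduced_word X w us \<Longrightarrow> reduced_word X w vs \<Longrightarrow> id_cong X (u_word us) (u_word vs)"
proof (induction "length us" arbitrary: w us vs rule: less_induct)
  case less
  have len: "length us = length vs" using less.prems by (simp add: reduced_word_def)
  have head: "id_cong X (u_word (g # us')) (u_word (g # vs'))"
    if "reduced_word X w (g # us')" "reduced_word X w (g # vs')" for g us' vs'
  proof -
    have "length us' < length us" using that(1) less.prems(1) by (auto simp: reduced_word_def)
    then have "id_cong X (u_word us') (u_word vs')"
      using less.hyps reduced_word_Cons(3) that by blast
    then have "id_cong X (u_word [g] * u_word us') (u_word [g] * u_word vs')"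
      by (rule id_cong_mult_left)
    then show ?thesis by (simp add: u_word_append[symmetric])
  qed
  show ?case
  proof (cases us)
    case Nil
    then show ?thesis using len by simp
  next
    case us: (Cons g us')
    with len obtain h vs' where vs: "vs = h # vs'" by (cases vs) auto
    note red = less.prems[unfolded us vs]
    show ?thesis
    proof (cases "g = h")
      case True
      then show ?thesis using head red us vs by simp
    next
      case ne: False
      note g = reduced_word_Cons[OF red(1)] and h = reduced_word_Cons[OF red(2)]
      have w: "w \<in> Weyl X" by (rule reduced_word_Weyl[OF red(1)])
      let ?m = "cox_m g h"
      obtain x where x: "x \<in> Weyl X" "w = word_prod (alternating g h ?m) \<circ> x"
        "cox_len X w = ?m + cox_len X x"
        using cox_len_braid[OF g(1) h(1) ne w g(2) h(2)] .
      obtain xs where xs: "reduced_word X x xs" using exists_reduced_word[OF x(1)] ..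
      have set: "set (alternating a b ?m) \<subseteq> gens X" if "a = g \<and> b = h \<or> a = h \<and> b = g" for a b
        using set_alternating[of a b ?m] that g(1) h(1) by blast
      have r1: "reduced_word X w (alternating g h ?m @ xs)"
        using xs x set[of g h] by (simp add: reduced_word_def)
      have r2: "reduced_word X w (alternating h g ?m @ xs)"
        using xs x set[of h g] word_prod_braid[OF g(1) h(1) ne] by (simp add: reduced_word_def)
      have m: "?m > 0" using cox_m_pos[OF g(1) h(1) ne] .
      have "id_cong X (u_word us) (u_word (alternating g h ?m @ xs))"
        using head[of g us'] red(1) r1 by (simp add: alternating_Cons[OF m] us)
      also have "id_cong X (u_word (alternating g h ?m @ xs)) (u_word (alternating h g ?m @ xs))"
        unfolding u_word_append
        by (intro id_cong_mult_right)
           (use id_ideal_relator[OF id_relators.braid[OF g(1) h(1) ne]] in \<open>simp add: id_cong_def\<close>)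
      also have "id_cong X (u_word (alternating h g ?m @ xs)) (u_word vs)"
        using head[of h _ vs'] red(2) r2 by (simp add: alternating_Cons[OF m] vs)
      finally show ?thesis .
    qed
  qed
qed

lemma u_elem_cong: "reduced_word X w ws \<Longrightarrow> id_cong X (u_elem X w) (u_word ws)"
  unfolding u_elem_def by (rule reduced_words_cong, rule someI)

lemma u_mult_u_elem:
  assumes g: "g \<in> gens X" and w: "w \<in> Weyl X"
  shows "\<not> desc g w \<Longrightarrow> id_cong X (u_word [g] * u_elem X w) (u_elem X (simple_refl g \<circ> w))"
    and "desc g w \<Longrightarrow> id_cong X (u_word [g] * u_elem X w) (scalar (const_coef beta) * u_elem X w)"
proof -
  assume nd: "\<not> desc g w"
  obtain ws where ws: "reduced_word X w ws" using exists_reduced_word[OF w] ..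
  have "desc g (simple_refl g \<circ> w)" using nd desc_simple_refl[OF w g] by simp
  then have r: "reduced_word X (simple_refl g \<circ> w) (g # ws)"
    using ws by (intro reduced_word_ConsI g simple_refl_Weyl w) simp_all
  have "id_cong X (u_word [g] * u_elem X w) (u_word [g] * u_word ws)"
    by (intro id_cong_mult_left u_elem_cong ws)
  also have "id_cong X (u_word [g] * u_word ws) (u_elem X (simple_refl g \<circ> w))"
    using id_cong_sym[OF u_elem_cong[OF r]] by (simp add: u_word_append[symmetric])
  finally show "id_cong X (u_word [g] * u_elem X w) (u_elem X (simple_refl g \<circ> w))" .
next
  assume d: "desc g w"
  obtain ws where ws: "reduced_word X (simple_refl g \<circ> w) ws"
    using exists_reduced_word[OF simple_refl_Weyl[OF g w]] ..
  have r: "id_cong X (u_elem X w) (u_word [g] * u_word ws)"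
    using u_elem_cong[OF reduced_word_ConsI[OF g w d ws]] by (simp add: u_word_append[symmetric])
  have "id_cong X (u_word [g] * u_elem X w) (u_word [g] * (u_word [g] * u_word ws))"
    by (rule id_cong_mult_left[OF r])
  also have "id_cong X (u_word [g] * (u_word [g] * u_word ws))
      (scalar (const_coef beta) * u_word [g] * u_word ws)"
    unfolding mult.assoc[symmetric] by (rule id_cong_mult_right[OF u_square_cong[OF g]])
  also have "id_cong X (scalar (const_coef beta) * u_word [g] * u_word ws)
      (scalar (const_coef beta) * u_elem X w)"
    unfolding mult.assoc by (rule id_cong_mult_left[OF id_cong_sym[OF r]])
  finally show "id_cong X (u_word [g] * u_elem X w) (scalar (const_coef beta) * u_elem X w)" .
qed

definition delta :: "(int \<Rightarrow> int) \<Rightarrow> (int \<Rightarrow> int) \<Rightarrow> 'r::comm_ring_1" where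
  "delta u w = (if w = u then 1 else 0)"

definition delta_id :: "(int \<Rightarrow> int) \<Rightarrow> 'r::comm_ring_1" where
  "delta_id = delta id"

lemma hecke_delta_up:
  assumes "g \<in> gens X" "w \<in> Weyl X" "\<not> desc g w"
  shows "hecke X t g (delta w) = delta (simple_refl g \<circ> w)"
proof
  fix v
  have "simple_refl g \<circ> v = w \<longleftrightarrow> v = simple_refl g \<circ> w"
    by (metis simple_refl_cancel_left)
  then show "hecke X t g (delta w) v = delta (simple_refl g \<circ> w) v"
    using assms desc_simple_refl[OF assms(2,1)] simple_refl_Weyl[OF assms(1,2)]
    by (auto simp: hecke_def delta_def)
qed

text \<open>Read from the right, every letter of a reduced word raises the length, and there
  \<open>hecke\<close> just moves the point mass.\<close>

lemma word_act_reduced: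
  "reduced_word X w ws \<Longrightarrow> word_act X ws delta_id = delta w"
proof (induction ws arbitrary: w)
  case Nil
  then have "w = id" by (simp add: reduced_word_def)
  then show ?case by (simp only: word_act_simps delta_id_def)
next
  case (Cons g ws)
  note r = reduced_word_Cons[OF Cons.prems]
  have w: "w \<in> Weyl X" by (rule reduced_word_Weyl[OF Cons.prems])
  have "\<not> desc g (simple_refl g \<circ> w)" using r(2) desc_simple_refl[OF w r(1)] by simp
  then have "hecke X (const_coef beta) g (delta (simple_refl g \<circ> w)) = delta w"
    using hecke_delta_up[OF r(1) simple_refl_Weyl[OF r(1) w]] by simp
  then show ?case by (simp only: word_act_simps Cons.IH[OF r(3)])
qed

lemma alg_act_u_elem:
  assumes "w \<in> Weyl X"
  shows "alg_act X (u_elem X w) delta_id = delta w"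
proof -
  obtain ws where "reduced_word X w ws" using exists_reduced_word[OF assms] ..
  then show ?thesis
    using id_cong_alg_act[OF u_elem_cong] word_act_reduced by (simp add: alg_act_u_word)
qed

text \<open>A generator sends a basis element to another one or to \<open>beta\<close> times itself,
  so a word never produces a sum; a foreign letter makes the coefficient zero.\<close>

lemma u_word_spanned: "\<exists>c w. w \<in> Weyl X \<and> id_cong X (u_word ws) (scalar c * u_elem X w)"
proof (induction ws)
  case Nil
  have "reduced_word X id []" using cox_len_le[of "[]" X] by (simp add: reduced_word_def)
  then have "id_cong X (u_word []) (scalar 1 * u_elem X id)"
    using id_cong_sym[OF u_elem_cong] by simp
  then show ?case by (intro exI conjI) (rule id_Weyl)
next
  case (Cons g ws)
  then obtain c w where w: "w \<in> Weyl X" and "id_cong X (u_word ws) (scalar c * u_elem X w)" by blast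
  then have "id_cong X (u_word [g] * u_word ws) (u_word [g] * (scalar c * u_elem X w))"
    by (intro id_cong_mult_left)
  then have *: "id_cong X (u_word (g # ws)) (scalar c * (u_word [g] * u_elem X w))"
    by (simp add: u_word_append[symmetric] mult.assoc[symmetric] scalar_central[of c "u_word [g]"])
  consider "g \<notin> gens X" | "g \<in> gens X" "desc g w" | "g \<in> gens X" "\<not> desc g w" by blast
  then show ?case
  proof cases
    case 1
    then have "id_cong X (u_word [g]) 0"
      using id_ideal_relator[OF id_relators.unused] by (simp add: id_cong_def)
    then have "id_cong X (scalar c * (u_word [g] * u_elem X w)) (scalar c * (0 * u_elem X w))"
      by (intro id_cong_mult_left id_cong_mult_right)
    then have "id_cong X (u_word (g # ws)) (scalar 0 * u_elem X w)"
      using id_cong_trans[OF *] by simp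
    then show ?thesis using w by blast
  next
    case 2
    have "id_cong X (u_word (g # ws)) (scalar (c * const_coef beta) * u_elem X w)"
      using id_cong_trans[OF * id_cong_mult_left[OF u_mult_u_elem(2)[OF 2(1) w 2(2)]]]
      by (simp add: scalar_mult mult.assoc)
    then show ?thesis using w by blast
  next
    case 3
    have "id_cong X (u_word (g # ws)) (scalar c * u_elem X (simple_refl g \<circ> w))"
      using id_cong_trans[OF * id_cong_mult_left[OF u_mult_u_elem(1)[OF 3(1) w 3(2)]]] .
    then show ?thesis using simple_refl_Weyl[OF 3(1) w] by blast
  qed
qed

lemma id_cong_expansion:
  "\<exists>S. finite S \<and> S \<subseteq> Weyl X \<and> (\<forall>w. w \<notin> S \<longrightarrow> alg_act X z delta_id w = 0) \<and>
     id_cong X z (\<Sum>w\<in>S. scalar (alg_act X z delta_id w) * u_elem X w)"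
proof (induction z rule: poly_mapping_sum_induct)
  case zero
  then show ?case by (intro exI[of _ "{}"]) simp
next
  case (single k c)
  obtain d w where w: "w \<in> Weyl X" and d: "id_cong X (u_word (letters k)) (scalar d * u_elem X w)"
    using u_word_spanned by blast
  have s: "Poly_Mapping.single k c = scalar c * u_word (letters k)"
    by (simp add: scalar_def u_word_def mult_single)
  have c: "id_cong X (Poly_Mapping.single k c) (scalar (c * d) * u_elem X w)"
    unfolding s using id_cong_mult_left[OF d, of "scalar c"] by (simp add: scalar_mult mult.assoc)
  have "alg_act X (Poly_Mapping.single k c) delta_id v = (if v = w then c * d else 0)" for v
    by (simp add: id_cong_alg_act[OF c] alg_act_scalar_mult alg_act_u_elem[OF w] delta_def)
  then show ?case using c w by (intro exI[of _ "{w}"]) simp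
next
  case (add p q)
  obtain S where S: "finite S" "S \<subseteq> Weyl X" "\<And>w. w \<notin> S \<Longrightarrow> alg_act X p delta_id w = 0"
    "id_cong X p (\<Sum>w\<in>S. scalar (alg_act X p delta_id w) * u_elem X w)" using add(1) by blast
  obtain T where T: "finite T" "T \<subseteq> Weyl X" "\<And>w. w \<notin> T \<Longrightarrow> alg_act X q delta_id w = 0"
    "id_cong X q (\<Sum>w\<in>T. scalar (alg_act X q delta_id w) * u_elem X w)" using add(2) by blast
  have 1: "(\<Sum>w\<in>S. scalar (alg_act X p delta_id w) * u_elem X w)
      = (\<Sum>w\<in>S \<union> T. scalar (alg_act X p delta_id w) * u_elem X w)"
    using S T by (intro sum.mono_neutral_left) auto
  have 2: "(\<Sum>w\<in>T. scalar (alg_act X q delta_id w) * u_elem X w)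
      = (\<Sum>w\<in>S \<union> T. scalar (alg_act X q delta_id w) * u_elem X w)"
    using S T by (intro sum.mono_neutral_left) auto
  have "id_cong X (p + q) (\<Sum>w\<in>S \<union> T. scalar (alg_act X (p + q) delta_id w) * u_elem X w)"
    using id_cong_add[OF S(4) T(4)] unfolding 1 2 alg_act_add scalar_add distrib_right sum.distrib .
  then show ?case using S T by (intro exI[of _ "S \<union> T"]) (auto simp: alg_act_add)
qed

text \<open>Existence is \<open>id_cong_expansion\<close>. For uniqueness, any candidate expansion
  applied to \<open>delta_id\<close> returns its own coefficients, because \<open>u_elem X w\<close>
  gives \<open>delta w\<close>.\<close>

lemma id_coeff_eq: "id_coeff X z = alg_act X z delta_id"
  unfolding id_coeff_def
proof (rule the_equality)
  let ?c = "alg_act X z delta_id"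
  obtain S where S: "finite S" "S \<subseteq> Weyl X" "\<And>w. w \<notin> S \<Longrightarrow> ?c w = 0"
    "id_cong X z (\<Sum>w\<in>S. scalar (?c w) * u_elem X w)"
    using id_cong_expansion[of X z] by (elim exE conjE) (rule that; simp)
  have sub: "{w. ?c w \<noteq> 0} \<subseteq> S" using S(3) by blast
  have "(\<Sum>w\<in>{w. ?c w \<noteq> 0}. scalar (?c w) * u_elem X w) = (\<Sum>w\<in>S. scalar (?c w) * u_elem X w)"
    using S(1) sub by (intro sum.mono_neutral_left) auto
  then show "finite {w. ?c w \<noteq> 0} \<and> {w. ?c w \<noteq> 0} \<subseteq> Weyl X \<and>
      z - (\<Sum>w\<in>{w. ?c w \<noteq> 0}. scalar (?c w) * u_elem X w) \<in> id_ideal X"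
    using S(1,2,4) sub finite_subset[OF sub S(1)] unfolding id_cong_def by auto
next
  fix c
  assume c: "finite {w. c w \<noteq> 0} \<and> {w. c w \<noteq> 0} \<subseteq> Weyl X \<and>
      z - (\<Sum>w\<in>{w. c w \<noteq> 0}. scalar (c w) * u_elem X w) \<in> id_ideal X"
  show "c = alg_act X z delta_id"
  proof
    fix v
    have "id_cong X z (\<Sum>w\<in>{w. c w \<noteq> 0}. scalar (c w) * u_elem X w)"
      using c by (simp add: id_cong_def)
    then have "alg_act X z delta_id v = (\<Sum>w\<in>{w. c w \<noteq> 0}. c w * alg_act X (u_elem X w) delta_id v)"
      by (simp add: id_cong_alg_act alg_act_sum alg_act_scalar_mult)
    also have "\<dots> = (\<Sum>w\<in>{w. c w \<noteq> 0}. if v = w then c v else 0)"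
      using c by (intro sum.cong refl) (auto simp: alg_act_u_elem subset_iff delta_def)
    also have "\<dots> = c v" using c by simp
    finally show "c v = alg_act X z delta_id v" by simp
  qed
qed

section \<open>Evaluation of polynomials\<close>

lemma polynomial_induct [case_names const var add mult]:
  fixes p :: "('v \<Rightarrow>\<^sub>0 nat) \<Rightarrow>\<^sub>0 'c::comm_ring_1"
  assumes const: "\<And>c. P (Poly_Mapping.single 0 c)"
    and var: "\<And>y. P (Poly_Mapping.single (Poly_Mapping.single y 1) 1)"
    and add: "\<And>p q. P p \<Longrightarrow> P q \<Longrightarrow> P (p + q)"
    and mult: "\<And>p q. P p \<Longrightarrow> P q \<Longrightarrow> P (p * q)"
  shows "P p"
proof (induction p rule: poly_mapping_sum_induct)
  case zero
  then show ?case using const[of 0] by simp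
next
  case (single m c)
  have pow: "P (Poly_Mapping.single (Poly_Mapping.single y n) 1)" for y n
  proof (induction n)
    case 0
    then show ?case using const[of 1] by simp
  next
    case (Suc n)
    then show ?case using mult[OF var[of y] Suc] by (simp add: mult_single single_add[symmetric])
  qed
  have "P (Poly_Mapping.single m 1)"
  proof (induction m rule: poly_mapping_sum_induct)
    case zero
    then show ?case using const[of 1] by simp
  next
    case (single y n)
    then show ?case by (rule pow)
  next
    case (add p q)
    then show ?case using mult[OF add] by (simp add: mult_single)
  qed
  then show ?case using mult[OF const[of c], of "Poly_Mapping.single m 1"] by (simp add: mult_single)
qed (rule add)

definition mon_eval :: "('v \<Rightarrow> 'r::comm_ring_1) \<Rightarrow> ('v \<Rightarrow>\<^sub>0 nat) \<Rightarrow> 'r" where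
  "mon_eval s m = (\<Prod>y\<in>Poly_Mapping.keys m. s y ^ Poly_Mapping.lookup m y)"

text \<open>The coefficient map \<open>h\<close> is kept separate: \<open>zbeta\<close> gives the
  substitution in the b variables, the identity of \<open>base\<close> gives localization.\<close>

definition poly_eval ::
    "('c::comm_ring_1 \<Rightarrow> 'r::comm_ring_1) \<Rightarrow> ('v \<Rightarrow> 'r) \<Rightarrow> (('v \<Rightarrow>\<^sub>0 nat) \<Rightarrow>\<^sub>0 'c) \<Rightarrow> 'r" where
  "poly_eval h s p = (\<Sum>m\<in>Poly_Mapping.keys p. h (Poly_Mapping.lookup p m) * mon_eval s m)"

lemma mon_eval_add: "mon_eval s (m + n) = mon_eval s m * mon_eval s n"
proof -
  let ?S = "Poly_Mapping.keys m \<union> Poly_Mapping.keys n"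
  have *: "mon_eval s k = (\<Prod>y\<in>?S. s y ^ Poly_Mapping.lookup k y)" if "Poly_Mapping.keys k \<subseteq> ?S" for k
    unfolding mon_eval_def using that by (intro prod.mono_neutral_left) (auto simp: in_keys_iff)
  have "Poly_Mapping.keys (m + n) \<subseteq> ?S" by (rule Poly_Mapping.keys_add)
  then show ?thesis by (simp add: * lookup_add power_add prod.distrib)
qed

definition ring_hom_fun :: "('c::comm_ring_1 \<Rightarrow> 'r::comm_ring_1) \<Rightarrow> bool" where
  "ring_hom_fun h \<longleftrightarrow> h 1 = 1 \<and> (\<forall>x y. h (x + y) = h x + h y) \<and> (\<forall>x y. h (x * y) = h x * h y)"

lemma ring_hom_fun_0: "ring_hom_fun h \<Longrightarrow> h 0 = 0"
  unfolding ring_hom_fun_def by (metis add_cancel_right_right)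

lemma ring_hom_fun_simps:
  assumes "ring_hom_fun h"
  shows "h 0 = 0" "h 1 = 1" "h (x + y) = h x + h y" "h (x * y) = h x * h y" "h (- x) = - h x"
    "h (x - y) = h x - h y" "h (x ^ n) = h x ^ n"
proof -
  show a: "h 0 = 0" "h 1 = 1" "\<And>x y. h (x + y) = h x + h y" "\<And>x y. h (x * y) = h x * h y"
    using assms ring_hom_fun_0 by (auto simp: ring_hom_fun_def)
  show "h (- x) = - h x" for x using a(3)[of x "- x"] a(1) by (simp add: eq_neg_iff_add_eq_0 add.commute)
  then show "h (x - y) = h x - h y" using a(3)[of x "- y"] by simp
  show "h (x ^ n) = h x ^ n" by (induction n) (simp_all add: a)
qed

context
  fixes h :: "'c::comm_ring_1 \<Rightarrow> 'r::comm_ring_1" and s :: "'v \<Rightarrow> 'r"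
  assumes hom: "ring_hom_fun h"
begin

lemma poly_eval_superset:
  "finite S \<Longrightarrow> Poly_Mapping.keys p \<subseteq> S \<Longrightarrow>
   poly_eval h s p = (\<Sum>m\<in>S. h (Poly_Mapping.lookup p m) * mon_eval s m)"
  unfolding poly_eval_def
  by (intro sum.mono_neutral_left) (auto simp: in_keys_iff ring_hom_fun_simps[OF hom])

lemma poly_eval_add: "poly_eval h s (p + q) = poly_eval h s p + poly_eval h s q"
proof -
  let ?S = "Poly_Mapping.keys p \<union> Poly_Mapping.keys q"
  have "Poly_Mapping.keys (p + q) \<subseteq> ?S" by (rule Poly_Mapping.keys_add)
  then show ?thesis
    by (simp add: poly_eval_superset[of ?S] lookup_add sum.distrib ring_hom_fun_simps[OF hom] algebra_simps)
qed

lemma poly_eval_single: "poly_eval h s (Poly_Mapping.single m c) = h c * mon_eval s m"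
  by (cases "c = 0") (simp_all add: poly_eval_def ring_hom_fun_simps[OF hom])

lemma poly_eval_const: "poly_eval h s (Poly_Mapping.single 0 c) = h c"
  by (simp add: poly_eval_single mon_eval_def)

lemma poly_eval_var: "poly_eval h s (Poly_Mapping.single (Poly_Mapping.single y 1) 1) = s y"
  by (simp add: poly_eval_single mon_eval_def ring_hom_fun_simps[OF hom])

lemma poly_eval_0: "poly_eval h s 0 = 0"
  by (simp add: poly_eval_def)

lemma poly_eval_mult: "poly_eval h s (p * q) = poly_eval h s p * poly_eval h s q"
proof (induction p rule: poly_mapping_sum_induct)
  case (single m c)
  show ?case
    by (induction q rule: poly_mapping_sum_induct)
       (simp_all add: mult_single poly_eval_single mon_eval_add distrib_left poly_eval_add poly_eval_0
         ring_hom_fun_simps[OF hom] algebra_simps)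
qed (simp_all add: distrib_right poly_eval_add poly_eval_0)

lemma ring_hom_poly_eval: "ring_hom_fun (poly_eval h s)"
  using poly_eval_const[of 1] by (simp add: ring_hom_fun_def poly_eval_add poly_eval_mult ring_hom_fun_simps[OF hom])

end

section \<open>The action on the base ring\<close>

type_synonym bpoly = "(nat \<Rightarrow>\<^sub>0 nat) \<Rightarrow>\<^sub>0 int poly"

definition emb :: "bpoly \<Rightarrow> base" where
  "emb p = Fraction_Field.Fract p 1"

lemma ring_hom_emb: "ring_hom_fun emb"
  by (simp add: ring_hom_fun_def emb_def One_fract_def)

lemma emb_eq_0_iff: "emb p = 0 \<longleftrightarrow> p = 0"
  by (simp add: emb_def Zero_fract_def eq_fract)

lemma zbeta_emb: "zbeta c = emb (Poly_Mapping.single 0 c)"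
  by (simp add: zbeta_def emb_def)

lemma ring_hom_zbeta: "ring_hom_fun zbeta"
proof -
  have "Poly_Mapping.single 0 (x * y) = (Poly_Mapping.single 0 x * Poly_Mapping.single 0 y :: bpoly)" for x y
    by (simp add: mult_single)
  then show ?thesis using ring_hom_emb by (simp add: ring_hom_fun_def zbeta_emb single_add)
qed

lemma b_pos_emb: "b_pos i = emb (Poly_Mapping.single (Poly_Mapping.single (i - 1) 1) 1)"
  by (simp add: b_pos_def emb_def)

lemma Fract_emb: "q \<noteq> 0 \<Longrightarrow> Fraction_Field.Fract p q = emb p / emb q"
  by (simp add: emb_def)

lemma b_pos_unit: "1 + beta * b_pos i \<noteq> 0"
proof -
  let ?p = "1 + Poly_Mapping.single 0 [:0, 1:] * Poly_Mapping.single (Poly_Mapping.single (i - 1) 1) 1 :: bpoly"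
  have "Poly_Mapping.single (i - 1) (1::nat) \<noteq> 0"
    by (metis lookup_single_eq lookup_zero zero_neq_one)
  then have "Poly_Mapping.lookup ?p 0 = 1"
    by (simp add: lookup_add lookup_one mult_single lookup_single when_def)
  then have "?p \<noteq> 0" by (metis lookup_zero zero_neq_one)
  moreover have "1 + beta * b_pos i = emb ?p"
    by (simp only: beta_def zbeta_emb b_pos_emb ring_hom_fun_simps[OF ring_hom_emb])
  ultimately show ?thesis by (simp add: emb_eq_0_iff)
qed

lemma one_plus_beta_bar:
  assumes "1 + beta * x \<noteq> 0"
  shows "1 + beta * bar x = 1 / (1 + beta * x)"
  using assms by (simp add: bar_def divide_simps)

lemma bar_bar [simp]: "1 + beta * x \<noteq> 0 \<Longrightarrow> bar (bar x) = x"
  unfolding bar_def[of "bar x"] by (simp add: one_plus_beta_bar) (simp add: bar_def)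

lemma b_var_unit [simp]: "1 + beta * b_var k \<noteq> 0"
proof -
  have "1 + beta * bar (b_pos i) \<noteq> 0" for i
    by (simp add: one_plus_beta_bar b_pos_unit)
  then show ?thesis by (simp add: b_var_def b_pos_unit)
qed

lemma bar_b_var: "k \<noteq> 0 \<Longrightarrow> bar (b_var k) = b_var (- k)"
  by (simp add: b_var_def b_pos_unit)

text \<open>The argument \<open>int j + 1\<close> undoes the shift between the polynomial variable j
  and the index of b.\<close>

definition b_image :: "gen \<Rightarrow> nat \<Rightarrow> base" where
  "b_image g j = b_var (simple_refl g (int j + 1))"

definition b_eval :: "gen \<Rightarrow> bpoly \<Rightarrow> base" where
  "b_eval g = poly_eval zbeta (b_image g)"

lemmas b_eval_simps =
  ring_hom_fun_simps[OF ring_hom_poly_eval[OF ring_hom_zbeta], of "b_image _", folded b_eval_def]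

lemma b_eval_const: "b_eval g (Poly_Mapping.single 0 c) = zbeta c"
  by (simp add: b_eval_def poly_eval_const[OF ring_hom_zbeta])

lemma b_eval_var: "b_eval g (Poly_Mapping.single (Poly_Mapping.single j 1) 1) = b_image g j"
  unfolding b_eval_def by (rule poly_eval_var[OF ring_hom_zbeta])

text \<open>The substitution is an involution once denominators are allowed; this gives its injectivity.\<close>

lemma b_eval_involution:
  "\<exists>d q. d \<noteq> 0 \<and> b_eval g d \<noteq> 0 \<and> b_eval g p * emb d = emb q \<and> b_eval g q = emb p * b_eval g d"
proof (induction p rule: polynomial_induct)
  case (const c)
  show ?case
    by (intro exI[of _ 1] exI[of _ "Poly_Mapping.single 0 c"])
       (simp add: b_eval_const zbeta_emb b_eval_simps ring_hom_fun_simps[OF ring_hom_emb])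
next
  case (var j)
  let ?v = "\<lambda>k. Poly_Mapping.single (Poly_Mapping.single k 1) 1 :: bpoly"
  let ?k = "simple_refl g (int j + 1)"
  have "?k \<noteq> 0" using signed_perm_eq_0_iff[OF signed_perm_simple_refl, of g "int j + 1"] by simp
  then consider "?k > 0" | "?k < 0" by linarith
  then show ?case
  proof cases
    case 1
    define i where "i = nat ?k - 1"
    have i: "?k = int i + 1" using 1 by (simp add: i_def)
    then have i': "simple_refl g (int i + 1) = int j + 1" by (metis simple_refl_invol)
    have "b_eval g (?v j) * emb 1 = emb (?v i)"
      by (simp only: b_eval_var b_image_def i) (simp add: b_var_def b_pos_emb nat_add_distrib ring_hom_fun_simps[OF ring_hom_emb])
    moreover have "b_eval g (?v i) = emb (?v j) * b_eval g 1"
      by (simp only: b_eval_var b_image_def i') (simp add: b_var_def b_pos_emb nat_add_distrib b_eval_simps)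
    ultimately show ?thesis by (intro exI[of _ 1] exI[of _ "?v i"]) (simp add: b_eval_simps)
  next
    case 2
    define i where "i = nat (- ?k) - 1"
    have i: "?k = - (int i + 1)" using 2 by (simp add: i_def)
    then have i': "simple_refl g (int i + 1) = - (int j + 1)"
      by (metis simple_refl_invol simple_refl_odd minus_minus)
    \<comment> \<open>\<open>?d\<close> is the denominator of \<open>bar (b_pos (i + 1))\<close>,
      whose numerator is \<open>- ?v i\<close>.\<close>
    let ?d = "1 + Poly_Mapping.single 0 [:0, 1:] * ?v i"
    have emb_v: "emb (?v k) = b_pos (k + 1)" for k by (simp add: b_pos_emb)
    have ed: "emb ?d = 1 + beta * b_pos (i + 1)"
      by (simp only: ring_hom_fun_simps[OF ring_hom_emb] emb_v beta_def zbeta_emb)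
    have vk: "b_eval g (?v j) = bar (b_pos (i + 1))" "b_eval g (?v i) = bar (b_pos (j + 1))"
      by (simp_all only: b_eval_var b_image_def i i') (simp_all add: b_var_def nat_add_distrib)
    have bd: "b_eval g ?d = 1 + beta * bar (b_pos (j + 1))"
      by (simp only: b_eval_simps b_eval_const vk beta_def)
    have "b_eval g (?v j) * emb ?d = emb (- ?v i)"
      unfolding vk ed ring_hom_fun_simps(5)[OF ring_hom_emb] emb_v
      using b_pos_unit[of "i + 1"] by (simp add: bar_def)
    moreover have "b_eval g (- ?v i) = emb (?v j) * b_eval g ?d"
      unfolding b_eval_simps(5) bd vk emb_v one_plus_beta_bar[OF b_pos_unit]
      by (simp add: bar_def)
    moreover have "?d \<noteq> 0"
      using b_pos_unit[of "i + 1"] unfolding ed[symmetric] emb_eq_0_iff .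
    moreover have "b_eval g ?d \<noteq> 0"
      unfolding bd one_plus_beta_bar[OF b_pos_unit] using b_pos_unit[of "j + 1"] by simp
    ultimately show ?thesis by blast
  qed
next
  case (add p p')
  then obtain d q d' q' where *: "d \<noteq> 0" "b_eval g d \<noteq> 0" "b_eval g p * emb d = emb q"
    "b_eval g q = emb p * b_eval g d" "d' \<noteq> 0" "b_eval g d' \<noteq> 0"
    "b_eval g p' * emb d' = emb q'" "b_eval g q' = emb p' * b_eval g d'" by metis
  have "b_eval g (p + p') * emb (d * d') = emb (q * d' + q' * d)"
    by (simp add: b_eval_simps ring_hom_fun_simps[OF ring_hom_emb] *(3,7)[symmetric] algebra_simps)
  moreover have "b_eval g (q * d' + q' * d) = emb (p + p') * b_eval g (d * d')"
    by (simp add: b_eval_simps ring_hom_fun_simps[OF ring_hom_emb] *(4,8) algebra_simps)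
  ultimately show ?case using * by (intro exI[of _ "d * d'"] exI) (auto simp: b_eval_simps)
next
  case (mult p p')
  then obtain d q d' q' where *: "d \<noteq> 0" "b_eval g d \<noteq> 0" "b_eval g p * emb d = emb q"
    "b_eval g q = emb p * b_eval g d" "d' \<noteq> 0" "b_eval g d' \<noteq> 0"
    "b_eval g p' * emb d' = emb q'" "b_eval g q' = emb p' * b_eval g d'" by metis
  have "b_eval g (p * p') * emb (d * d') = emb (q * q')"
    by (simp add: b_eval_simps ring_hom_fun_simps[OF ring_hom_emb] *(3,7)[symmetric] algebra_simps)
  moreover have "b_eval g (q * q') = emb (p * p') * b_eval g (d * d')"
    by (simp add: b_eval_simps ring_hom_fun_simps[OF ring_hom_emb] *(4,8) algebra_simps)
  ultimately show ?case using * by (intro exI[of _ "d * d'"] exI) (auto simp: b_eval_simps)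
qed

lemma b_eval_eq_0_iff: "b_eval g p = 0 \<longleftrightarrow> p = 0"
proof
  assume "b_eval g p = 0"
  with b_eval_involution[of g p] obtain d q where "b_eval g d \<noteq> 0" "emb q = 0"
    "b_eval g q = emb p * b_eval g d" by (metis mult_zero_left)
  then show "p = 0" by (simp add: emb_eq_0_iff b_eval_simps)
qed (simp add: b_eval_simps)

text \<open>Extension to fractions. The description is meaningful because \<open>b_eval g\<close> is
  injective, so that denominators stay nonzero and equal fractions have equal images.\<close>

definition b_endo :: "gen \<Rightarrow> base \<Rightarrow> base" where
  "b_endo g x = (THE y. \<exists>p q. q \<noteq> 0 \<and> x = Fraction_Field.Fract p q \<and> y = b_eval g p / b_eval g q)"

lemma b_endo_Fract:
  assumes "q \<noteq> 0" shows "b_endo g (Fraction_Field.Fract p q) = b_eval g p / b_eval g q"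
  unfolding b_endo_def
proof (rule the_equality)
  fix y assume "\<exists>p' q'. q' \<noteq> 0 \<and> Fraction_Field.Fract p q = Fraction_Field.Fract p' q' \<and> y = b_eval g p' / b_eval g q'"
  then obtain p' q' where *: "q' \<noteq> 0" "p * q' = p' * q" "y = b_eval g p' / b_eval g q'"
    using assms by (auto simp: eq_fract)
  have "b_eval g p * b_eval g q' = b_eval g p' * b_eval g q"
    using arg_cong[OF *(2), of "b_eval g"] by (simp add: b_eval_simps)
  then show "y = b_eval g p / b_eval g q"
    using * assms by (simp add: frac_eq_eq b_eval_eq_0_iff)
qed (use assms in blast)

lemma ring_endo_iff: "ring_endo f \<longleftrightarrow> ring_hom_fun f"
  by (simp add: ring_endo_def ring_hom_fun_def)

lemma ring_hom_b_endo: "ring_hom_fun (b_endo g)"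
proof -
  have 1: "b_endo g 1 = 1" by (simp add: One_fract_def b_endo_Fract b_eval_simps)
  have 2: "b_endo g (x + y) = b_endo g x + b_endo g y \<and> b_endo g (x * y) = b_endo g x * b_endo g y" for x y
  proof -
    obtain p q p' q' where *: "x = Fraction_Field.Fract p q" "q \<noteq> 0" "y = Fraction_Field.Fract p' q'" "q' \<noteq> 0"
      by (metis Fract_cases)
    then have "b_eval g q \<noteq> 0" "b_eval g q' \<noteq> 0" by (simp_all add: b_eval_eq_0_iff)
    then show ?thesis unfolding *
      using *(2,4) by (simp add: b_endo_Fract b_eval_simps add_frac_eq)
  qed
  show ?thesis using 1 2 by (simp add: ring_hom_fun_def)
qed

lemma b_endo_emb: "b_endo g (emb p) = b_eval g p"
  by (simp add: emb_def b_endo_Fract b_eval_simps)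

lemma b_endo_beta: "b_endo g beta = beta"
  by (simp add: beta_def zbeta_emb b_endo_emb b_eval_const)

lemma b_endo_b_var_pos: "k > 0 \<Longrightarrow> b_endo g (b_var k) = b_var (simple_refl g k)"
  by (simp add: b_var_def b_pos_emb b_endo_emb b_eval_var[simplified] b_image_def nat_diff_distrib)

text \<open>Integer constants are built from 1, and \<open>pCons\<close> is a Horner step in
  \<open>beta\<close>.\<close>

lemma ring_hom_fun_zbeta_unique:
  assumes f: "ring_hom_fun f" "f beta = beta"
  shows "f (zbeta c) = zbeta c"
proof -
  note fs = ring_hom_fun_simps[OF f(1)] and zs = ring_hom_fun_simps[OF ring_hom_zbeta]
  have nat: "f (of_nat n) = of_nat n" "zbeta (of_nat n) = of_nat n" for n
    by (induction n) (simp_all add: fs zs)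
  have int: "f (zbeta [:a:]) = zbeta [:a:]" for a
  proof -
    have "[:a:] = of_int a" by (simp add: of_int_poly)
    moreover have "zbeta (of_int a) = of_int a" "f (of_int a) = of_int a"
      by (cases a; simp add: fs zs nat)+
    ultimately show ?thesis by simp
  qed
  show ?thesis
  proof (induction c)
    case (pCons a p)
    have "pCons a p = [:a:] + [:0, 1:] * p" by simp
    then have "zbeta (pCons a p) = zbeta [:a:] + beta * zbeta p"
      by (simp only: zs beta_def)
    with pCons int f(2) show ?case by (simp add: fs)
  qed (simp add: fs zs)
qed

text \<open>The prescribed values determine an endomorphism on polynomials; multiplying by a
  denominator, whose image is nonzero, determines it on the field.\<close>

lemma b_act_eq: "b_act g = b_endo g"
  unfolding b_act_def
proof (rule the_equality)
  show "ring_endo (b_endo g) \<and> b_endo g beta = beta \<and> (\<forall>k>0. b_endo g (b_var k) = b_var (simple_refl g k))"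
    by (simp add: ring_endo_iff ring_hom_b_endo b_endo_beta b_endo_b_var_pos)
next
  fix f assume f: "ring_endo f \<and> f beta = beta \<and> (\<forall>k>0. f (b_var k) = b_var (simple_refl g k))"
  then have hom: "ring_hom_fun f" by (simp add: ring_endo_iff)
  note fs = ring_hom_fun_simps[OF hom]
  have emb: "f (emb p) = b_eval g p" for p
  proof (induction p rule: polynomial_induct)
    case (const c)
    then show ?case using ring_hom_fun_zbeta_unique[OF hom] f by (simp add: zbeta_emb[symmetric] b_eval_const)
  next
    case (var j)
    have "f (b_var (int j + 1)) = b_image g j" using f by (simp add: b_image_def)
    then show ?case unfolding b_eval_var by (simp add: b_var_def b_pos_emb nat_add_distrib)
  qed (simp_all add: fs ring_hom_fun_simps[OF ring_hom_emb] b_eval_simps)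
  show "f = b_endo g"
  proof
    fix x :: base
    obtain p q where x: "x = Fraction_Field.Fract p q" "q \<noteq> 0" by (metis Fract_cases)
    then have "x * emb q = emb p" by (simp add: Fract_emb emb_eq_0_iff)
    then have "f x * b_eval g q = b_eval g p" using fs(4)[of x "emb q"] by (simp add: emb)
    then show "f x = b_endo g x" using x by (simp add: b_endo_Fract b_eval_eq_0_iff field_simps)
  qed
qed

lemmas b_act_simps = ring_hom_fun_simps[OF ring_hom_b_endo, folded b_act_eq]

lemma b_act_beta: "b_act g beta = beta"
  by (simp add: b_act_eq b_endo_beta)

lemma b_act_bar: "b_act g (bar x) = bar (b_act g x)"
proof (cases "1 + beta * x = 0")
  \<comment> \<open>Both sides are 0 here, by the convention for division by zero.\<close>
  case True
  then have "1 + beta * b_act g x = 0"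
    using b_act_simps(3)[of g 1 "beta * x"] by (simp add: b_act_simps b_act_beta)
  with True show ?thesis by (simp add: bar_def b_act_simps)
next
  case False
  have "bar x * (1 + beta * x) = - x" using False by (simp add: bar_def)
  then have *: "b_act g (bar x) * (1 + beta * b_act g x) = - b_act g x"
    using b_act_simps(4)[of g "bar x" "1 + beta * x"] by (simp add: b_act_simps b_act_beta)
  \<comment> \<open>The image of an inverse is an inverse, so \<open>1 + beta * b_act g x\<close> is
    again nonzero.\<close>
  have "(1 + beta * x) * (1 / (1 + beta * x)) = 1" using False by simp
  then have "(1 + beta * b_act g x) * b_act g (1 / (1 + beta * x)) = 1"
    using b_act_simps(4)[of g "1 + beta * x" "1 / (1 + beta * x)"] by (simp add: b_act_simps b_act_beta)
  then have "1 + beta * b_act g x \<noteq> 0" by auto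
  then show ?thesis using * by (simp add: bar_def field_simps)
qed

lemma b_act_b_var:
  assumes "k \<noteq> 0" shows "b_act g (b_var k) = b_var (simple_refl g k)"
proof (cases "k > 0")
  case True
  then show ?thesis by (simp add: b_act_eq b_endo_b_var_pos)
next
  case False
  have "simple_refl g k \<noteq> 0"
    using assms signed_perm_eq_0_iff[OF signed_perm_simple_refl] by simp
  then have "b_var (simple_refl g k) = bar (b_var (simple_refl g (- k)))"
    by (simp add: bar_b_var simple_refl_odd)
  moreover have "b_act g (b_var (- k)) = b_var (simple_refl g (- k))"
    using False assms by (simp add: b_act_eq b_endo_b_var_pos)
  moreover have "b_var k = bar (b_var (- k))" using assms by (simp add: bar_b_var)
  ultimately show ?thesis by (simp add: b_act_bar)
qed

section \<open>Products of the factors \<open>h\<^sub>i(x)\<close>\<close>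

text \<open>The coefficients of a product of factors h_g(x). The ring is left open: it is
  \<open>coef\<close> before localization and \<open>base\<close> after it.\<close>

definition hprod :: "cox_type \<Rightarrow> 'r::comm_ring_1 \<Rightarrow> (gen \<times> 'r) list \<Rightarrow> (int \<Rightarrow> int) \<Rightarrow> 'r" where
  "hprod X t l = foldr (\<lambda>(g, x) f w. f w + x * hecke X t g f w) l delta_id"

lemma hprod_simps [simp]:
  "hprod X t [] = delta_id"
  "hprod X t ((g, x) # l) w = hprod X t l w + x * hecke X t g (hprod X t l) w"
  by (simp_all add: hprod_def)

text \<open>\<open>hecke\<close> uses ring operations only, so a homomorphism acts on the labels. It
  is applied to localization and to \<open>b_act g\<close>.\<close>

lemma hprod_hom:
  assumes h: "ring_hom_fun h"
  shows "h (hprod X t l w) = hprod X (h t) (map (apsnd h) l) w"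
proof (induction l arbitrary: w)
  case Nil
  then show ?case by (simp add: delta_id_def delta_def ring_hom_fun_simps[OF h])
next
  case (Cons p l)
  have IH: "h (hprod X t l u) = hprod X (h t) (map (apsnd h) l) u" for u by (rule Cons)
  have "h (hecke X t g (hprod X t l) w) = hecke X (h t) g (hprod X (h t) (map (apsnd h) l)) w" for g
    by (simp add: hecke_def ring_hom_fun_simps[OF h] IH)
  then show ?case by (cases p) (simp add: ring_hom_fun_simps[OF h] IH)
qed

definition hlist :: "(gen \<times> coef) list \<Rightarrow> free_alg" where
  "hlist l = prod_list (map (\<lambda>(g, x). h_op g x) l)"

lemma hlist_simps [simp]:
  "hlist [] = 1" "hlist ((g, x) # l) = h_op g x * hlist l" "hlist (l @ l') = hlist l * hlist l'"
  by (simp_all add: hlist_def)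

lemma hlist_concat: "hlist (concat ls) = prod_list (map hlist ls)"
  by (induction ls) simp_all

lemma alg_act_hlist: "alg_act X (hlist l) delta_id = hprod X (const_coef beta) l"
proof (induction l)
  case Nil
  then show ?case by (simp add: alg_act_1)
next
  case (Cons p l)
  show ?case
    by (cases p, rule ext)
       (simp add: h_op_def alg_act_mult alg_act_add alg_act_1 alg_act_scalar alg_act_u_word Cons.IH)
qed

text \<open>Expanding with u^2 = beta u leaves 1 + (x + y + beta x y) u.\<close>

lemma h_op_mult_cong:
  assumes "g \<in> gens X" "x + y + const_coef beta * x * y = 0"
  shows "id_cong X (h_op g x * h_op g y) 1"
proof -
  let ?u = "u_word [g]"
  have "scalar x * ?u * (scalar y * ?u) = scalar x * (?u * scalar y) * ?u" by (simp only: mult.assoc)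
  also have "\<dots> = scalar (x * y) * (?u * ?u)"
    by (simp only: scalar_central[of y ?u, symmetric] scalar_mult mult.assoc)
  finally have "h_op g x * h_op g y = 1 + (scalar (x + y) * ?u + scalar (x * y) * (?u * ?u))"
    by (simp add: h_op_def distrib_left distrib_right scalar_add add.assoc)
  also have "id_cong X \<dots> (1 + (scalar (x + y) * ?u + scalar (x * y) * (scalar (const_coef beta) * ?u)))"
    using assms(1) by (intro id_cong_add id_cong_refl id_cong_mult_left u_square_cong)
  also have "scalar (x + y) * ?u + scalar (x * y) * (scalar (const_coef beta) * ?u)
      = scalar (x + y + const_coef beta * x * y) * ?u"
  proof -
    have "scalar (x * y) * (scalar (const_coef beta) * ?u) = scalar (x * y * const_coef beta) * ?u"
      by (simp only: scalar_mult mult.assoc)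
    moreover have "const_coef beta * x * y = x * y * const_coef beta" by (simp add: ac_simps)
    ultimately show ?thesis by (simp only: scalar_add distrib_right)
  qed
  finally show ?thesis using assms(2) by simp
qed

lemma hlist_left_inverse:
  assumes "\<And>g i. (g, i) \<in> set K \<Longrightarrow> g \<in> gens X"
    and "\<And>g i. (g, i) \<in> set K \<Longrightarrow> b i + a i + const_coef beta * b i * a i = 0"
  shows "id_cong X (hlist (rev (map (apsnd b) K)) * hlist (map (apsnd a) K)) 1"
  using assms
proof (induction K)
  case (Cons k K)
  obtain g i where k: "k = (g, i)" by (cases k)
  have "id_cong X (h_op g (b i) * h_op g (a i)) 1"
    using Cons.prems k by (intro h_op_mult_cong) auto
  then have "id_cong X (hlist (rev (map (apsnd b) K)) * (h_op g (b i) * h_op g (a i)) * hlist (map (apsnd a) K))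
      (hlist (rev (map (apsnd b) K)) * 1 * hlist (map (apsnd a) K))"
    by (intro id_cong_mult_left id_cong_mult_right)
  also have "id_cong X (hlist (rev (map (apsnd b) K)) * 1 * hlist (map (apsnd a) K)) 1"
  proof -
    have "id_cong X (hlist (rev (map (apsnd b) K)) * hlist (map (apsnd a) K)) 1"
      by (rule Cons.IH) (meson Cons.prems list.set_intros(2))+
    then show ?thesis by simp
  qed
  finally show ?case by (simp add: k mult.assoc)
qed simp

text \<open>The letters of \<open>G\<close> of type \<open>A\<^bsub>n-1\<^esub>\<close>, each with the number of the variable it carries.\<close>

definition G_skel :: "nat \<Rightarrow> (gen \<times> nat) list" where
  "G_skel n = concat (map (\<lambda>i. map (\<lambda>j. (Gen j, i)) (rev [i..<n])) [1..<n])"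

fun F_gens :: "cox_type \<Rightarrow> nat \<Rightarrow> gen list" where
  "F_gens TypeA n = []"
| "F_gens TypeB n = map Gen (rev [1..<n]) @ [Gen 0] @ map Gen [1..<n]"
| "F_gens TypeC n = map Gen (rev [1..<n]) @ [Gen 0, Gen 0] @ map Gen [1..<n]"
| "F_gens TypeD n = map Gen (rev [1..<n]) @ [GenHat1] @ map Gen [2..<n]"

lemma G_op_hlist: "G_op n a = hlist (map (apsnd a) (G_skel n))"
proof -
  have "A_op n i x = hlist (map (\<lambda>j. (Gen j, x)) (rev [i..<n]))" for i x
    by (simp add: A_op_def hlist_def comp_def)
  then show ?thesis
    by (simp add: G_op_def G_skel_def map_concat hlist_concat comp_def)
qed

lemma F_op_hlist: "F_op X n x = hlist (map (\<lambda>g. (g, x)) (F_gens X n))"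
  by (cases X) (simp_all add: hlist_def comp_def power2_eq_square mult.assoc)

lemma F_prod_hlist: "F_prod X n x = hlist (concat (map (\<lambda>i. map (\<lambda>g. (g, x i)) (F_gens X n)) [1..<n+1]))"
  by (simp add: F_prod_def F_op_hlist hlist_concat comp_def)

lemma G_skel_gens: "(g, i) \<in> set (G_skel n) \<Longrightarrow> (\<exists>j. g = Gen j \<and> 1 \<le> j \<and> j < n) \<and> 1 \<le> i \<and> g \<in> gens X"
  by (cases X) (auto simp: G_skel_def)

lemma ring_hom_const_coef: "ring_hom_fun const_coef"
  by (simp add: ring_hom_fun_def const_coef_def single_add mult_single)

lemma bar_cancel: "1 + beta * x \<noteq> 0 \<Longrightarrow> x + bar x + beta * x * bar x = 0"
  by (simp add: bar_def field_simps)

text \<open>The label \<open>Inl i\<close> carries \<open>b\<^sub>i\<close> and \<open>Inr y\<close> carries the variable \<open>y\<close>; reversing \<open>G_skel\<close>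
  and replacing each \<open>b\<^sub>i bar\<close> by \<open>b\<^sub>i\<close> gives the inverse.\<close>

definition Groth_word :: "cox_type \<Rightarrow> nat \<Rightarrow> (gen \<times> (nat + axvar)) list" where
  "Groth_word X n = rev (map (apsnd Inl) (G_skel n))
     @ concat (map (\<lambda>i. map (\<lambda>g. (g, Inr (VarX i))) (F_gens X n)) [1..<n+1])
     @ map (apsnd (\<lambda>i. Inr (VarA i))) (G_skel n)"

text \<open>\<open>id_inverse\<close> picks an unspecified representative. The reversed word
  \<open>?H\<close> is a two-sided inverse modulo the ideal, and inverses are unique there, so it
  may be substituted for the chosen one.\<close>

lemma Groth_fin_hprod:
  "Groth_fin X n = hprod X (const_coef beta)
     (map (apsnd (case_sum (\<lambda>i. const_coef (b_var (int i))) var_coef)) (Groth_word X n))"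
proof -
  let ?b = "\<lambda>i. const_coef (b_var (int i))" and ?a = "\<lambda>i. const_coef (bar (b_var (int i)))"
  let ?G = "G_op n ?a" and ?H = "hlist (rev (map (apsnd ?b) (G_skel n)))"
  have z: "?b i + ?a i + const_coef beta * ?b i * ?a i = 0" for i
    using arg_cong[OF bar_cancel[OF b_var_unit, of "int i"], of const_coef]
    by (simp add: ring_hom_fun_simps[OF ring_hom_const_coef])
  then have z': "?a i + ?b i + const_coef beta * ?a i * ?b i = 0" for i
    by (simp add: ac_simps)
  have 1: "id_cong X (?H * ?G) 1"
    unfolding G_op_hlist using G_skel_gens[of _ _ n X] z by (intro hlist_left_inverse) auto
  have "id_cong X (hlist (rev (map (apsnd ?a) (rev (G_skel n)))) * hlist (map (apsnd ?b) (rev (G_skel n)))) 1"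
    using G_skel_gens[of _ _ n X] z' by (intro hlist_left_inverse) auto
  then have 2: "id_cong X (?G * ?H) 1" by (simp add: rev_map G_op_hlist)
  have "id_inverse X ?G * ?G - 1 \<in> id_ideal X \<and> ?G * id_inverse X ?G - 1 \<in> id_ideal X"
    unfolding id_inverse_def by (rule someI[of _ ?H]) (use 1 2 in \<open>simp add: id_cong_def\<close>)
  then have 3: "id_cong X (id_inverse X ?G * ?G) 1" by (simp add: id_cong_def)
  have "id_cong X (id_inverse X ?G) (id_inverse X ?G * (?G * ?H))"
    using id_cong_mult_left[OF id_cong_sym[OF 2], of "id_inverse X ?G"] by simp
  also have "id_cong X (id_inverse X ?G * (?G * ?H)) ?H"
    using id_cong_mult_right[OF 3, of ?H] by (simp add: mult.assoc)
  finally have "id_cong X (id_inverse X ?G * (F_prod X n (\<lambda>i. var_coef (VarX i)) * G_op n (\<lambda>i. var_coef (VarA i))))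
    (?H * (F_prod X n (\<lambda>i. var_coef (VarX i)) * G_op n (\<lambda>i. var_coef (VarA i))))"
    by (rule id_cong_mult_right)
  then have "Groth_fin X n = alg_act X (?H * (F_prod X n (\<lambda>i. var_coef (VarX i)) * G_op n (\<lambda>i. var_coef (VarA i)))) delta_id"
    unfolding Groth_fin_def id_coeff_eq mult.assoc by (rule id_cong_alg_act)
  also have "?H * (F_prod X n (\<lambda>i. var_coef (VarX i)) * G_op n (\<lambda>i. var_coef (VarA i)))
    = hlist (map (apsnd (case_sum ?b var_coef)) (Groth_word X n))"
    by (simp add: Groth_word_def F_prod_hlist G_op_hlist map_concat rev_map[symmetric] comp_def apsnd_compose)
  finally show ?thesis by (simp add: alg_act_hlist)
qed

section \<open>Stability\<close>

text \<open>The ideal generated by the variables x_i with i > \<open>N\<close>, described through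
  monomials.\<close>

definition high_polys :: "nat \<Rightarrow> coef set" where
  "high_polys N = {p. \<forall>m. (\<forall>i>N. VarX i \<notin> Poly_Mapping.keys m) \<longrightarrow> Poly_Mapping.lookup p m = 0}"

lemma high_polys_0: "0 \<in> high_polys N"
  by (simp add: high_polys_def)

lemma high_polys_add: "p \<in> high_polys N \<Longrightarrow> q \<in> high_polys N \<Longrightarrow> p + q \<in> high_polys N"
  by (simp add: high_polys_def lookup_add)

lemma high_polys_mult:
  assumes "p \<in> high_polys N" shows "q * p \<in> high_polys N"
  unfolding high_polys_def
proof (intro CollectI allI impI)
  fix m :: "axvar \<Rightarrow>\<^sub>0 nat" assume m: "\<forall>i>N. VarX i \<notin> Poly_Mapping.keys m"
  have "Poly_Mapping.lookup p k = 0" if "m = l + k" for l k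
  proof -
    have "Poly_Mapping.keys k \<subseteq> Poly_Mapping.keys m"
      using that by (auto simp: in_keys_iff lookup_add)
    then have "\<forall>i>N. VarX i \<notin> Poly_Mapping.keys k" using m by blast
    then show ?thesis using assms unfolding high_polys_def by blast
  qed
  then have "(Poly_Mapping.lookup p k when m = l + k) = 0" for l k by (simp add: when_def)
  then show "Poly_Mapping.lookup (q * p) m = 0" by (simp add: lookup_mult)
qed

lemma high_polys_mult': "p \<in> high_polys N \<Longrightarrow> p * q \<in> high_polys N"
  using high_polys_mult[of p N q] by (simp add: mult.commute)

lemma var_coef_high: "i > N \<Longrightarrow> var_coef (VarX i) \<in> high_polys N"
  by (auto simp: high_polys_def var_coef_def lookup_single when_def)

text \<open>A factor 1 + x u with x in the ideal is 1 modulo the ideal, so removing it changes no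
  coefficient modulo the ideal.\<close>

lemma hprod_drop_high:
  assumes "\<And>g x. (g, x) \<in> set l \<Longrightarrow> \<not> P (g, x) \<Longrightarrow> s x \<in> high_polys N"
  shows "hprod X t (map (apsnd s) l) w - hprod X t (map (apsnd s) (filter P l)) w \<in> high_polys N"
  using assms
proof (induction l arbitrary: w)
  case Nil
  then show ?case by (simp add: high_polys_0)
next
  case (Cons p l)
  obtain g x where p: "p = (g, x)" by (cases p)
  let ?f = "hprod X t (map (apsnd s) l)" and ?f' = "hprod X t (map (apsnd s) (filter P l))"
  have IH: "?f w - ?f' w \<in> high_polys N" for w
    by (rule Cons.IH) (meson Cons.prems list.set_intros(2))
  show ?case
  proof (cases "P p")
    case True
    have "hecke X t g ?f w - hecke X t g ?f' w
        = (if g \<in> gens X \<and> w \<in> Weyl X \<and> desc g w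
           then t * (?f w - ?f' w) + (?f (simple_refl g \<circ> w) - ?f' (simple_refl g \<circ> w)) else 0)"
      by (simp add: hecke_def algebra_simps)
    also have "\<dots> \<in> high_polys N"
      using high_polys_add[OF high_polys_mult[OF IH] IH] high_polys_0 by simp
    finally have "(?f w - ?f' w) + s x * (hecke X t g ?f w - hecke X t g ?f' w) \<in> high_polys N"
      by (intro high_polys_add IH high_polys_mult)
    then show ?thesis using True by (simp add: p algebra_simps)
  next
    case False
    then have "(?f w - ?f' w) + s x * hecke X t g ?f w \<in> high_polys N"
      using Cons.prems[of g x] p by (intro high_polys_add IH high_polys_mult') simp
    then show ?thesis using False by (simp add: p algebra_simps)
  qed
qed

text \<open>\<open>GenHat1\<close> moves 1 and 2 just as \<open>Gen 1\<close> does; for N >= 2, an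
  index below N says that the generator belongs to rank N.\<close>

fun gen_index :: "gen \<Rightarrow> nat" where
  "gen_index (Gen i) = i"
| "gen_index GenHat1 = 1"

lemma desc_gen_index:
  assumes w: "signed_perm w" "fixes_above N w" and N: "N \<ge> 2" and d: "desc g w"
  shows "gen_index g < N"
proof (cases g)
  case (Gen i)
  have y: "fixes_above N (inv w)" by (rule fixes_above_inv[OF signed_perm_bij w(2)]) fact
  show ?thesis
  proof (rule ccontr)
    assume "\<not> ?thesis"
    then have i: "i \<ge> N" using Gen by simp
    then have *: "inv w (int i + 1) = int i + 1" using y by (auto simp: fixes_above_def)
    have "inv w (int i) \<le> int i"
    proof (cases "i = N")
      case True
      have "\<bar>inv w (int i)\<bar> \<le> int N"
        by (rule fixes_above_bound[OF bij_imp_bij_inv y]) (use w True in \<open>auto simp: signed_perm_bij\<close>)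
      with True show ?thesis by simp
    qed (use i y in \<open>auto simp: fixes_above_def\<close>)
    with * show False using d Gen i N by (auto simp: desc_def)
  qed
qed (use N in simp)

lemma fixes_above_simple_refl_comp:
  "fixes_above N w \<Longrightarrow> N \<ge> 2 \<Longrightarrow> gen_index g < N \<Longrightarrow> fixes_above N (simple_refl g \<circ> w)"
  by (cases g) (auto simp: fixes_above_def simple_refl_eq)

text \<open>A letter of index at least \<open>N\<close> is no descent of an element of rank
  \<open>N\<close>, so its \<open>hecke\<close> term vanishes. The other letters keep
  \<open>simple_refl g \<circ> w\<close> in rank \<open>N\<close>, where the induction hypothesis
  applies.\<close>

lemma hprod_filter_gens:
  assumes "w \<in> Weyl X" "fixes_above N w" "N \<ge> 2"
  shows "hprod X t l w = hprod X t (filter (\<lambda>(g, x). gen_index g < N) l) w"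
  using assms(1,2)
proof (induction l arbitrary: w)
  case (Cons p l)
  obtain g x where p: "p = (g, x)" by (cases p)
  let ?l = "filter (\<lambda>(g, x). gen_index g < N) l"
  show ?case
  proof (cases "gen_index g < N")
    case True
    have "hprod X t l (simple_refl g \<circ> w) = hprod X t ?l (simple_refl g \<circ> w)" if "g \<in> gens X"
      using True that Cons.prems fixes_above_simple_refl_comp[OF Cons.prems(2) assms(3) True]
      by (intro Cons.IH simple_refl_Weyl)
    then have "hecke X t g (hprod X t l) w = hecke X t g (hprod X t ?l) w"
      using Cons.IH[OF Cons.prems] by (simp add: hecke_def)
    then show ?thesis using True Cons.IH[OF Cons.prems] by (simp add: p)
  next
    case False
    then have "\<not> desc g w" using desc_gen_index[OF Weyl_signed_perm] Cons.prems assms(3) by blast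
    then show ?thesis using False Cons.IH[OF Cons.prems] by (simp add: p hecke_def)
  qed
qed simp

lemma filter_less_upt: "i \<le> N \<Longrightarrow> N \<le> n \<Longrightarrow> filter (\<lambda>j. j < N) [i..<n] = [i..<N]"
proof -
  assume a: "i \<le> N" "N \<le> n"
  then obtain k where n: "n = N + k" by (metis le_iff_add)
  have "filter (\<lambda>j. j < N) [i..<N] = [i..<N]" by (simp add: filter_id_conv)
  moreover have "filter (\<lambda>j. j < N) [N..<n] = []" by (simp add: filter_empty_conv)
  ultimately show ?thesis using a upt_add_eq_append[of i N k] by (simp add: n)
qed

lemma filter_G_skel:
  assumes "1 \<le> N" "N \<le> n"
  shows "filter (\<lambda>(g, i). gen_index g < N) (G_skel n) = G_skel N"
proof -
  obtain k where n: "n = N + k" using assms by (metis le_iff_add)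
  have "filter (\<lambda>(g, i). gen_index g < N) (map (\<lambda>j. (Gen j, i)) (rev [i..<n])) = map (\<lambda>j. (Gen j, i)) (rev [i..<N])"
    if "i < N" for i
    using that assms filter_less_upt[of i N n] by (simp add: filter_map comp_def rev_filter[symmetric])
  then have 1: "concat (map (\<lambda>i. filter (\<lambda>(g, i). gen_index g < N) (map (\<lambda>j. (Gen j, i)) (rev [i..<n]))) [1..<N]) = G_skel N"
    unfolding G_skel_def by (intro arg_cong[of _ _ concat] map_cong) auto
  have 2: "concat (map (\<lambda>i. filter (\<lambda>(g, i). gen_index g < N) (map (\<lambda>j. (Gen j, i)) (rev [i..<n]))) [N..<n]) = []"
    by (auto simp: filter_empty_conv)
  have "[1..<n] = [1..<N] @ [N..<n]" using assms upt_add_eq_append[of 1 N k] by (simp add: n)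
  then have "filter (\<lambda>(g, i). gen_index g < N) (G_skel n)
     = concat (map (\<lambda>i. filter (\<lambda>(g, i). gen_index g < N) (map (\<lambda>j. (Gen j, i)) (rev [i..<n]))) [1..<N])
     @ concat (map (\<lambda>i. filter (\<lambda>(g, i). gen_index g < N) (map (\<lambda>j. (Gen j, i)) (rev [i..<n]))) [N..<n])"
    by (simp add: G_skel_def filter_concat comp_def)
  with 1 2 show ?thesis by simp
qed

lemma filter_F_gens:
  assumes "2 \<le> N" "N \<le> n" shows "filter (\<lambda>g. gen_index g < N) (F_gens X n) = F_gens X N"
  using assms filter_less_upt[of 1 N n] filter_less_upt[of 2 N n]
  by (cases X) (simp_all add: filter_map comp_def rev_filter[symmetric])

lemma filter_Groth_word:
  assumes "2 \<le> N" "N \<le> n"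
  shows "filter (\<lambda>(g, l). gen_index g < N) (filter (\<lambda>(g, l). \<forall>i. l = Inr (VarX i) \<longrightarrow> i \<le> N) (Groth_word X n))
    = Groth_word X N"
proof -
  let ?P = "\<lambda>(g, l :: nat + axvar). gen_index g < N \<and> (\<forall>i. l = Inr (VarX i) \<longrightarrow> i \<le> N)"
  obtain k where n: "n = N + k" using assms by (metis le_iff_add)
  have 1: "filter ?P (rev (map (apsnd Inl) (G_skel n))) = rev (map (apsnd Inl) (G_skel N))"
    using filter_G_skel[of N n] assms
    by (simp add: rev_filter[symmetric] filter_map comp_def case_prod_unfold del: rev_map)
  have 3: "filter ?P (map (apsnd (\<lambda>i. Inr (VarA i))) (G_skel n)) = map (apsnd (\<lambda>i. Inr (VarA i))) (G_skel N)"
    using filter_G_skel[of N n] assms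
    by (simp add: filter_map comp_def case_prod_unfold)
  have a: "filter ?P (map (\<lambda>g. (g, Inr (VarX i) :: nat + axvar)) (F_gens X n)) = map (\<lambda>g. (g, Inr (VarX i) :: nat + axvar)) (F_gens X N)"
    if "i \<le> N" for i
    using filter_F_gens[OF assms, of X] that by (simp add: filter_map comp_def)
  have b: "filter ?P (map (\<lambda>g. (g, Inr (VarX i) :: nat + axvar)) (F_gens X n)) = []" if "N < i" for i
    using that by (simp add: filter_empty_conv)
  have "[1..<n+1] = [1..<N+1] @ [N+1..<n+1]" using upt_add_eq_append[of 1 "N+1" k] by (simp add: n)
  then have "filter ?P (concat (map (\<lambda>i. map (\<lambda>g. (g, Inr (VarX i) :: nat + axvar)) (F_gens X n)) [1..<n+1]))
    = concat (map (\<lambda>i. filter ?P (map (\<lambda>g. (g, Inr (VarX i) :: nat + axvar)) (F_gens X n))) [1..<N+1])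
    @ concat (map (\<lambda>i. filter ?P (map (\<lambda>g. (g, Inr (VarX i) :: nat + axvar)) (F_gens X n))) [N+1..<n+1])"
    by (simp only: map_append concat_append filter_append filter_concat map_map comp_def)
  also have "concat (map (\<lambda>i. filter ?P (map (\<lambda>g. (g, Inr (VarX i) :: nat + axvar)) (F_gens X n))) [1..<N+1])
    = concat (map (\<lambda>i. map (\<lambda>g. (g, Inr (VarX i) :: nat + axvar)) (F_gens X N)) [1..<N+1])"
    using a by (intro arg_cong[of _ _ concat] map_cong) auto
  also have "concat (map (\<lambda>i. filter ?P (map (\<lambda>g. (g, Inr (VarX i) :: nat + axvar)) (F_gens X n))) [N+1..<n+1]) = []"
    using b by (simp add: concat_eq_Nil_conv del: upt_Suc filter_map)
  finally have 2: "filter ?P (concat (map (\<lambda>i. map (\<lambda>g. (g, Inr (VarX i) :: nat + axvar)) (F_gens X n)) [1..<n+1]))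
    = concat (map (\<lambda>i. map (\<lambda>g. (g, Inr (VarX i) :: nat + axvar)) (F_gens X N)) [1..<N+1])" by simp
  have "filter (\<lambda>(g, l). gen_index g < N) (filter (\<lambda>(g, l). \<forall>i. l = Inr (VarX i) \<longrightarrow> i \<le> N) (Groth_word X n))
      = filter ?P (Groth_word X n)"
    by (simp add: case_prod_unfold conj_commute)
  also have "\<dots> = Groth_word X N"
    by (simp only: Groth_word_def filter_append 1 2 3)
  finally show ?thesis .
qed

text \<open>Dropping the x_i with i > \<open>N\<close> changes only monomials that contain one of
  them; dropping the letters of index at least \<open>N\<close> does not change the coefficient of
  u_w. What is left is the word of rank \<open>N\<close>.\<close>

lemma lookup_Groth_fin_stable:
  assumes w: "w \<in> Weyl X" "fixes_above N w" and N: "2 \<le> N" "N \<le> n"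
    and m: "\<forall>i>N. VarX i \<notin> Poly_Mapping.keys m"
  shows "Poly_Mapping.lookup (Groth_fin X n w) m = Poly_Mapping.lookup (Groth_fin X N w) m"
proof -
  let ?s = "case_sum (\<lambda>i. const_coef (b_var (int i))) var_coef"
  let ?P = "\<lambda>(g::gen, l::nat + axvar). \<forall>i. l = Inr (VarX i) \<longrightarrow> i \<le> N"
  let ?l = "filter ?P (Groth_word X n)"
  have "hprod X (const_coef beta) (map (apsnd ?s) (Groth_word X n)) w
      - hprod X (const_coef beta) (map (apsnd ?s) ?l) w \<in> high_polys N"
    by (rule hprod_drop_high) (auto simp: not_le intro: var_coef_high)
  moreover have "hprod X (const_coef beta) (map (apsnd ?s) ?l) w
      = hprod X (const_coef beta) (filter (\<lambda>(g, x). gen_index g < N) (map (apsnd ?s) ?l)) w"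
    by (rule hprod_filter_gens[OF w N(1)])
  moreover have "filter (\<lambda>(g, x). gen_index g < N) (map (apsnd ?s) ?l)
      = map (apsnd ?s) (filter (\<lambda>(g, l). gen_index g < N) ?l)"
    by (simp only: filter_map) (simp add: comp_def case_prod_unfold)
  ultimately have "Groth_fin X n w - Groth_fin X N w \<in> high_polys N"
    by (simp only: Groth_fin_hprod filter_Groth_word[OF N])
  then have "Poly_Mapping.lookup (Groth_fin X n w - Groth_fin X N w) m = 0"
    using m unfolding high_polys_def by blast
  then show ?thesis by (simp add: lookup_minus)
qed

lemma Groth_lookup:
  assumes w: "w \<in> Weyl X" "fixes_above N w" and N: "2 \<le> N"
    and m: "\<forall>i>N. VarX i \<notin> Poly_Mapping.keys m"
  shows "Groth X w m = Poly_Mapping.lookup (Groth_fin X N w) m"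
  unfolding Groth_def eventual_value_def
proof (rule the_equality)
  have st: "Poly_Mapping.lookup (Groth_fin X n w) m = Poly_Mapping.lookup (Groth_fin X N w) m" if "n \<ge> N" for n
    using lookup_Groth_fin_stable[OF w N that m] .
  show "\<forall>\<^sub>F n in sequentially. Poly_Mapping.lookup (Groth_fin X n w) m = Poly_Mapping.lookup (Groth_fin X N w) m"
    unfolding eventually_sequentially by (intro exI[of _ N] allI impI) (rule st)
  fix c assume "\<forall>\<^sub>F n in sequentially. Poly_Mapping.lookup (Groth_fin X n w) m = c"
  then obtain M where M: "\<And>n. n \<ge> M \<Longrightarrow> Poly_Mapping.lookup (Groth_fin X n w) m = c"
    by (auto simp: eventually_sequentially)
  then show "c = Poly_Mapping.lookup (Groth_fin X N w) m"
    by (intro trans[OF M[OF max.cobounded1, symmetric] st[OF max.cobounded2]])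
qed

definition loc_word :: "cox_type \<Rightarrow> nat \<Rightarrow> (int \<Rightarrow> int) \<Rightarrow> (gen \<times> base) list" where
  "loc_word X n v = map (apsnd (case_sum (\<lambda>i. b_var (int i)) (loc_subst v))) (Groth_word X n)"

lemma mono_value_eq: "mono_value = mon_eval"
  by (simp add: fun_eq_iff mono_value_def mon_eval_def)

text \<open>A variable x_i with i > \<open>N\<close> localizes to 0, because v i = i > 0. So only
  monomials whose coefficients are already stable at rank \<open>N\<close> contribute, and the
  formal sum becomes the evaluation of a polynomial.\<close>

lemma psi_hprod:
  assumes w: "w \<in> Weyl X" "fixes_above N w" and v: "fixes_above N v" and N: "2 \<le> N"
  shows "psi X w v = hprod X beta (loc_word X N v) w"
proof -
  let ?P = "Groth_fin X N w" and ?s = "loc_subst v"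
  have eq: "Groth X w m * mono_value ?s m = Poly_Mapping.lookup ?P m * mono_value ?s m" for m
  proof (cases "\<forall>i>N. VarX i \<notin> Poly_Mapping.keys m")
    case True
    then show ?thesis using Groth_lookup[OF w N] by simp
  next
    case False
    then obtain i where i: "i > N" "VarX i \<in> Poly_Mapping.keys m" by auto
    then have "v (int i) = int i" using v by (auto simp: fixes_above_def)
    then have "?s (VarX i) ^ Poly_Mapping.lookup m (VarX i) = 0"
      using i by (auto simp: in_keys_iff)
    then have "mono_value ?s m = 0"
      unfolding mono_value_def using i(2) by (intro prod_zero bexI[of _ "VarX i"]) simp_all
    then show ?thesis by simp
  qed
  have id: "ring_hom_fun (\<lambda>c::base. c)" by (simp add: ring_hom_fun_def)
  have "psi X w v = Sum_any (\<lambda>m. Poly_Mapping.lookup ?P m * mono_value ?s m)"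
    by (simp add: psi_def Phi_def eq)
  also have "\<dots> = (\<Sum>m\<in>Poly_Mapping.keys ?P. Poly_Mapping.lookup ?P m * mono_value ?s m)"
    by (rule Sum_any.expand_superset) (auto simp: in_keys_iff)
  also have "\<dots> = poly_eval (\<lambda>c. c) ?s ?P"
    by (simp add: poly_eval_def mono_value_eq)
  also have "\<dots> = hprod X beta (loc_word X N v) w"
  proof -
    have c: "poly_eval (\<lambda>c. c) ?s (const_coef c) = c" for c
      using poly_eval_const[OF id] by (simp add: const_coef_def)
    have "poly_eval (\<lambda>c. c) ?s (case_sum (\<lambda>i. const_coef (b_var (int i))) var_coef l)
        = case_sum (\<lambda>i. b_var (int i)) ?s l" for l
      using poly_eval_var[OF id, of ?s] c by (simp add: var_coef_def split: sum.split)
    then show ?thesis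
      unfolding Groth_fin_hprod hprod_hom[OF ring_hom_poly_eval[OF id]]
      by (simp add: c loc_word_def apsnd_def map_prod_def case_prod_unfold comp_def)
  qed
  finally show ?thesis .
qed

section \<open>Identities between products of the \<open>h\<^sub>i(x)\<close>\<close>

text \<open>A copy of the function space whose product is composition, so that operators form a
  \<open>monoid_mult\<close> and can be used with \<open>prod_list\<close> and
  \<open>mult.assoc\<close>.\<close>

datatype 'a endo = Endo (app: "'a \<Rightarrow> 'a")

instantiation endo :: (type) monoid_mult
begin

definition one_endo :: "'a endo" where
  "1 = Endo id"

definition times_endo :: "'a endo \<Rightarrow> 'a endo \<Rightarrow> 'a endo" where
  "p * q = Endo (app p \<circ> app q)"

instance
  by standard (simp_all add: one_endo_def times_endo_def o_assoc)

end

lemma app_one: "app 1 f = f" and app_mult: "app (p * q) f = app p (app q f)"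
  by (simp_all add: one_endo_def times_endo_def)

definition hop :: "cox_type \<Rightarrow> gen \<Rightarrow> base \<Rightarrow> ((int \<Rightarrow> int) \<Rightarrow> base) endo" where
  "hop X g x = Endo (\<lambda>f w. f w + x * hecke X beta g f w)"

lemma app_hop: "app (hop X g x) f = (\<lambda>w. f w + x * hecke X beta g f w)"
  by (simp add: hop_def)

lemma endo_eqI: "(\<And>f w. app p f w = app q f w) \<Longrightarrow> p = q"
  by (cases p; cases q) (auto simp: fun_eq_iff)

lemma hop_0 [simp]: "hop X g 0 = 1"
  by (rule endo_eqI) (simp add: app_hop app_one)

lemma hop_oplus: "hop X g x * hop X g y = hop X g (oplus x y)"
  by (rule endo_eqI)
     (simp add: app_mult app_hop hecke_add hecke_scale hecke_square oplus_def algebra_simps)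

lemma hop_commute:
  assumes "pair2 g k" shows "hop X g x * hop X k y = hop X k y * hop X g x"
  by (rule endo_eqI)
     (simp add: app_mult app_hop hecke_add hecke_scale hecke_pair2[OF assms] algebra_simps)

text \<open>Yang-Baxter equation of type A2: after expansion, the quadratic and braid relations
  match the two sides term by term.\<close>

lemma hop_braid:
  assumes "pair3 g k p q r"
  shows "hop X g x * (hop X k (oplus x y) * hop X g y) = hop X k y * (hop X g (oplus x y) * hop X k x)"
  by (rule endo_eqI)
     (simp add: app_mult app_hop hecke_add hecke_scale hecke_square hecke_pair3[OF assms] oplus_def algebra_simps)

text \<open>Besides the braid relation, only the coefficients of \<open>u\<^sub>0u\<^sub>1\<close> and \<open>u\<^sub>1u\<^sub>0\<close> matter.\<close>

lemma hop_braid4: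
  assumes c: "x * y + x * r + z * r + beta * (x * y * r + x * z * r) = y * z"
  shows "hop X (Gen 1) x * (hop X (Gen 0) y * (hop X (Gen 1) z * hop X (Gen 0) r))
    = hop X (Gen 0) r * (hop X (Gen 1) z * (hop X (Gen 0) y * hop X (Gen 1) x))"
proof (rule endo_eqI)
  fix f w
  define a b where "a = Gen 1" and "b = Gen 0"
  let ?a = "hecke X beta a" and ?b = "hecke X beta b"
  have br: "?a (?b (?a (?b F))) = ?b (?a (?b (?a F)))" for F
    unfolding a_def b_def by (rule hecke_pair4[symmetric])
  \<comment> \<open>\<open>S\<close> gathers the terms that agree for the product and its reversal,
    by the quadratic and braid relations alone.\<close>
  define S where "S = f w + (x + z + beta * x * z) * ?a f w + (y + r + beta * y * r) * ?b f w
    + x * y * z * ?a (?b (?a f)) w + y * z * r * ?b (?a (?b f)) w + x * y * z * r * ?b (?a (?b (?a f))) w"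
  have "app (hop X a x * (hop X b y * (hop X a z * hop X b r))) f w
    = S + (x * y + x * r + z * r + beta * (x * y * r + x * z * r)) * ?a (?b f) w + y * z * ?b (?a f) w"
    by (simp add: S_def app_mult app_hop hecke_add hecke_scale hecke_square br algebra_simps)
  moreover have "app (hop X b r * (hop X a z * (hop X b y * hop X a x))) f w
    = S + (x * y + x * r + z * r + beta * (x * y * r + x * z * r)) * ?b (?a f) w + y * z * ?a (?b f) w"
    by (simp add: S_def app_mult app_hop hecke_add hecke_scale hecke_square br algebra_simps)
  ultimately show "app (hop X (Gen 1) x * (hop X (Gen 0) y * (hop X (Gen 1) z * hop X (Gen 0) r))) f w
    = app (hop X (Gen 0) r * (hop X (Gen 1) z * (hop X (Gen 0) y * hop X (Gen 1) x))) f w"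
    unfolding c a_def b_def by simp
qed

lemma oplus_commute: "oplus x y = oplus y x"
  and oplus_assoc: "oplus (oplus x y) z = oplus x (oplus y z)"
  and oplus_0 [simp]: "oplus x 0 = x" "oplus 0 x = x"
  by (simp_all add: oplus_def algebra_simps)

abbreviation unit :: "base \<Rightarrow> bool" where
  "unit x \<equiv> 1 + beta * x \<noteq> 0"

lemma oplus_bar [simp]: "unit x \<Longrightarrow> oplus x (bar x) = 0" "unit x \<Longrightarrow> oplus (bar x) x = 0"
  using bar_cancel[of x] by (simp_all add: oplus_def algebra_simps)

lemma unit_bar: "unit x \<Longrightarrow> unit (bar x)"
  by (simp add: one_plus_beta_bar)

lemma oplus_bar_cancel: "unit y \<Longrightarrow> oplus y (oplus (bar y) x) = x"
  by (simp add: oplus_assoc[symmetric])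

definition Aop :: "cox_type \<Rightarrow> nat \<Rightarrow> nat \<Rightarrow> base \<Rightarrow> ((int \<Rightarrow> int) \<Rightarrow> base) endo" where
  "Aop X n i x = prod_list (map (\<lambda>j. hop X (Gen j) x) (rev [i..<n]))"

text \<open>The reversed product: the right arm of F, and the inverse of
  \<open>Aop X n i (bar x)\<close>.\<close>

definition Bop :: "cox_type \<Rightarrow> nat \<Rightarrow> nat \<Rightarrow> base \<Rightarrow> ((int \<Rightarrow> int) \<Rightarrow> base) endo" where
  "Bop X n i x = prod_list (map (\<lambda>j. hop X (Gen j) x) [i..<n])"

lemma Aop_rec: "i < n \<Longrightarrow> Aop X n i x = Aop X n (Suc i) x * hop X (Gen i) x"
  by (simp add: Aop_def upt_conv_Cons)

lemma Bop_rec: "i < n \<Longrightarrow> Bop X n i x = hop X (Gen i) x * Bop X n (Suc i) x"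
  by (simp add: Bop_def upt_conv_Cons)

lemma Aop_end [simp]: "Aop X n n x = 1" and Bop_end [simp]: "Bop X n n x = 1"
  by (simp_all add: Aop_def Bop_def)

lemma prod_list_commute:
  "(\<And>m. m \<in> set ms \<Longrightarrow> m * c = c * m) \<Longrightarrow> prod_list ms * c = c * (prod_list ms :: 'm::monoid_mult)"
proof (induction ms)
  case (Cons m ms)
  then have "m * c = c * m" "prod_list ms * c = c * prod_list ms" by simp_all
  then show ?case by (simp add: mult.assoc) (simp add: mult.assoc[symmetric])
qed simp

lemma Aop_commute:
  assumes "\<And>j. i \<le> j \<Longrightarrow> j < n \<Longrightarrow> pair2 g (Gen j)"
  shows "Aop X n i y * hop X g x = hop X g x * Aop X n i y"
  unfolding Aop_def using assms by (intro prod_list_commute) (auto intro: hop_commute[symmetric])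

lemma Bop_commute:
  assumes "\<And>j. i \<le> j \<Longrightarrow> j < n \<Longrightarrow> pair2 g (Gen j)"
  shows "Bop X n i y * hop X g x = hop X g x * Bop X n i y"
  unfolding Bop_def using assms by (intro prod_list_commute) (auto intro: hop_commute[symmetric])

text \<open>Downward induction on i. In the step h_i(x) moves past the factors of index at least i +
  2, the Yang-Baxter equation transforms the core in the letters i and i + 1, and the resulting
  h_{i+1}(z) feeds the induction hypothesis.\<close>

lemma Aop_exchange:
  assumes "1 \<le> i" "i < n"
  shows "Aop X n i x * (Aop X n (Suc i) (oplus x z) * hop X (Gen i) z) = Aop X n i (oplus x z) * Aop X n (Suc i) x"
  using assms
proof (induction "n - Suc i" arbitrary: i)
  case 0
  then have "n = Suc i" by simp
  then show ?case by (simp add: Aop_rec[of i] hop_oplus)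
next
  case (Suc d)
  let ?y = "oplus x z"
  have i: "i < n" "Suc i < n" using Suc.hyps(2) by simp_all
  have far: "pair2 (Gen i) (Gen j)" if "Suc (Suc i) \<le> j" "j < n" for j using that by (intro pair2_far) simp
  have c: "Aop X n (Suc (Suc i)) y * hop X (Gen i) u = hop X (Gen i) u * Aop X n (Suc (Suc i)) y" for y u
    using far by (rule Aop_commute)
  have IH: "Aop X n (Suc i) x * (Aop X n (Suc (Suc i)) ?y * hop X (Gen (Suc i)) z)
      = Aop X n (Suc i) ?y * Aop X n (Suc (Suc i)) x"
    using Suc.hyps(2) i by (intro Suc.hyps(1)) simp_all
  have "Aop X n i x * (Aop X n (Suc i) ?y * hop X (Gen i) z)
    = Aop X n (Suc i) x * (hop X (Gen i) x * Aop X n (Suc (Suc i)) ?y) * (hop X (Gen (Suc i)) ?y * hop X (Gen i) z)"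
    by (simp only: Aop_rec[OF i(1)] Aop_rec[OF i(2), of X ?y] mult.assoc)
  also have "\<dots> = Aop X n (Suc i) x * Aop X n (Suc (Suc i)) ?y
      * (hop X (Gen i) x * (hop X (Gen (Suc i)) ?y * hop X (Gen i) z))"
    by (simp only: c[symmetric] mult.assoc)
  also have "\<dots> = Aop X n (Suc i) x * (Aop X n (Suc (Suc i)) ?y * hop X (Gen (Suc i)) z)
      * (hop X (Gen i) ?y * hop X (Gen (Suc i)) x)"
    by (simp only: hop_braid[OF pair3_adjacent[OF Suc.prems(1)]] mult.assoc)
  also have "\<dots> = Aop X n (Suc i) ?y * (Aop X n (Suc (Suc i)) x * hop X (Gen i) ?y) * hop X (Gen (Suc i)) x"
    by (simp only: IH mult.assoc)
  also have "\<dots> = Aop X n i ?y * Aop X n (Suc i) x"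
    by (simp only: c Aop_rec[OF i(1)] Aop_rec[OF i(2), of X x] mult.assoc)
  finally show ?case .
qed

text \<open>The mirror image of \<open>Aop_exchange\<close>.\<close>

lemma Bop_exchange:
  assumes "1 \<le> i" "i < n"
  shows "hop X (Gen i) z * (Bop X n (Suc i) (oplus x z) * Bop X n i x) = Bop X n (Suc i) x * Bop X n i (oplus x z)"
  using assms
proof (induction "n - Suc i" arbitrary: i)
  case 0
  then have "n = Suc i" by simp
  then show ?case by (simp add: Bop_rec[of i] hop_oplus oplus_commute)
next
  case (Suc d)
  let ?y = "oplus x z"
  have i: "i < n" "Suc i < n" using Suc.hyps(2) by simp_all
  have far: "pair2 (Gen i) (Gen j)" if "Suc (Suc i) \<le> j" "j < n" for j using that by (intro pair2_far) simp
  have c: "Bop X n (Suc (Suc i)) y * hop X (Gen i) u = hop X (Gen i) u * Bop X n (Suc (Suc i)) y" for y u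
    using far by (rule Bop_commute)
  have IH: "hop X (Gen (Suc i)) z * (Bop X n (Suc (Suc i)) ?y * Bop X n (Suc i) x)
      = Bop X n (Suc (Suc i)) x * Bop X n (Suc i) ?y"
    using Suc.hyps(2) i by (intro Suc.hyps(1)) simp_all
  have yx: "oplus z x = ?y" by (rule oplus_commute)
  have "hop X (Gen i) z * (Bop X n (Suc i) ?y * Bop X n i x)
    = hop X (Gen i) z * hop X (Gen (Suc i)) ?y * (Bop X n (Suc (Suc i)) ?y * hop X (Gen i) x) * Bop X n (Suc i) x"
    by (simp only: Bop_rec[OF i(1)] Bop_rec[OF i(2), of X ?y] mult.assoc)
  also have "\<dots> = (hop X (Gen i) z * (hop X (Gen (Suc i)) (oplus z x) * hop X (Gen i) x))
      * (Bop X n (Suc (Suc i)) ?y * Bop X n (Suc i) x)"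
    by (simp only: c mult.assoc yx)
  also have "\<dots> = (hop X (Gen (Suc i)) x * (hop X (Gen i) (oplus z x) * hop X (Gen (Suc i)) z))
      * (Bop X n (Suc (Suc i)) ?y * Bop X n (Suc i) x)"
    by (simp only: hop_braid[OF pair3_adjacent[OF Suc.prems(1)]])
  also have "\<dots> = hop X (Gen (Suc i)) x * hop X (Gen i) ?y
      * (hop X (Gen (Suc i)) z * (Bop X n (Suc (Suc i)) ?y * Bop X n (Suc i) x))"
    by (simp only: mult.assoc yx)
  also have "\<dots> = hop X (Gen (Suc i)) x * (hop X (Gen i) ?y * Bop X n (Suc (Suc i)) x) * Bop X n (Suc i) ?y"
    by (simp only: IH mult.assoc)
  also have "\<dots> = Bop X n (Suc i) x * Bop X n i ?y"
    by (simp only: c[symmetric] Bop_rec[OF i(1)] Bop_rec[OF i(2), of X x] mult.assoc)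
  finally show ?case .
qed

lemma hop_bar: "unit x \<Longrightarrow> hop X g x * hop X g (bar x) = 1" "unit x \<Longrightarrow> hop X g (bar x) * hop X g x = 1"
  by (simp_all add: hop_oplus)

lemma Aop_Bop_inverse:
  assumes "unit x" "i \<le> n"
  shows "Aop X n i (bar x) * Bop X n i x = 1" "Bop X n i x * Aop X n i (bar x) = 1"
proof -
  have "Aop X n i (bar x) * Bop X n i x = 1 \<and> Bop X n i x * Aop X n i (bar x) = 1"
    using assms(2)
  proof (induction rule: inc_induct)
    case (step m)
    have "Aop X n m (bar x) * Bop X n m x
      = Aop X n (Suc m) (bar x) * (hop X (Gen m) (bar x) * hop X (Gen m) x) * Bop X n (Suc m) x"
      by (simp only: Aop_rec[OF step(2)] Bop_rec[OF step(2)] mult.assoc)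
    moreover have "Bop X n m x * Aop X n m (bar x)
      = hop X (Gen m) x * (Bop X n (Suc m) x * Aop X n (Suc m) (bar x)) * hop X (Gen m) (bar x)"
      by (simp only: Aop_rec[OF step(2)] Bop_rec[OF step(2)] mult.assoc)
    ultimately show ?case using step assms(1) by (simp add: hop_bar)
  qed simp
  then show "Aop X n i (bar x) * Bop X n i x = 1" "Bop X n i x * Aop X n i (bar x) = 1" by auto
qed

lemma Aop_Bop_inverse':
  assumes "unit x" "i \<le> n"
  shows "Aop X n i x * Bop X n i (bar x) = 1" "Bop X n i (bar x) * Aop X n i x = 1"
  using Aop_Bop_inverse[OF unit_bar[OF assms(1)] assms(2), of X] assms(1) by simp_all

text \<open>\<open>Aop_exchange\<close> at y, with z chosen so that
  \<open>oplus y z = x\<close>.\<close>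

lemma Aop_swap:
  assumes "1 \<le> i" "i < n" "unit y"
  shows "Aop X n i x * Aop X n (Suc i) y = Aop X n i y * (Aop X n (Suc i) x * hop X (Gen i) (oplus (bar y) x))"
  using Aop_exchange[OF assms(1,2), of X y "oplus (bar y) x"] by (simp add: oplus_bar_cancel assms(3))

lemma Bop_swap:
  assumes "1 \<le> i" "i < n" "unit y"
  shows "hop X (Gen i) (oplus (bar y) x) * (Bop X n (Suc i) x * Bop X n i y) = Bop X n (Suc i) y * Bop X n i x"
  using Bop_exchange[OF assms(1,2), of X "oplus (bar y) x" y] by (simp add: oplus_bar_cancel assms(3))

text \<open>The factor with argument \<open>oplus (bar y) x\<close> produced by
  \<open>Aop_swap\<close> combines with the remaining h_i(y) to h_i(x).\<close>

lemma Aop_Aop_commute: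
  assumes "1 \<le> i" "i < n" "unit y"
  shows "Aop X n i x * Aop X n i y = Aop X n i y * Aop X n i x"
proof -
  have "Aop X n i x * Aop X n i y = Aop X n i x * Aop X n (Suc i) y * hop X (Gen i) y"
    by (simp only: Aop_rec[OF assms(2), of X y] mult.assoc)
  also have "\<dots> = Aop X n i y * (Aop X n (Suc i) x * (hop X (Gen i) (oplus (bar y) x) * hop X (Gen i) y))"
    by (simp only: Aop_swap[OF assms] mult.assoc)
  also have "hop X (Gen i) (oplus (bar y) x) * hop X (Gen i) y = hop X (Gen i) x"
    by (simp add: hop_oplus oplus_commute[of _ y] oplus_bar_cancel assms(3))
  also have "Aop X n (Suc i) x * hop X (Gen i) x = Aop X n i x" by (simp only: Aop_rec[OF assms(2)])
  finally show ?thesis .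
qed

text \<open>\<open>Bop X n i x\<close> is the inverse of \<open>Aop X n i (bar x)\<close>, which
  commutes with \<open>Aop X n i y\<close>.\<close>

lemma Bop_Aop_commute:
  assumes "1 \<le> i" "i < n" "unit x" "unit y"
  shows "Bop X n i x * Aop X n i y = Aop X n i y * Bop X n i x"
proof -
  note inv = Aop_Bop_inverse[OF assms(3), of i n X]
  have "Bop X n i x * Aop X n i y = Bop X n i x * (Aop X n i y * Aop X n i (bar x)) * Bop X n i x"
    using inv assms(2) by (simp add: mult.assoc)
  also have "\<dots> = (Bop X n i x * Aop X n i (bar x)) * Aop X n i y * Bop X n i x"
    by (simp only: Aop_Aop_commute[OF assms(1,2) unit_bar[OF assms(3)], of X y] mult.assoc)
  finally show ?thesis using inv assms(2) by simp
qed

section \<open>The factors \<open>F\<close>\<close>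

definition Fop :: "cox_type \<Rightarrow> nat \<Rightarrow> base \<Rightarrow> ((int \<Rightarrow> int) \<Rightarrow> base) endo" where
  "Fop X n x = prod_list (map (\<lambda>g. hop X g x) (F_gens X n))"

text \<open>In type C, h_0(x)^2 is h_0 at \<open>oplus x x\<close>; with this argument types B and C
  share every computation.\<close>

definition c0 :: "cox_type \<Rightarrow> base \<Rightarrow> base" where
  "c0 X x = (if X = TypeC then oplus x x else x)"

lemma Fop_BC:
  assumes "X = TypeB \<or> X = TypeC"
  shows "Fop X n x = Aop X n 1 x * (hop X (Gen 0) (c0 X x) * Bop X n 1 x)"
  using assms by (auto simp: Fop_def Aop_def Bop_def c0_def comp_def hop_oplus[symmetric] mult.assoc)

lemma Fop_D: "Fop TypeD n x = Aop TypeD n 1 x * (hop TypeD GenHat1 x * Bop TypeD n 2 x)"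
  by (simp add: Fop_def Aop_def Bop_def comp_def)

lemma Fop_0 [simp]: "Fop X n 0 = 1"
  by (simp add: Fop_def map_replicate_const)

lemma pair2_hat: "1 \<le> j \<Longrightarrow> j \<noteq> 2 \<Longrightarrow> pair2 GenHat1 (Gen j)"
  by (rule pair2_GenHat1_Gen) auto

text \<open>The generators \<open>Gen 1\<close> and \<open>GenHat1\<close> commute, so the letter 1
  may stand on either side. This form serves for the right factor in products of two F.\<close>

lemma Fop_D':
  assumes "2 \<le> n" shows "Fop TypeD n x = Aop TypeD n 2 x * (hop TypeD GenHat1 x * Bop TypeD n 1 x)"
proof -
  let ?X = TypeD
  have 1: "1 < n" and 2: "Suc 1 = 2" using assms by simp_all
  have "Fop ?X n x = Aop ?X n 2 x * (hop ?X (Gen 1) x * hop ?X GenHat1 x * Bop ?X n 2 x)"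
    unfolding Fop_D by (simp only: Aop_rec[OF 1] 2 mult.assoc)
  also have "hop ?X (Gen 1) x * hop ?X GenHat1 x = hop ?X GenHat1 x * hop ?X (Gen 1) x"
    by (rule hop_commute[OF pair2_commute[OF pair2_hat]]) simp_all
  finally show ?thesis by (simp only: Bop_rec[OF 1] 2 mult.assoc)
qed

text \<open>Normal form for a product of two F: the inner \<open>Bop\<close> in x moves past the
  inner \<open>Aop\<close> in y, which leaves a core in \<open>Gen 0\<close> and
  \<open>Gen 1\<close> between two pairs of arms.\<close>

lemma Fop_Fop_BC:
  assumes "X = TypeB \<or> X = TypeC" "2 \<le> n" "unit x" "unit y"
  shows "Fop X n x * Fop X n y = Aop X n 1 x * (Aop X n 2 y
    * (hop X (Gen 0) (c0 X x) * (hop X (Gen 1) (oplus x y) * hop X (Gen 0) (c0 X y)) * (Bop X n 2 x * Bop X n 1 y)))"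
proof -
  let ?h0 = "hop X (Gen 0)" and ?h1 = "hop X (Gen 1)"
  have 1: "1 < n" and 2: "Suc 1 = 2" using assms by simp_all
  have far: "pair2 (Gen 0) (Gen j)" if "2 \<le> j" "j < n" for j using that by (intro pair2_far) simp
  have cA: "Aop X n 2 y * ?h0 u = ?h0 u * Aop X n 2 y" for y u using far by (rule Aop_commute)
  have cB: "Bop X n 2 y * ?h0 u = ?h0 u * Bop X n 2 y" for y u using far by (rule Bop_commute)
  have "Fop X n x * Fop X n y = Aop X n 1 x * (?h0 (c0 X x) * ((Bop X n 1 x * Aop X n 1 y) * (?h0 (c0 X y) * Bop X n 1 y)))"
    by (simp only: Fop_BC[OF assms(1)] mult.assoc)
  also have "Bop X n 1 x * Aop X n 1 y = Aop X n 1 y * Bop X n 1 x"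
    using 1 assms by (intro Bop_Aop_commute) simp_all
  also have "\<dots> = Aop X n 2 y * ((?h1 y * ?h1 x) * Bop X n 2 x)"
    by (simp only: Aop_rec[OF 1] Bop_rec[OF 1] 2 mult.assoc)
  also have "?h1 y * ?h1 x = ?h1 (oplus x y)" by (simp add: hop_oplus oplus_commute)
  also have "Aop X n 1 x * (?h0 (c0 X x) * (Aop X n 2 y * (?h1 (oplus x y) * Bop X n 2 x) * (?h0 (c0 X y) * Bop X n 1 y)))
    = Aop X n 1 x * ((?h0 (c0 X x) * Aop X n 2 y) * (?h1 (oplus x y) * ((Bop X n 2 x * ?h0 (c0 X y)) * Bop X n 1 y)))"
    by (simp only: mult.assoc)
  finally show ?thesis by (simp only: cA[symmetric] cB mult.assoc)
qed

text \<open>Once x is written as \<open>oplus y z\<close>, the coefficient condition of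
  \<open>hop_braid4\<close> is a polynomial identity, for the arguments of type B as well as those
  of type C.\<close>

lemma c0_braid4:
  assumes "z = oplus (bar y) x" "unit y"
  shows "hop X (Gen 1) z * (hop X (Gen 0) (c0 X x) * (hop X (Gen 1) (oplus x y) * hop X (Gen 0) (c0 X y)))
    = hop X (Gen 0) (c0 X y) * (hop X (Gen 1) (oplus x y) * (hop X (Gen 0) (c0 X x) * hop X (Gen 1) z))"
proof -
  have x: "x = oplus y z" using assms by (simp add: oplus_bar_cancel)
  show ?thesis
    unfolding x by (rule hop_braid4) (simp add: c0_def oplus_def algebra_simps)
qed

text \<open>As in types B and C, but the core in \<open>GenHat1\<close> and \<open>Gen 2\<close> is
  turned around by the Yang-Baxter equation and its outer factors h_2 are absorbed by the arms. A
  single factor of \<open>GenHat1\<close> remains; \<open>3 \<le> n\<close> provides the letter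
  2.\<close>

lemma Fop_Fop_D:
  assumes "3 \<le> n" "unit x" "unit y"
  shows "Fop TypeD n x * Fop TypeD n y = Aop TypeD n 1 x * (Aop TypeD n 2 y
    * (hop TypeD GenHat1 (oplus x y) * (Bop TypeD n 2 x * Bop TypeD n 1 y)))"
proof -
  let ?X = TypeD
  let ?k = "hop ?X GenHat1" and ?h2 = "hop ?X (Gen 2)"
  have 1: "2 < n" and 2: "Suc 2 = 3" and 3: "2 \<le> n" using assms by simp_all
  have cA: "Aop ?X n 3 y * ?k u = ?k u * Aop ?X n 3 y" for y u by (rule Aop_commute) (simp add: pair2_hat)
  have cB: "Bop ?X n 3 y * ?k u = ?k u * Bop ?X n 3 y" for y u by (rule Bop_commute) (simp add: pair2_hat)
  have "Fop ?X n x * Fop ?X n y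
    = Aop ?X n 1 x * (?k x * ((Bop ?X n 2 x * Aop ?X n 2 y) * (?k y * Bop ?X n 1 y)))"
    by (simp only: Fop_D[of n x] Fop_D'[OF 3, of y] mult.assoc)
  also have "Bop ?X n 2 x * Aop ?X n 2 y = Aop ?X n 2 y * Bop ?X n 2 x"
    using 1 assms by (intro Bop_Aop_commute) simp_all
  also have "\<dots> = Aop ?X n 3 y * ((?h2 y * ?h2 x) * Bop ?X n 3 x)"
    by (simp only: Aop_rec[OF 1] Bop_rec[OF 1] 2 mult.assoc)
  also have "?h2 y * ?h2 x = ?h2 (oplus x y)" by (simp add: hop_oplus oplus_commute)
  also have "Aop ?X n 1 x * (?k x * (Aop ?X n 3 y * (?h2 (oplus x y) * Bop ?X n 3 x) * (?k y * Bop ?X n 1 y)))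
    = Aop ?X n 1 x * ((?k x * Aop ?X n 3 y) * (?h2 (oplus x y) * ((Bop ?X n 3 x * ?k y) * Bop ?X n 1 y)))"
    by (simp only: mult.assoc)
  also have "\<dots> = Aop ?X n 1 x * (Aop ?X n 3 y * ((?k x * (?h2 (oplus x y) * ?k y)) * (Bop ?X n 3 x * Bop ?X n 1 y)))"
    by (simp only: cA[symmetric] cB mult.assoc)
  also have "?k x * (?h2 (oplus x y) * ?k y) = ?h2 y * (?k (oplus x y) * ?h2 x)"
    by (rule hop_braid[OF pair3_GenHat1])
  finally show ?thesis by (simp only: Aop_rec[OF 1] Bop_rec[OF 1] 2 mult.assoc)
qed

text \<open>Exchanging x and y in the left arms produces h_1(z), which passes through the core and
  is absorbed by the right arms. It passes by \<open>c0_braid4\<close> in types B and C; in type D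
  it commutes with the core.\<close>

lemma Fop_commute:
  assumes n: "3 \<le> n" and x: "unit x" and y: "unit y"
  shows "Fop X n x * Fop X n y = Fop X n y * Fop X n x"
proof -
  define z where "z = oplus (bar y) x"
  have 1: "1 < n" "2 \<le> n" and s: "Suc 1 = 2" using n by simp_all
  have A: "Aop X n 1 x * Aop X n 2 y = Aop X n 1 y * (Aop X n 2 x * hop X (Gen 1) z)"
    using Aop_swap[OF _ 1(1) y, of X x] unfolding z_def s by simp
  have B: "hop X (Gen 1) z * (Bop X n 2 x * Bop X n 1 y) = Bop X n 2 y * Bop X n 1 x"
    using Bop_swap[OF _ 1(1) y, of X x] unfolding z_def s by simp
  consider "X = TypeA" | "X = TypeB \<or> X = TypeC" | "X = TypeD" by (cases X) auto
  then show ?thesis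
  proof cases
    case 1
    then show ?thesis by (simp add: Fop_def)
  next
    case 2
    let ?h0 = "\<lambda>x. hop X (Gen 0) (c0 X x)" and ?h1 = "hop X (Gen 1)"
    have "Fop X n x * Fop X n y = (Aop X n 1 x * Aop X n 2 y) * ((?h0 x * (?h1 (oplus x y) * ?h0 y)) * (Bop X n 2 x * Bop X n 1 y))"
      by (simp only: Fop_Fop_BC[OF 2 1(2) x y] mult.assoc)
    also have "\<dots> = Aop X n 1 y * (Aop X n 2 x * ((?h1 z * (?h0 x * (?h1 (oplus x y) * ?h0 y))) * (Bop X n 2 x * Bop X n 1 y)))"
      by (simp only: A mult.assoc)
    also have "?h1 z * (?h0 x * (?h1 (oplus x y) * ?h0 y)) = ?h0 y * (?h1 (oplus x y) * (?h0 x * ?h1 z))"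
      by (rule c0_braid4[OF z_def y])
    also have "Aop X n 1 y * (Aop X n 2 x * ((?h0 y * (?h1 (oplus x y) * (?h0 x * ?h1 z))) * (Bop X n 2 x * Bop X n 1 y)))
      = Aop X n 1 y * (Aop X n 2 x * ((?h0 y * (?h1 (oplus x y) * ?h0 x)) * (?h1 z * (Bop X n 2 x * Bop X n 1 y))))"
      by (simp only: mult.assoc)
    also have "\<dots> = Fop X n y * Fop X n x"
      unfolding B Fop_Fop_BC[OF 2 1(2) y x] oplus_commute[of x y] ..
    finally show ?thesis .
  next
    case 3
    let ?k = "hop X GenHat1" and ?h1 = "hop X (Gen 1)"
    have F: "Fop X n u * Fop X n v = Aop X n 1 u * (Aop X n 2 v * (?k (oplus u v) * (Bop X n 2 u * Bop X n 1 v)))"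
      if "unit u" "unit v" for u v
      unfolding 3 by (rule Fop_Fop_D[OF n that])
    have "Fop X n x * Fop X n y = (Aop X n 1 x * Aop X n 2 y) * (?k (oplus x y) * (Bop X n 2 x * Bop X n 1 y))"
      by (simp only: F[OF x y] mult.assoc)
    also have "\<dots> = Aop X n 1 y * (Aop X n 2 x * ((?h1 z * ?k (oplus x y)) * (Bop X n 2 x * Bop X n 1 y)))"
      by (simp only: A mult.assoc)
    also have "?h1 z * ?k (oplus x y) = ?k (oplus x y) * ?h1 z"
      by (rule hop_commute[OF pair2_commute[OF pair2_hat]]) simp_all
    also have "Aop X n 1 y * (Aop X n 2 x * ((?k (oplus x y) * ?h1 z) * (Bop X n 2 x * Bop X n 1 y)))
      = Aop X n 1 y * (Aop X n 2 x * (?k (oplus x y) * (?h1 z * (Bop X n 2 x * Bop X n 1 y))))"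
      by (simp only: mult.assoc)
    also have "\<dots> = Fop X n y * Fop X n x"
      unfolding B F[OF y x] oplus_commute[of x y] ..
    finally show ?thesis .
  qed
qed

text \<open>The product collapses from the inside: \<open>Bop\<close> against \<open>Aop\<close>,
  then the central letter, then the outer arms.\<close>

lemma Fop_bar:
  assumes n: "2 \<le> n" and x: "unit x"
  shows "Fop X n (bar x) * Fop X n x = 1"
proof -
  consider "X = TypeA" | "X = TypeB \<or> X = TypeC" | "X = TypeD" by (cases X) auto
  then show ?thesis
  proof cases
    case 1
    then show ?thesis by (simp add: Fop_def)
  next
    case 2
    have "c0 X (bar x) = bar x \<and> c0 X x = x \<or> c0 X (bar x) = oplus (bar x) (bar x) \<and> c0 X x = oplus x x"
      by (simp add: c0_def)
    moreover have "oplus (oplus (bar x) (bar x)) (oplus x x) = oplus (bar x) (oplus (oplus (bar x) x) x)"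
      by (simp only: oplus_assoc)
    ultimately have c: "oplus (c0 X (bar x)) (c0 X x) = 0" using x by auto
    have "Fop X n (bar x) * Fop X n x = Aop X n 1 (bar x) * (hop X (Gen 0) (c0 X (bar x))
        * ((Bop X n 1 (bar x) * Aop X n 1 x) * hop X (Gen 0) (c0 X x)) * Bop X n 1 x)"
      by (simp only: Fop_BC[OF 2] mult.assoc)
    also have "\<dots> = 1"
      using n x by (simp add: Aop_Bop_inverse Aop_Bop_inverse' hop_oplus c)
    finally show ?thesis .
  next
    case 3
    have "Fop X n (bar x) * Fop X n x = Aop X n 1 (bar x) * (hop X GenHat1 (bar x)
        * ((Bop X n 2 (bar x) * Aop X n 2 x) * hop X GenHat1 x) * Bop X n 1 x)"
      unfolding 3 by (simp only: Fop_D[of n "bar x"] Fop_D'[OF n, of x] mult.assoc)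
    also have "\<dots> = 1"
      using n x by (simp add: Aop_Bop_inverse Aop_Bop_inverse' hop_oplus)
    finally show ?thesis .
  qed
qed

section \<open>The recursion\<close>

definition Eop :: "cox_type \<Rightarrow> (gen \<times> base) list \<Rightarrow> ((int \<Rightarrow> int) \<Rightarrow> base) endo" where
  "Eop X l = prod_list (map (\<lambda>(g, x). hop X g x) l)"

lemma Eop_simps [simp]:
  "Eop X [] = 1" "Eop X ((g, x) # l) = hop X g x * Eop X l" "Eop X (l @ l') = Eop X l * Eop X l'"
  by (simp_all add: Eop_def)

lemma Eop_concat: "Eop X (concat ls) = prod_list (map (Eop X) ls)"
  by (induction ls) simp_all

lemma hprod_Eop: "hprod X beta l = app (Eop X l) delta_id"
proof (induction l)
  case Nil
  show ?case by (simp add: app_one)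
next
  case (Cons p l)
  show ?case by (cases p, rule ext) (simp add: app_mult app_hop Cons.IH)
qed

definition Gop :: "cox_type \<Rightarrow> nat \<Rightarrow> (nat \<Rightarrow> base) \<Rightarrow> ((int \<Rightarrow> int) \<Rightarrow> base) endo" where
  "Gop X n a = prod_list (map (\<lambda>i. Aop X n i (a i)) [1..<n])"

definition Ginv :: "cox_type \<Rightarrow> nat \<Rightarrow> (nat \<Rightarrow> base) \<Rightarrow> ((int \<Rightarrow> int) \<Rightarrow> base) endo" where
  "Ginv X n b = Eop X (rev (map (apsnd b) (G_skel n)))"

definition FF :: "cox_type \<Rightarrow> nat \<Rightarrow> (nat \<Rightarrow> base) \<Rightarrow> ((int \<Rightarrow> int) \<Rightarrow> base) endo" where
  "FF X n x = prod_list (map (\<lambda>i. Fop X n (x i)) [1..<n+1])"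

lemma Gop_Eop: "Gop X n a = Eop X (map (apsnd a) (G_skel n))"
proof -
  have "Aop X n i x = Eop X (map (\<lambda>j. (Gen j, x)) (rev [i..<n]))" for i x
    by (simp add: Aop_def Eop_def comp_def)
  then show ?thesis
    by (simp add: Gop_def G_skel_def map_concat Eop_concat comp_def)
qed

lemma FF_Eop: "FF X n x = Eop X (concat (map (\<lambda>i. map (\<lambda>g. (g, x i)) (F_gens X n)) [1..<n+1]))"
proof -
  have "Fop X n y = Eop X (map (\<lambda>g. (g, y)) (F_gens X n))" for y
    by (simp add: Fop_def Eop_def comp_def)
  then show ?thesis by (simp add: FF_def Eop_concat comp_def)
qed

lemma Eop_Groth_word:
  "Eop X (map (apsnd s) (Groth_word X n))
   = Ginv X n (\<lambda>i. s (Inl i)) * (FF X n (\<lambda>i. s (Inr (VarX i))) * Gop X n (\<lambda>i. s (Inr (VarA i))))"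
  by (simp add: Groth_word_def Ginv_def FF_Eop Gop_Eop map_concat rev_map[symmetric] comp_def apsnd_compose)

lemma Gop_cong: "(\<And>i. 1 \<le> i \<Longrightarrow> a i = a' i) \<Longrightarrow> Gop X n a = Gop X n a'"
  unfolding Gop_def by (intro arg_cong[of _ _ prod_list] map_cong) auto

lemma FF_cong: "(\<And>i. 1 \<le> i \<Longrightarrow> x i = x' i) \<Longrightarrow> FF X n x = FF X n x'"
  unfolding FF_def by (intro arg_cong[of _ _ prod_list] map_cong) auto

lemma Eop_inverse:
  assumes "\<And>g i. (g, i) \<in> set K \<Longrightarrow> oplus (b i) (a i) = 0"
  shows "Eop X (rev (map (apsnd b) K)) * Eop X (map (apsnd a) K) = 1"
    and "Eop X (map (apsnd a) K) * Eop X (rev (map (apsnd b) K)) = 1"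
proof -
  have "Eop X (rev (map (apsnd b) K)) * Eop X (map (apsnd a) K) = 1
      \<and> Eop X (map (apsnd a) K) * Eop X (rev (map (apsnd b) K)) = 1"
    using assms
  proof (induction K)
    case (Cons k K)
    obtain g i where k: "k = (g, i)" by (cases k)
    let ?B = "Eop X (rev (map (apsnd b) K))" and ?A = "Eop X (map (apsnd a) K)"
    have IH: "?B * ?A = 1 \<and> ?A * ?B = 1"
      by (rule Cons.IH) (meson Cons.prems list.set_intros(2))
    have "oplus (b i) (a i) = 0" using Cons.prems[of g i] k by simp
    then have h: "hop X g (b i) * hop X g (a i) = 1" "hop X g (a i) * hop X g (b i) = 1"
      by (simp_all add: hop_oplus oplus_commute[of "a i"])
    have "?B * hop X g (b i) * (hop X g (a i) * ?A) = ?B * (hop X g (b i) * hop X g (a i)) * ?A"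
      "hop X g (a i) * ?A * (?B * hop X g (b i)) = hop X g (a i) * (?A * ?B) * hop X g (b i)"
      by (simp_all only: mult.assoc)
    then show ?case using IH h by (simp add: k)
  qed simp
  then show "Eop X (rev (map (apsnd b) K)) * Eop X (map (apsnd a) K) = 1"
    "Eop X (map (apsnd a) K) * Eop X (rev (map (apsnd b) K)) = 1" by auto
qed

lemma Ginv_Gop:
  assumes "\<And>i. 1 \<le> i \<Longrightarrow> unit (b i)"
  shows "Ginv X n b * Gop X n (\<lambda>i. bar (b i)) = 1" "Gop X n (\<lambda>i. bar (b i)) * Ginv X n b = 1"
proof -
  have "oplus (b i) (bar (b i)) = 0" if "(g, i) \<in> set (G_skel n)" for g i
    using assms G_skel_gens[OF that, of X] by simp
  then show "Ginv X n b * Gop X n (\<lambda>i. bar (b i)) = 1" "Gop X n (\<lambda>i. bar (b i)) * Ginv X n b = 1"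
    unfolding Gop_Eop Ginv_def by (intro Eop_inverse; blast)+
qed

definition Gtail :: "cox_type \<Rightarrow> nat \<Rightarrow> nat \<Rightarrow> (nat \<Rightarrow> base) \<Rightarrow> ((int \<Rightarrow> int) \<Rightarrow> base) endo" where
  "Gtail X n k a = prod_list (map (\<lambda>i. Aop X n i (a i)) [k..<n])"

lemma Gop_Gtail: "Gop X n a = Gtail X n 1 a"
  by (simp add: Gop_def Gtail_def)

lemma Gtail_rec: "k < n \<Longrightarrow> Gtail X n k a = Aop X n k (a k) * Gtail X n (Suc k) a"
  by (simp add: Gtail_def upt_conv_Cons)

lemma Gtail_cong: "(\<And>i. k \<le> i \<Longrightarrow> a i = a' i) \<Longrightarrow> Gtail X n k a = Gtail X n k a'"
  unfolding Gtail_def by (intro arg_cong[of _ _ prod_list] map_cong) auto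

lemma Gtail_commute:
  assumes "\<And>j. k \<le> j \<Longrightarrow> j < n \<Longrightarrow> pair2 g (Gen j)"
  shows "Gtail X n k a * hop X g x = hop X g x * Gtail X n k a"
  unfolding Gtail_def using assms by (intro prod_list_commute) (auto intro!: Aop_commute)

text \<open>Downward induction on k. At k = i, \<open>Aop_exchange\<close> swaps the values at i and
  i + 1 at the cost of h_i(z), which commutes with the factors of index at least i + 2; earlier
  factors are just prefixed.\<close>

lemma Gtail_swap:
  assumes "1 \<le> k" "k \<le> i" "i + 2 \<le> n"
    and a': "a' i = a (Suc i)" "a' (Suc i) = a i" "\<And>j. 1 \<le> j \<Longrightarrow> j \<noteq> i \<Longrightarrow> j \<noteq> Suc i \<Longrightarrow> a' j = a j"
    and z: "oplus (a i) z = a (Suc i)"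
  shows "Gtail X n k a' = Gtail X n k a * hop X (Gen i) z"
  using assms(2,1)
proof (induction rule: inc_induct)
  case base
  have i: "i < n" "Suc i < n" "1 \<le> i" using assms by simp_all
  let ?R = "Gtail X n (Suc (Suc i)) a"
  have R: "Gtail X n (Suc (Suc i)) a' = ?R" using i by (intro Gtail_cong a'(3)) auto
  have c: "?R * hop X (Gen i) z = hop X (Gen i) z * ?R" by (rule Gtail_commute) (simp add: pair2_far)
  have ex: "Aop X n i (a (Suc i)) * Aop X n (Suc i) (a i)
      = Aop X n i (a i) * (Aop X n (Suc i) (a (Suc i)) * hop X (Gen i) z)"
    using Aop_exchange[OF i(3,1), of X "a i" z] by (simp only: z)
  have "Gtail X n i a' = (Aop X n i (a (Suc i)) * Aop X n (Suc i) (a i)) * ?R"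
    by (simp only: Gtail_rec[OF i(1)] Gtail_rec[OF i(2)] R a'(1,2) mult.assoc)
  also have "\<dots> = Aop X n i (a i) * (Aop X n (Suc i) (a (Suc i)) * (hop X (Gen i) z * ?R))"
    unfolding ex by (simp only: mult.assoc)
  also have "\<dots> = Gtail X n i a * hop X (Gen i) z"
    by (simp only: c[symmetric] Gtail_rec[OF i(1)] Gtail_rec[OF i(2)] mult.assoc)
  finally show ?case .
next
  case (step k)
  then have k: "k < n" using assms by simp
  show ?case using step a'(3)[of k] by (simp add: Gtail_rec[OF k] mult.assoc)
qed

lemma prod_list_change:
  fixes f f' :: "'i \<Rightarrow> 'm::monoid_mult"
  assumes "distinct is" "j \<in> set is" "f j = c * f' j"
    and "\<And>i. i \<in> set is \<Longrightarrow> i \<noteq> j \<Longrightarrow> f i = f' i" "\<And>i. i \<in> set is \<Longrightarrow> c * f' i = f' i * c"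
  shows "prod_list (map f is) = c * prod_list (map f' is)"
  using assms
proof (induction "is")
  case (Cons i "is")
  show ?case
  proof (cases "i = j")
    case True
    then have "prod_list (map f is) = prod_list (map f' is)"
      using Cons.prems(1,4) by (intro arg_cong[of _ _ prod_list] map_cong) auto
    then show ?thesis using True Cons.prems(3) by (simp add: mult.assoc)
  next
    case False
    then have f: "f i = f' i" using Cons.prems by simp
    have IH: "prod_list (map f is) = c * prod_list (map f' is)"
      using False Cons.prems by (intro Cons.IH) auto
    have "f' i * (c * prod_list (map f' is)) = (c * f' i) * prod_list (map f' is)"
      using Cons.prems(5)[of i] by (simp add: mult.assoc[symmetric])
    then show ?thesis using f IH by (simp add: mult.assoc)
  qed
qed simp

text \<open>Since F(b_{-k}) F(b_k) = 1, switching b_{-k} on and switching b_k off cost the same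
  factor; it moves to the front because the F commute.\<close>

lemma FF_change:
  assumes n: "3 \<le> n" and j: "1 \<le> j" "j \<le> n" and k: "k > 0"
    and flip: "x j = b_var (- k) \<and> x' j = 0 \<or> x j = 0 \<and> x' j = b_var k"
    and eq: "\<And>i. 1 \<le> i \<Longrightarrow> i \<noteq> j \<Longrightarrow> x i = x' i" and u: "\<And>i. 1 \<le> i \<Longrightarrow> unit (x' i)"
  shows "FF X n x = Fop X n (b_var (- k)) * FF X n x'"
  unfolding FF_def
proof (rule prod_list_change)
  show "Fop X n (x j) = Fop X n (b_var (- k)) * Fop X n (x' j)"
    using flip Fop_bar[of n "b_var k" X] n k by (auto simp: bar_b_var)
  show "Fop X n (b_var (- k)) * Fop X n (x' i) = Fop X n (x' i) * Fop X n (b_var (- k))"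
    if "i \<in> set [1..<n + 1]" for i
    using that n u by (intro Fop_commute) auto
qed (use j eq in auto)

lemma intertwine:
  fixes C G G' H :: "'m::monoid_mult"
  assumes "C * G' = G * H" "I * G = 1" "G' * I' = 1"
  shows "I * C = H * I'"
proof -
  have "I * C = I * (C * G') * I'" using assms(3) by (simp add: mult.assoc)
  also have "\<dots> = I * G * H * I'" by (simp only: assms(1) mult.assoc)
  finally show ?thesis using assms(2) by simp
qed

lemma simple_root_Gen0: "simple_root X (Gen 0) = c0 X (bar (b_var 1))"
  by (simp add: simple_root_def c0_def)

text \<open>The right arm of F cancels the first factor A_1(b_1). The left arm is the new first
  factor, and the central letter, whose argument is the root, commutes with the factors of index at
  least 2.\<close>

lemma Gop_Gen0:
  assumes X: "X = TypeB \<or> X = TypeC" and n: "3 \<le> n"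
    and a: "a 1 = bar (b_var 1)" "a' 1 = b_var 1" "\<And>j. 2 \<le> j \<Longrightarrow> a' j = a j"
  shows "Fop X n (bar (b_var 1)) * Gop X n a' = Gop X n a * hop X (Gen 0) (simple_root X (Gen 0))"
proof -
  have 1: "1 < n" and 2: "Suc 1 = 2" using n by simp_all
  let ?x = "bar (b_var 1)" and ?R = "Gtail X n 2 a" and ?h = "hop X (Gen 0) (simple_root X (Gen 0))"
  have R: "Gtail X n 2 a' = ?R" by (intro Gtail_cong a(3))
  have c: "?R * ?h = ?h * ?R" by (rule Gtail_commute) (simp add: pair2_far)
  have inv: "Bop X n 1 ?x * Aop X n 1 (b_var 1) = 1" by (rule Aop_Bop_inverse') (use n in simp_all)
  have "Fop X n ?x * Gop X n a' = Aop X n 1 ?x * (?h * ((Bop X n 1 ?x * Aop X n 1 (b_var 1)) * ?R))"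
    by (simp only: Fop_BC[OF X] Gop_Gtail Gtail_rec[OF 1] 2 R a(2) simple_root_Gen0 mult.assoc)
  also have "\<dots> = Gop X n a * ?h"
    unfolding inv by (simp only: mult_1_left c[symmetric] Gop_Gtail Gtail_rec[OF 1] 2 a(1) mult.assoc)
  finally show ?thesis .
qed

text \<open>As for \<open>Gop_Gen0\<close>, with the two right arms cancelling the first two
  factors; the root is the argument of the core in \<open>Fop_Fop_D\<close>.\<close>

lemma Gop_GenHat1:
  assumes n: "3 \<le> n"
    and a: "a 1 = bar (b_var 1)" "a 2 = bar (b_var 2)" "a' 1 = b_var 2" "a' 2 = b_var 1"
      "\<And>j. 3 \<le> j \<Longrightarrow> a' j = a j"
  shows "Fop TypeD n (bar (b_var 1)) * Fop TypeD n (bar (b_var 2)) * Gop TypeD n a'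
    = Gop TypeD n a * hop TypeD GenHat1 (simple_root TypeD GenHat1)"
proof -
  let ?X = TypeD
  have 1: "1 < n" "2 < n" and 2: "Suc 1 = 2" "Suc 2 = 3" using n by simp_all
  let ?x = "bar (b_var 1)" and ?y = "bar (b_var 2)" and ?R = "Gtail ?X n 3 a"
    and ?h = "hop ?X GenHat1 (simple_root ?X GenHat1)"
  have r: "simple_root ?X GenHat1 = oplus ?x ?y" by (simp add: simple_root_def)
  have u: "unit ?x" "unit ?y" by (simp_all add: unit_bar)
  have R: "Gtail ?X n 3 a' = ?R" by (intro Gtail_cong a(5))
  have c: "?R * ?h = ?h * ?R" by (rule Gtail_commute) (simp add: pair2_hat)
  have inv: "Bop ?X n 1 ?y * Aop ?X n 1 (b_var 2) = 1" "Bop ?X n 2 ?x * Aop ?X n 2 (b_var 1) = 1"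
    by (rule Aop_Bop_inverse'; use n in simp)+
  have "Fop ?X n ?x * Fop ?X n ?y * Gop ?X n a'
    = Aop ?X n 1 ?x * (Aop ?X n 2 ?y * (?h * (Bop ?X n 2 ?x * ((Bop ?X n 1 ?y * Aop ?X n 1 (b_var 2)) * (Aop ?X n 2 (b_var 1) * ?R)))))"
    by (simp only: Fop_Fop_D[OF n u] Gop_Gtail Gtail_rec[OF 1(1)] Gtail_rec[OF 1(2)] 2 R a(3,4) r mult.assoc)
  also have "\<dots> = Aop ?X n 1 ?x * (Aop ?X n 2 ?y * (?h * ((Bop ?X n 2 ?x * Aop ?X n 2 (b_var 1)) * ?R)))"
    unfolding inv(1) by (simp only: mult_1_left mult.assoc)
  also have "\<dots> = Gop ?X n a * ?h"
    unfolding inv(2)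
    by (simp only: mult_1_left c[symmetric] Gop_Gtail Gtail_rec[OF 1(1)] Gtail_rec[OF 1(2)] 2 a(1,2) mult.assoc)
  finally show ?thesis .
qed

lemma Eop_recursion:
  assumes g: "g \<in> gens X" and v: "v \<in> Weyl X" "fixes_above N v" and N: "gen_index g + 2 \<le> N" "3 \<le> N"
  shows "Eop X (loc_word X N v)
    = hop X g (simple_root X g) * Eop X (map (apsnd (b_act g)) (loc_word X N (simple_refl g \<circ> v)))"
proof -
  let ?s = "simple_refl g"
  note sp = Weyl_signed_perm[OF v(1)]
  have v0: "v (int i) \<noteq> 0" if "1 \<le> i" for i using that signed_perm_eq_0_iff[OF sp] by simp
  have s0: "?s k = 0 \<longleftrightarrow> k = 0" for k by (rule signed_perm_eq_0_iff) simp
  define b b' where "b = (\<lambda>i. b_var (int i))" and "b' = (\<lambda>i. b_act g (b_var (int i)))"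
  define x x' where "x = (\<lambda>i. loc_subst v (VarX i))" and "x' = (\<lambda>i. b_act g (loc_subst (?s \<circ> v) (VarX i)))"
  define a a' where "a = (\<lambda>i. bar (b i))" and "a' = (\<lambda>i. bar (b' i))"
  define G where "G = Gop X N (\<lambda>i. loc_subst v (VarA i))"
  have "b_act g (loc_subst (?s \<circ> v) (VarA i)) = loc_subst v (VarA i)" if "1 \<le> i" for i
    using v0[OF that] s0 by (simp add: b_act_bar b_act_b_var)
  then have G': "Gop X N (\<lambda>i. b_act g (loc_subst (?s \<circ> v) (VarA i))) = G"
    unfolding G_def by (rule Gop_cong)
  have E: "Eop X (loc_word X N v) = Ginv X N b * (FF X N x * G)"
    by (simp add: loc_word_def Eop_Groth_word b_def x_def G_def)
  have lw: "map (apsnd h) (loc_word X N u)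
      = map (apsnd (\<lambda>l. h (case_sum (\<lambda>i. b_var (int i)) (loc_subst u) l))) (Groth_word X N)" for h u
    by (simp add: loc_word_def apsnd_compose comp_def)
  have E': "Eop X (map (apsnd (b_act g)) (loc_word X N (?s \<circ> v))) = Ginv X N b' * (FF X N x' * G)"
    unfolding lw Eop_Groth_word sum.case G' b'_def x'_def ..
  have b'_eq: "b' i = b_var (?s (int i))" if "1 \<le> i" for i
    using that by (simp add: b'_def b_act_b_var)
  \<comment> \<open>The value stays b_{v(i)} but is switched on by the sign of s_g(v(i)), so
    \<open>x\<close> and \<open>x'\<close> differ only where \<open>g\<close> changes a
    sign.\<close>
  have x'_eq: "x' i = (if ?s (v (int i)) < 0 then b_var (v (int i)) else 0)" if "1 \<le> i" for i
    using v0[OF that] s0 b_act_b_var[of "?s (v (int i))" g] by (simp add: x'_def b_act_simps)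
  have x_eq: "x i = (if v (int i) < 0 then b_var (v (int i)) else 0)" for i
    by (simp add: x_def)
  have ux': "unit (x' i)" and ux: "unit (x i)" if "1 \<le> i" for i
    using that by (simp_all add: x'_eq x_eq)
  have I: "Ginv X N b * Gop X N a = 1" "Gop X N a' * Ginv X N b' = 1"
    unfolding a_def a'_def by (rule Ginv_Gop; simp add: b_def b'_eq)+
  \<comment> \<open>Each absolute value up to \<open>N\<close> is taken at exactly one position;
    this locates the variables affected by a sign change.\<close>
  have pos: "\<exists>j. 1 \<le> j \<and> j \<le> N \<and> \<bar>v (int j)\<bar> = k \<and> (\<forall>i. 1 \<le> i \<longrightarrow> i \<noteq> j \<longrightarrow> \<bar>v (int i)\<bar> \<noteq> k)"
    if "0 < k" "k \<le> int N" for k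
  proof -
    have vinv: "v (inv v k) = k" using signed_perm_bij[OF sp] by (simp add: bij_is_surj surj_f_inv_f)
    have "\<bar>inv v k\<bar> \<le> int N"
      by (rule fixes_above_bound[OF bij_imp_bij_inv fixes_above_inv]) (use that v sp signed_perm_bij in auto)
    moreover have "inv v k \<noteq> 0" using vinv that signed_perm_0[OF sp] by auto
    moreover have "\<bar>v (int (nat \<bar>inv v k\<bar>))\<bar> = k"
      using vinv that signed_perm_odd[OF sp, of "inv v k"] by (cases "inv v k \<ge> 0") auto
    moreover have "i = nat \<bar>inv v k\<bar>" if i: "1 \<le> i" "\<bar>v (int i)\<bar> = k" for i
    proof -
      have "v (int i) = v (inv v k) \<or> v (int i) = v (- inv v k)"
        using i vinv signed_perm_odd[OF sp, of "inv v k"] by linarith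
      then have "int i = inv v k \<or> int i = - inv v k"
        using signed_perm_bij[OF sp] by (metis bij_is_inj injD)
      then show ?thesis by linarith
    qed
    ultimately show ?thesis by (intro exI[of _ "nat \<bar>inv v k\<bar>"]) auto
  qed
  obtain C where C: "FF X N x = C * FF X N x'" "C * Gop X N a' = Gop X N a * hop X g (simple_root X g)"
  proof (cases g)
    case [simp]: (Gen i)
    show thesis
    proof (cases "i = 0")
      case True
      then have X: "X = TypeB \<or> X = TypeC" using g by (cases X) auto
      obtain j where j: "1 \<le> j" "j \<le> N" "\<bar>v (int j)\<bar> = 1" "\<And>i. 1 \<le> i \<Longrightarrow> i \<noteq> j \<Longrightarrow> \<bar>v (int i)\<bar> \<noteq> 1"
        using pos[of 1] N by auto
      have "FF X N x = Fop X N (b_var (- 1)) * FF X N x'"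
      proof (rule FF_change[OF N(2) j(1,2)])
        show "x j = b_var (- 1) \<and> x' j = 0 \<or> x j = 0 \<and> x' j = b_var 1"
          using j(1,3) True by (auto simp: x_eq x'_eq simple_refl_Gen abs_if split: if_splits)
        show "x i = x' i" if "1 \<le> i" "i \<noteq> j" for i
          using j(4)[OF that] that True by (auto simp: x_eq x'_eq simple_refl_Gen)
      qed (use ux' in auto)
      moreover have "Fop X N (bar (b_var 1)) * Gop X N a' = Gop X N a * hop X (Gen 0) (simple_root X (Gen 0))"
      proof (rule Gop_Gen0[OF X N(2)])
        show "a 1 = bar (b_var 1)" "a' 1 = b_var 1"
          using True by (simp_all add: a_def a'_def b_def b'_eq simple_refl_Gen bar_b_var)
        show "a' j = a j" if "2 \<le> j" for j
          using True that by (simp add: a_def a'_def b_def b'_eq simple_refl_Gen)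
      qed
      ultimately show thesis using True that[of "Fop X N (b_var (- 1))"] by (simp add: bar_b_var)
    next
      case False
      \<comment> \<open>For i >= 1 no sign changes, so the correction factor is 1.\<close>
      have "FF X N x = FF X N x'"
        using False v0 by (intro FF_cong) (auto simp: x_eq x'_eq simple_refl_Gen)
      moreover have "Gtail X N 1 a' = Gtail X N 1 a * hop X (Gen i) (simple_root X (Gen i))"
      proof (rule Gtail_swap)
        show "a' i = a (Suc i)" "a' (Suc i) = a i"
          using False by (simp_all add: a_def a'_def b_def b'_eq simple_refl_Gen add.commute)
        show "a' j = a j" if "1 \<le> j" "j \<noteq> i" "j \<noteq> Suc i" for j
          using False that by (simp add: a_def a'_def b_def b'_eq simple_refl_Gen)
        show "oplus (a i) (simple_root X (Gen i)) = a (Suc i)"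
          using False by (simp add: simple_root_def a_def b_def oplus_assoc[symmetric] add.commute)
      qed (use False N in auto)
      ultimately show thesis using that[of 1] by (simp add: Gop_Gtail)
    qed
  next
    case [simp]: GenHat1
    then have X: "X = TypeD" using g by (cases X) auto
    obtain j where j: "1 \<le> j" "j \<le> N" "\<bar>v (int j)\<bar> = 1" "\<And>i. 1 \<le> i \<Longrightarrow> i \<noteq> j \<Longrightarrow> \<bar>v (int i)\<bar> \<noteq> 1"
      using pos[of 1] N by auto
    obtain k where k: "1 \<le> k" "k \<le> N" "\<bar>v (int k)\<bar> = 2" "\<And>i. 1 \<le> i \<Longrightarrow> i \<noteq> k \<Longrightarrow> \<bar>v (int i)\<bar> \<noteq> 2"
      using pos[of 2] N by auto
    have jk: "j \<noteq> k" using j k by auto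
    \<comment> \<open>Intermediate sequence, so that the two sign changes are made one at a
      time.\<close>
    define x'' where "x'' = x(j := x' j)"
    have "FF X N x = Fop X N (b_var (- 1)) * FF X N x''"
    proof (rule FF_change[OF N(2) j(1,2)])
      show "x j = b_var (- 1) \<and> x'' j = 0 \<or> x j = 0 \<and> x'' j = b_var 1"
        using j(1,3) by (auto simp: x''_def x_eq x'_eq simple_refl_GenHat1 abs_if split: if_splits)
    qed (use ux ux' in \<open>auto simp: x''_def\<close>)
    also have "FF X N x'' = Fop X N (b_var (- 2)) * FF X N x'"
    proof (rule FF_change[OF N(2) k(1,2)])
      show "x'' k = b_var (- 2) \<and> x' k = 0 \<or> x'' k = 0 \<and> x' k = b_var 2"
        using k(1,3) jk by (auto simp: x''_def x_eq x'_eq simple_refl_GenHat1 abs_if split: if_splits)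
      show "x'' i = x' i" if "1 \<le> i" "i \<noteq> k" for i
        using j(4)[of i] k(4)[of i] that by (auto simp: x''_def x_eq x'_eq simple_refl_GenHat1)
    qed (use ux' in auto)
    finally have "FF X N x = (Fop X N (b_var (- 1)) * Fop X N (b_var (- 2))) * FF X N x'"
      by (simp add: mult.assoc)
    moreover have "Fop TypeD N (bar (b_var 1)) * Fop TypeD N (bar (b_var 2)) * Gop TypeD N a'
      = Gop TypeD N a * hop TypeD GenHat1 (simple_root TypeD GenHat1)"
    proof (rule Gop_GenHat1[OF N(2)])
      show "a 1 = bar (b_var 1)" "a 2 = bar (b_var 2)" "a' 1 = b_var 2" "a' 2 = b_var 1"
        by (simp_all add: a_def a'_def b_def b'_eq simple_refl_GenHat1 bar_b_var)
      show "a' j = a j" if "3 \<le> j" for j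
        using that by (simp add: a_def a'_def b_def b'_eq simple_refl_GenHat1)
    qed
    ultimately show thesis
      using that[of "Fop X N (b_var (- 1)) * Fop X N (b_var (- 2))"] X by (simp add: bar_b_var)
  qed
  have "Ginv X N b * C = hop X g (simple_root X g) * Ginv X N b'"
    by (rule intertwine[OF C(2) I])
  then have "Ginv X N b * C * (FF X N x' * G) = hop X g (simple_root X g) * Ginv X N b' * (FF X N x' * G)"
    by simp
  then show ?thesis unfolding E E' C(1) by (simp only: mult.assoc)
qed

lemma psi_recursion:
  assumes w: "w \<in> Weyl X" and v: "v \<in> Weyl X" and g: "g \<in> gens X"
  shows "psi X w v = b_act g (psi X w (simple_refl g \<circ> v))
    + simple_root X g * hecke X beta g (\<lambda>u. b_act g (psi X u (simple_refl g \<circ> v))) w"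
proof -
  obtain M1 where M1: "fixes_above M1 w" using Weyl_signed_perm[OF w] by (auto simp: signed_perm_iff)
  obtain M2 where M2: "fixes_above M2 v" using Weyl_signed_perm[OF v] by (auto simp: signed_perm_iff)
  \<comment> \<open>The summand \<open>gen_index g\<close> keeps s_g w and s_g v in rank
    \<open>N\<close>; the 3 meets the size conditions of \<open>Eop_recursion\<close>.\<close>
  define N where "N = max M1 M2 + gen_index g + 3"
  have N: "gen_index g + 2 \<le> N" "3 \<le> N" "2 \<le> N" "gen_index g < N" by (simp_all add: N_def)
  have fw: "fixes_above N w" and fv: "fixes_above N v"
    using M1 M2 by (auto elim!: fixes_above_mono simp: N_def)
  let ?s = "simple_refl g"
  note fsw = fixes_above_simple_refl_comp[OF fw N(3,4)] and fsv = fixes_above_simple_refl_comp[OF fv N(3,4)]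
  let ?E = "Eop X (map (apsnd (b_act g)) (loc_word X N (?s \<circ> v)))"
  have hom: "ring_hom_fun (b_act g)" using ring_hom_b_endo by (simp add: b_act_eq)
  have E: "app ?E delta_id u = b_act g (psi X u (?s \<circ> v))" if "u \<in> Weyl X" "fixes_above N u" for u
    using hprod_hom[OF hom, of X beta "loc_word X N (?s \<circ> v)" u] psi_hprod[OF that fsv N(3)]
    by (simp add: b_act_beta hprod_Eop)
  have "psi X w v = app (hop X g (simple_root X g)) (app ?E delta_id) w"
    unfolding psi_hprod[OF w fw fv N(3)] hprod_Eop Eop_recursion[OF g v fv N(1,2)] app_mult ..
  also have "\<dots> = app ?E delta_id w + simple_root X g * hecke X beta g (app ?E delta_id) w"
    by (simp add: app_hop)
  \<comment> \<open>\<open>E\<close> is available only in rank \<open>N\<close>, but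
    \<open>hecke\<close> at w looks only at w and s_g w.\<close>
  also have "hecke X beta g (app ?E delta_id) w = hecke X beta g (\<lambda>u. b_act g (psi X u (?s \<circ> v))) w"
    by (simp add: hecke_def E[OF w fw] E[OF simple_refl_Weyl[OF g w] fsw])
  finally show ?thesis unfolding E[OF w fw] .
qed

text \<open>At the identity every x_i localizes to 0 and every a_i to the bar of b_i, so the F
  disappear and the two G cancel.\<close>

lemma psi_id:
  assumes w: "w \<in> Weyl X" shows "psi X w id = (if w = id then 1 else 0)"
proof -
  obtain M where M: "fixes_above M w" using Weyl_signed_perm[OF w] by (auto simp: signed_perm_iff)
  define N where "N = M + 2"
  have f: "fixes_above N w" using M by (rule fixes_above_mono) (simp add: N_def)
  have fi: "fixes_above N id" by (simp add: fixes_above_def)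
  have "FF X N (\<lambda>i. loc_subst id (VarX i)) = FF X N (\<lambda>i. 0)" by (rule FF_cong) simp
  also have "\<dots> = 1" by (simp add: FF_def map_replicate_const)
  finally have F: "FF X N (\<lambda>i. loc_subst id (VarX i)) = 1" .
  have "Eop X (loc_word X N id)
      = Ginv X N (\<lambda>i. b_var (int i)) * (FF X N (\<lambda>i. loc_subst id (VarX i)) * Gop X N (\<lambda>i. bar (b_var (int i))))"
    unfolding loc_word_def Eop_Groth_word by simp
  also have "\<dots> = 1" unfolding F by (simp add: Ginv_Gop)
  finally have "hprod X beta (loc_word X N id) = delta_id" by (simp add: hprod_Eop app_one)
  then show ?thesis
    using psi_hprod[OF w f fi] by (simp add: N_def delta_id_def delta_def)
qed

lemma Rb_closed: "0 \<in> Rb" "1 \<in> Rb" "beta \<in> Rb"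
  using Rb.zbeta[of 0] Rb.zbeta[of 1] Rb.zbeta[of "[:0, 1:]"]
  by (simp_all add: ring_hom_fun_simps[OF ring_hom_zbeta] beta_def)

lemma hprod_Rb:
  "(\<And>g x. (g, x) \<in> set l \<Longrightarrow> x \<in> Rb) \<Longrightarrow> hprod X beta l w \<in> Rb"
proof (induction l arbitrary: w)
  case Nil
  then show ?case by (simp add: delta_id_def delta_def Rb_closed)
next
  case (Cons p l)
  obtain g x where p: "p = (g, x)" by (cases p)
  have IH: "hprod X beta l u \<in> Rb" for u by (rule Cons.IH) (meson Cons.prems list.set_intros(2))
  have "hecke X beta g (hprod X beta l) w \<in> Rb"
    by (auto simp: hecke_def intro!: Rb.add Rb.mult IH Rb_closed)
  moreover have "x \<in> Rb" using Cons.prems[of g x] p by simp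
  ultimately show ?case by (simp add: p Rb.add Rb.mult IH)
qed

lemma Groth_word_labels:
  assumes "(g, l) \<in> set (Groth_word X n)"
  shows "\<exists>i\<ge>1. l = Inl i \<or> l = Inr (VarX i) \<or> l = Inr (VarA i)"
  using assms G_skel_gens[of _ _ n X] unfolding Groth_word_def by fastforce

text \<open>With the inverse of G written as a reversed word, every label is 0 or some b_k with k
  nonzero, so no further denominators arise.\<close>

lemma psi_Rb:
  assumes w: "w \<in> Weyl X" and v: "v \<in> Weyl X" shows "psi X w v \<in> Rb"
proof -
  obtain M1 where M1: "fixes_above M1 w" using Weyl_signed_perm[OF w] by (auto simp: signed_perm_iff)
  obtain M2 where M2: "fixes_above M2 v" using Weyl_signed_perm[OF v] by (auto simp: signed_perm_iff)
  define N where "N = max M1 M2 + 2"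
  have N: "2 \<le> N" and fw: "fixes_above N w" and fv: "fixes_above N v"
    using M1 M2 by (auto elim!: fixes_above_mono simp: N_def)
  have "x \<in> Rb" if "(g, x) \<in> set (loc_word X N v)" for g x
  proof -
    have "(g, x) \<in> apsnd (case_sum (\<lambda>i. b_var (int i)) (loc_subst v)) ` set (Groth_word X N)"
      using that by (simp add: loc_word_def)
    then obtain p where p: "(g, x) = apsnd (case_sum (\<lambda>i. b_var (int i)) (loc_subst v)) p" "p \<in> set (Groth_word X N)"
      by (rule imageE)
    define l where "l = snd p"
    have l: "(g, l) \<in> set (Groth_word X N)" "x = case_sum (\<lambda>i. b_var (int i)) (loc_subst v) l"
      using p by (cases p; simp add: l_def)+
    obtain i where i: "i \<ge> 1" "l = Inl i \<or> l = Inr (VarX i) \<or> l = Inr (VarA i)"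
      using Groth_word_labels[OF l(1)] by blast
    have "v (int i) \<noteq> 0" using i(1) signed_perm_eq_0_iff[OF Weyl_signed_perm[OF v]] by simp
    then show ?thesis using i l(2) by (auto simp: bar_b_var intro!: Rb.b_var Rb_closed)
  qed
  then show ?thesis unfolding psi_hprod[OF w fw fv N] by (rule hprod_Rb)
qed

theorem theorem2:
  fixes X :: cox_type
  shows "(\<forall>w\<in>Weyl X. \<forall>v\<in>Weyl X. psi X w v \<in> Rb) \<and>
    (\<forall>w\<in>Weyl X. psi X w id = (if w = id then 1 else 0)) \<and>
    (\<forall>w\<in>Weyl X. \<forall>v\<in>Weyl X. \<forall>g\<in>gens X. bruhat_less X (simple_refl g \<circ> v) v \<longrightarrow>
      (bruhat_less X w (simple_refl g \<circ> w) \<longrightarrow>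
         psi X w v = b_act g (psi X w (simple_refl g \<circ> v))) \<and>
      (bruhat_less X (simple_refl g \<circ> w) w \<longrightarrow>
         psi X w v = (1 + beta * simple_root X g) * b_act g (psi X w (simple_refl g \<circ> v))
                     + simple_root X g * b_act g (psi X (simple_refl g \<circ> w) (simple_refl g \<circ> v))))"
proof (intro conjI ballI impI)
  fix w v g assume w: "w \<in> Weyl X" and v: "v \<in> Weyl X" and g: "g \<in> gens X"
  note rec = psi_recursion[OF w v g] and d = desc_iff_cox_len[OF w g]
  show "psi X w v = b_act g (psi X w (simple_refl g \<circ> v))" if "bruhat_less X w (simple_refl g \<circ> w)"
  proof -
    have "\<not> desc g w" using bruhat_less_cox_len[OF that] d by simp
    then show ?thesis using rec by (simp add: hecke_def)
  qed
  show "psi X w v = (1 + beta * simple_root X g) * b_act g (psi X w (simple_refl g \<circ> v))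
      + simple_root X g * b_act g (psi X (simple_refl g \<circ> w) (simple_refl g \<circ> v))"
    if "bruhat_less X (simple_refl g \<circ> w) w"
  proof -
    have "desc g w" using bruhat_less_cox_len[OF that] d by simp
    \<comment> \<open>The \<open>beta\<close> term of \<open>hecke\<close> at a descent joins the
      first summand and gives the factor 1 + beta alpha.\<close>
    then show ?thesis using rec w g by (simp add: hecke_def algebra_simps)
  qed
qed (simp_all add: psi_Rb psi_id)

end
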